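(* Assume condition (C3) holds (with constants $T_3,c_3,\alpha_3$) and $A=0$. Let $\nu_s$ be a symmetric Lévy measure on $\mathbb{R}^d$ and suppose there is $a_1\in(0,1]$ with $a_1\nu_s(B)\le N(B)$ for all Borel $B$, and $a_2\in[1,\infty)$ such that $\mathrm{Re}[\Psi(x)]\le a_2\,\mathrm{Re}[\Psi_s(x)]$ for all $|x|>1/T_3$. Then for all $T,\theta>0$ there is a constant $\tilde c>0$ depending only on $d,\alpha_3,c_3,T_3,a_1,a_2,\nu_s,T,\theta$ such that for all $0<t<T$ and $|x|\le\theta h_s^{-1}(1/t)$, $$p(t,x+t b_{h_s^{-1}(1/t)})\ge\tilde c\,[h_s^{-1}(1/t)]^{-d}.$$ If $T_3=\infty$, then this holds with $T=\infty$ and some $\tilde c>0$.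
   Context: $Y$ is a Lévy process in $\mathbb{R}^d$ with generating triplet $(A,N,b)$ ($A$ symmetric non-negative definite, $b\in\mathbb{R}^d$, $N$ Lévy measure), characteristic exponent $\Psi$ ($\mathbb{E}e^{i\langle x,Y_t\rangle}=e^{-t\Psi(x)}$), $\Psi^*(r)=\sup_{|z|\le r}\mathrm{Re}\,\Psi(z)$, $b_r=b+\int z(\mathbf{1}_{|z|<r}-\mathbf{1}_{|z|<1})N(dz)$, $p(t,x)$ the density of $Y_t$. Condition (C3): there are $T_3\in(0,\infty]$, $c_3\in(0,1]$, $\alpha_3\in(0,2]$ with $c_3\Psi^*(|x|)\le\mathrm{Re}\Psi(x)$ for all $|x|>1/T_3$ and $\Psi^*(\lambda r)\ge c_3\lambda^{\alpha_3}\Psi^*(r)$ for all $\lambda\ge1$, $r>1/T_3$ ($1/\infty=0$). $\Psi_s$ and $h_s$ are the characteristic exponent and $h$-function of the triplet $(0,\nu_s,0)$: $\Psi_s(x)=\int(1-\cos\langle x,z\rangle)\nu_s(dz)$, $h_s(r)=\int(1\wedge|z|^2/r^2)\nu_s(dz)$; $h_s^{-1}$ is the inverse of the (continuous, strictly decreasing, unbounded under the hypotheses) function $h_s$. *)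

theory Defs
  imports "HOL-Analysis.Analysis"
begin

definition levy_measure :: "'a::euclidean_space measure \<Rightarrow> bool" where
  "levy_measure N \<longleftrightarrow> sets N = sets borel \<and> emeasure N {0} = 0 \<and>
     (\<integral>\<^sup>+ z. ennreal (min 1 (norm z ^ 2)) \<partial>N) < \<infinity>"

definition symmetric_measure :: "'a::euclidean_space measure \<Rightarrow> bool" where
  "symmetric_measure N \<longleftrightarrow> (\<forall>B\<in>sets borel. emeasure N (uminus ` B) = emeasure N B)"

text \<open>Characteristic exponent of the triplet (0,N,b), convention
  E exp(i<x,Y_t>) = exp(-t Psi(x)).\<close>
definition levy_exp :: "'a::euclidean_space measure \<Rightarrow> 'a \<Rightarrow> 'a \<Rightarrow> complex" where
  "levy_exp N b x = - \<i> * complex_of_real (b \<bullet> x) +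
     (\<integral> z. (1 - cis (x \<bullet> z) + \<i> * complex_of_real (x \<bullet> z) * indicator (ball 0 1) z) \<partial>N)"

definition Psi_star :: "'a::euclidean_space measure \<Rightarrow> 'a \<Rightarrow> real \<Rightarrow> real" where
  "Psi_star N b r = (SUP z\<in>cball 0 r. Re (levy_exp N b z))"

definition drift_r :: "'a::euclidean_space measure \<Rightarrow> 'a \<Rightarrow> real \<Rightarrow> 'a" where
  "drift_r N b r = b + (\<integral> z. (indicator (ball 0 r) z - indicator (ball 0 1) z) *\<^sub>R z \<partial>N)"

definition Psi_s :: "'a::euclidean_space measure \<Rightarrow> 'a \<Rightarrow> real" where
  "Psi_s \<nu> x = (\<integral> z. 1 - cos (x \<bullet> z) \<partial>\<nu>)"

definition h_fun :: "'a::euclidean_space measure \<Rightarrow> real \<Rightarrow> real" where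
  "h_fun \<nu> r = (\<integral> z. min 1 (norm z ^ 2 / r ^ 2) \<partial>\<nu>)"

definition h_inv :: "'a::euclidean_space measure \<Rightarrow> real \<Rightarrow> real" where
  "h_inv \<nu> u = (THE r. r > 0 \<and> h_fun \<nu> r = u)"

text \<open>Condition (C3); T3 is in (0,\<infinity>] as an extended real, 1/\<infinity> = 0.\<close>
definition cond_C3 :: "'a::euclidean_space measure \<Rightarrow> 'a \<Rightarrow> ereal \<Rightarrow> real \<Rightarrow> real \<Rightarrow> bool" where
  "cond_C3 N b T3 c3 \<alpha>3 \<longleftrightarrow> 0 < T3 \<and> 0 < c3 \<and> c3 \<le> 1 \<and> 0 < \<alpha>3 \<and> \<alpha>3 \<le> 2 \<and>
     (\<forall>x. ereal (norm x) > 1 / T3 \<longrightarrow> c3 * Psi_star N b (norm x) \<le> Re (levy_exp N b x)) \<and>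
     (\<forall>l r. l \<ge> 1 \<and> ereal r > 1 / T3 \<longrightarrow>
         Psi_star N b (l * r) \<ge> c3 * l powr \<alpha>3 * Psi_star N b r)"

text \<open>p t is the (continuous) density of Y_t, where Y is the Levy process with
  triplet (0,N,b): its Fourier transform is exp(-t Psi).\<close>
definition levy_density :: "'a::euclidean_space measure \<Rightarrow> 'a \<Rightarrow> (real \<Rightarrow> 'a \<Rightarrow> real) \<Rightarrow> bool" where
  "levy_density N b p \<longleftrightarrow> (\<forall>t>0. continuous_on UNIV (p t) \<and> (\<forall>y. 0 \<le> p t y) \<and>
     integrable lborel (p t) \<and>
     (\<forall>\<xi>. (\<integral> y. cis (\<xi> \<bullet> y) * complex_of_real (p t y) \<partial>lborel)
            = exp (- (complex_of_real t * levy_exp N b \<xi>))))"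

definition thm43_hyps ::
  "'a::euclidean_space measure \<Rightarrow> 'a \<Rightarrow> (real \<Rightarrow> 'a \<Rightarrow> real) \<Rightarrow> ereal \<Rightarrow> real \<Rightarrow> real \<Rightarrow>
   'a measure \<Rightarrow> real \<Rightarrow> real \<Rightarrow> bool" where
  "thm43_hyps N b p T3 c3 \<alpha>3 \<nu>s a1 a2 \<longleftrightarrow>
     levy_measure N \<and> cond_C3 N b T3 c3 \<alpha>3 \<and> levy_density N b p \<and>
     (\<forall>B\<in>sets borel. ennreal a1 * emeasure \<nu>s B \<le> emeasure N B) \<and>
     (\<forall>x. ereal (norm x) > 1 / T3 \<longrightarrow> Re (levy_exp N b x) \<le> a2 * Psi_s \<nu>s x)"

end

theory Submission
  imports Defs "HOL-Probability.Probability"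
begin

text \<open>
  Put \<open>r = h\<^sub>s\<^sup>-\<^sup>1(1/t)\<close>. Since \<open>a\<^sub>1 \<nu>\<^sub>s \<le> N\<close>, the jump measure splits as
  \<open>t N = (t a\<^sub>1 / 2) \<nu>\<^sub>s + \<tau> \<nu>\<^sub>s|\<^bsub>cball 0 s\<^esub> + w N\<close>, and the law of the process is the convolution of the
  corresponding laws.

  The first law has a real and integrable characteristic function, with the decay given by (C3); hence its
  density is at least of order \<open>r\<^sup>-\<^sup>d\<close> on some small ball of radius comparable with \<open>r\<close>. The second law, of
  symmetric jumps of size at most \<open>s = \<kappa> r\<close>, is cut into \<open>n\<close> equal pieces. Each of them enlarges the ball on
  which the lower bound holds: from a point just outside the ball, one of the two opposite displacements
  leads inside, and \<open>1 - cos\<close> bounds from below the probability of a displacement that is large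
  enough. A bounded number \<open>n\<close> of pieces leads to a ball of any prescribed multiple of \<open>r\<close>. Of the third law
  one only needs that with a probability bounded from below there is no jump of size at least \<open>r\<close> and the
  compensated sum of the other jumps is of order \<open>r\<close>.

  Infinite jump measures are approximated by finite ones, for which the laws are compound Poisson, and
  all laws act on functions of the form \<open>inv_ft F\<close>; a Gaussian factor in \<open>F\<close> makes everything
  integrable and is removed at the end by the continuity of the density.
\<close>

section \<open>Compound Poisson laws\<close>

text \<open>The constant has to be fixed before \<open>N\<close>, \<open>b\<close> and
  \<open>p\<close>, while (C3) speaks only of frequencies above \<open>1 / T3\<close>. Everything is
  therefore measured at a scale \<open>q = r / k0\<close> with \<open>k0\<close> so large that
  \<open>1 / q\<close> exceeds \<open>1 / T3\<close>. Between \<open>q\<close> and \<open>r\<close>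
  the function \<open>h_fun\<close> changes by a factor of at most \<open>k0^2\<close>, so
  \<open>t * h_fun \<nu> q\<close> lies between 1 and \<open>k0^2\<close>. What shapes the proof is
  the choice of the second law. Let \<open>H / 2\<close> be its total intensity. A piece moves by at
  most order \<kappa> q, and usefully by a of order \<kappa> q sqrt(H/n), so n pieces gain order
  \<kappa> q sqrt(n H); to reach a multiple L of q, n must be of order L^2 / (\<kappa>^2 H).
  Sideways motion is harmless only if (\<kappa> q)^2 is at most of order q a, that is, \<kappa> at
  most of order sqrt(H/n). Together these force H to be a large constant. Such an H is affordable
  because (C3) makes \<open>t * h_fun \<nu> (\<kappa> * q)\<close> at least of order \<kappa> to the
  power -\<alpha>. Hence H is chosen first, then \<kappa>, then n. Gain and error of one piece are
  both proportional to H/n, so a large n does not spoil their ratio.\<close>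

lemma borel_measurable_cis [measurable (raw)]:
  "f \<in> borel_measurable M \<Longrightarrow> (\<lambda>x. cis (f x)) \<in> borel_measurable M"
  by (rule measurable_compose[where g = cis and N = borel])
     (auto intro!: borel_measurable_continuous_onI continuous_intros)

definition char_fn :: "'a::euclidean_space measure \<Rightarrow> 'a \<Rightarrow> complex" where
  "char_fn Q \<xi> = (LINT z|Q. cis (\<xi> \<bullet> z))"

definition borel_prob :: "'a::euclidean_space measure \<Rightarrow> bool" where
  "borel_prob Q \<longleftrightarrow> prob_space Q \<and> sets Q = sets borel"

lemma integrable_bounded_borel:
  fixes f :: "'a::euclidean_space \<Rightarrow> 'b::{banach, second_countable_topology}"
  assumes "finite_measure Q" "sets Q = sets borel" "f \<in> borel_measurable borel" "\<And>x. norm (f x) \<le> B"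
  shows "integrable Q f"
proof -
  interpret finite_measure Q by fact
  have [measurable]: "f \<in> borel_measurable Q"
    using assms(3) by (simp add: measurable_cong_sets[OF assms(2) refl])
  show ?thesis
    by (rule integrable_const_bound[where B=B]) (use assms in auto)
qed

lemma integrable_cis:
  fixes \<xi> :: "'a::euclidean_space"
  assumes "finite_measure Q" "sets Q = sets borel"
  shows "integrable Q (\<lambda>z. cis (\<xi> \<bullet> z))"
  by (rule integrable_bounded_borel[OF assms, where B=1]) auto

lemma Re_char_fn:
  fixes \<xi> :: "'a::euclidean_space"
  assumes "finite_measure Q" "sets Q = sets borel"
  shows "Re (char_fn Q \<xi>) = (LINT z|Q. cos (\<xi> \<bullet> z))"
  using integral_Re[OF integrable_cis[OF assms, of \<xi>]] by (simp add: char_fn_def)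

lemma Im_char_fn:
  fixes \<xi> :: "'a::euclidean_space"
  assumes "finite_measure Q" "sets Q = sets borel"
  shows "Im (char_fn Q \<xi>) = (LINT z|Q. sin (\<xi> \<bullet> z))"
  using integral_Im[OF integrable_cis[OF assms, of \<xi>]] by (simp add: char_fn_def)

lemma borel_probD:
  assumes "borel_prob Q"
  shows "prob_space Q" "finite_measure Q" "sets Q = sets borel" "space Q = UNIV"
  using assms by (auto simp: borel_prob_def prob_space.finite_measure dest: sets_eq_imp_space_eq)

lemma norm_char_fn_le:
  assumes "borel_prob Q"
  shows "norm (char_fn Q \<xi>) \<le> 1"
proof -
  interpret prob_space Q using borel_probD[OF assms] by auto
  have "norm (char_fn Q \<xi>) \<le> (LINT z|Q. norm (cis (\<xi> \<bullet> z)))"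
    unfolding char_fn_def by (rule integral_norm_bound)
  then show ?thesis using prob_space by simp
qed

lemma borel_measurable_char_fn:
  assumes "borel_prob Q"
  shows "char_fn Q \<in> borel_measurable borel"
proof -
  interpret prob_space Q using borel_probD[OF assms] by auto
  note [measurable_cong] = borel_probD(3)[OF assms]
  show ?thesis unfolding char_fn_def
    by (rule borel_measurable_lebesgue_integral) simp
qed

primrec conv_power :: "'a::euclidean_space measure \<Rightarrow> nat \<Rightarrow> 'a measure" where
  "conv_power M 0 = return borel 0"
| "conv_power M (Suc k) = distr (M \<Otimes>\<^sub>M conv_power M k) borel (\<lambda>(x, y). x + y)"

lemma borel_prob_conv_power:
  assumes "borel_prob M"
  shows "borel_prob (conv_power M k)"
proof (induction k)
  case 0
  then show ?case by (simp add: borel_prob_def prob_space_return)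
next
  case (Suc k)
  interpret M: prob_space M using borel_probD[OF assms] by auto
  interpret K: prob_space "conv_power M k" using borel_probD[OF Suc] by auto
  interpret pair_prob_space M "conv_power M k" ..
  note [measurable_cong] = borel_probD(3)[OF assms] borel_probD(3)[OF Suc]
  show ?case unfolding borel_prob_def
    by (auto intro!: prob_space_distr)
qed

lemma char_fn_conv_power:
  assumes "borel_prob M"
  shows "char_fn (conv_power M k) \<xi> = char_fn M \<xi> ^ k"
proof (induction k)
  case 0
  show ?case unfolding char_fn_def by (simp add: integral_return)
next
  case (Suc k)
  note K = borel_prob_conv_power[OF assms, of k]
  interpret M: prob_space M using borel_probD[OF assms] by auto
  interpret K: prob_space "conv_power M k" using borel_probD[OF K] by auto
  interpret pair_prob_space M "conv_power M k" ..
  note [measurable_cong] = borel_probD(3)[OF assms] borel_probD(3)[OF K]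
  have "char_fn (conv_power M (Suc k)) \<xi>
      = (\<integral>w. cis (\<xi> \<bullet> (fst w + snd w)) \<partial>(M \<Otimes>\<^sub>M conv_power M k))"
    by (simp add: char_fn_def integral_distr case_prod_beta)
  also have "\<dots> = (\<integral>x. (\<integral>y. cis (\<xi> \<bullet> (x + y)) \<partial>conv_power M k) \<partial>M)"
    by (subst integral_fst'[symmetric])
       (auto intro!: integrable_const_bound[where B=1])
  also have "\<dots> = (LINT x|M. cis (\<xi> \<bullet> x) * char_fn (conv_power M k) \<xi>)"
    by (simp add: char_fn_def inner_add_right cis_mult[symmetric])
  also have "\<dots> = char_fn M \<xi> * char_fn (conv_power M k) \<xi>"
    by (simp add: char_fn_def)
  finally show ?case using Suc by simp
qed

text \<open>The generating function of the Poisson law at a complex point of the closed unit disc.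
  It is evaluated at \<open>char_fn M \<xi>\<close>, the transform of a single jump.\<close>

lemma integral_poisson_pmf_power:
  fixes w :: complex
  assumes "0 < l" "norm w \<le> 1"
  shows "(\<integral>k. w ^ k \<partial>measure_pmf (poisson_pmf l)) = exp (of_real l * (w - 1))"
    and "integrable (measure_pmf (poisson_pmf l)) (\<lambda>k. w ^ k)"
proof -
  show int: "integrable (measure_pmf (poisson_pmf l)) (\<lambda>k. w ^ k)"
    by (rule measure_pmf.integrable_const_bound[where B=1])
       (use assms in \<open>auto simp: norm_power power_le_one\<close>)
  have *: "integrable (count_space UNIV) (\<lambda>k. pmf (poisson_pmf l) k *\<^sub>R w ^ k)"
    using int unfolding measure_pmf_eq_density by (subst (asm) integrable_density) auto
  have "(\<integral>k. w ^ k \<partial>measure_pmf (poisson_pmf l))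
     = (\<integral>k. pmf (poisson_pmf l) k *\<^sub>R w ^ k \<partial>count_space UNIV)"
    unfolding measure_pmf_eq_density by (subst integral_density) auto
  also have "\<dots> = (\<Sum>k. pmf (poisson_pmf l) k *\<^sub>R w ^ k)"
    using sums_integral_count_space_nat[OF *] by (simp add: sums_iff)
  also have "\<dots> = (\<Sum>k. of_real (exp (- l)) * ((of_real l * w) ^ k /\<^sub>R fact k))"
    using assms by (intro suminf_cong)
      (simp add: scaleR_conv_of_real power_mult_distrib divide_inverse mult_ac)
  also have "\<dots> = of_real (exp (- l)) * exp (of_real l * w)"
    by (subst suminf_mult[OF summable_exp_generic]) (simp add: exp_def)
  also have "\<dots> = exp (of_real l * (w - 1))"
    by (simp add: exp_of_real[symmetric] exp_add[symmetric] algebra_simps)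
  finally show "(\<integral>k. w ^ k \<partial>measure_pmf (poisson_pmf l)) = exp (of_real l * (w - 1))" .
qed

text \<open>Given \<open>k\<close> jumps the transform is \<open>char_fn M \<xi> ^ k\<close>;
  averaging over a Poisson number of jumps produces the exponential.\<close>

lemma compound_poisson_prob:
  fixes M :: "'a::euclidean_space measure"
  assumes M: "borel_prob M" and l: "0 < l"
  defines "Q \<equiv> measure_pmf (poisson_pmf l) \<bind> conv_power M"
  shows "borel_prob Q" "char_fn Q \<xi> = exp (of_real l * (char_fn M \<xi> - 1))"
    "measure Q {0} \<ge> exp (- l)"
proof -
  note K = borel_prob_conv_power[OF M]
  have m [measurable]: "conv_power M \<in> measurable (measure_pmf (poisson_pmf l)) (subprob_algebra borel)"
    using K by (auto simp: space_subprob_algebra borel_prob_def prob_space_imp_subprob_space)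
  have sets: "sets Q = sets borel"
    unfolding Q_def by (rule sets_bind) (use K in \<open>auto simp: borel_prob_def\<close>)
  have prob: "prob_space Q"
    unfolding Q_def by (rule measure_pmf.prob_space_bind[OF _ m]) (use K in \<open>auto simp: borel_prob_def\<close>)
  show Q: "borel_prob Q" using sets prob by (simp add: borel_prob_def)
  \<comment> \<open>Conditioning on the number of jumps is done for bounded real functions, hence
    separately for the real and the imaginary part of the transform.\<close>
  have ib: "(LINT z|Q. f z) = (\<integral>k. (\<integral>z. f z \<partial>conv_power M k) \<partial>measure_pmf (poisson_pmf l))"
    if "f \<in> borel_measurable borel" "\<And>x. \<bar>f x\<bar> \<le> 1" for f :: "'a \<Rightarrow> real"
    unfolding Q_def
    by (rule integral_bind[where K=borel and B=1 and B'=1])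
       (use that K m in \<open>auto simp: borel_prob_def prob_space.emeasure_space_1 measure_pmf.finite_measure\<close>)
  note pw = integral_poisson_pmf_power[OF l norm_char_fn_le[OF M, of \<xi>]]
  have "Re (char_fn Q \<xi>) = (\<integral>k. Re (char_fn M \<xi> ^ k) \<partial>measure_pmf (poisson_pmf l))"
    unfolding Re_char_fn[OF borel_probD(2,3)[OF Q]]
    by (subst ib) (auto simp: Re_char_fn[OF borel_probD(2,3)[OF K], symmetric] char_fn_conv_power[OF M])
  moreover have "Im (char_fn Q \<xi>) = (\<integral>k. Im (char_fn M \<xi> ^ k) \<partial>measure_pmf (poisson_pmf l))"
    unfolding Im_char_fn[OF borel_probD(2,3)[OF Q]]
    by (subst ib) (auto simp: Im_char_fn[OF borel_probD(2,3)[OF K], symmetric] char_fn_conv_power[OF M])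
  ultimately show "char_fn Q \<xi> = exp (of_real l * (char_fn M \<xi> - 1))"
    by (intro complex_eqI) (simp_all add: pw integral_Re[OF pw(2), symmetric] integral_Im[OF pw(2), symmetric])
  have "ennreal (exp (- l)) = emeasure (measure_pmf (poisson_pmf l)) {0}"
    using l by (simp add: emeasure_pmf_single)
  also have "\<dots> = (\<integral>\<^sup>+k. indicator {0} k \<partial>measure_pmf (poisson_pmf l))"
    by simp
  also have "\<dots> \<le> (\<integral>\<^sup>+k. emeasure (conv_power M k) {0} \<partial>measure_pmf (poisson_pmf l))"
    by (rule nn_integral_mono) (auto simp: indicator_def)
  also have "\<dots> = emeasure Q {0}"
    unfolding Q_def by (rule emeasure_bind[symmetric, OF _ m]) auto
  finally show "measure Q {0} \<ge> exp (- l)"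
    using finite_measure.emeasure_eq_measure[OF borel_probD(2)[OF Q]] by simp
qed

text \<open>The atom at the origin is the contribution of the event that there is no jump at all.\<close>

lemma compound_poisson:
  fixes \<mu> :: "'a::euclidean_space measure"
  assumes fin: "finite_measure \<mu>" and sets: "sets \<mu> = sets borel"
  shows "\<exists>Q. borel_prob Q \<and> (\<forall>\<xi>. char_fn Q \<xi> = exp (LINT z|\<mu>. cis (\<xi> \<bullet> z) - 1)) \<and>
    measure Q {0} \<ge> exp (- measure \<mu> UNIV)"
proof -
  interpret finite_measure \<mu> by fact
  have sp: "space \<mu> = UNIV" using sets_eq_imp_space_eq[OF sets] by simp
  define l where "l = measure \<mu> UNIV"
  have eq: "(LINT z|\<mu>. cis (\<xi> \<bullet> z) - 1) = (LINT z|\<mu>. cis (\<xi> \<bullet> z)) - of_real l" for \<xi>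
    using integrable_cis[OF fin sets, of \<xi>]
    by (subst Bochner_Integration.integral_diff) (auto simp: l_def sp scaleR_conv_of_real)
  show ?thesis
  proof (cases "l = 0")
    \<comment> \<open>The Poisson rate must be positive, so the null measure is treated apart; its
      law is the point mass at the origin.\<close>
    case True
    have "AE z in \<mu>. False"
      using True sp sets by (intro AE_I'[of UNIV]) (auto simp: l_def null_sets_def emeasure_eq_measure)
    then have "(LINT z|\<mu>. cis (\<xi> \<bullet> z)) = 0" for \<xi>
      by (intro integral_eq_zero_AE) auto
    then show ?thesis
      using True unfolding eq
      by (intro exI[of _ "return borel 0"])
         (auto simp: borel_prob_def prob_space_return char_fn_def integral_return l_def[symmetric] measure_return)
  next
    case False
    then have l: "l > 0" by (simp add: l_def zero_less_measure_iff measure_nonneg less_le)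
    define M where "M = density \<mu> (\<lambda>_. ennreal (1 / l))"
    have "emeasure M (space M) = 1"
      using l by (simp add: M_def sp emeasure_density_const emeasure_eq_measure l_def[symmetric]
        ennreal_mult[symmetric] sets)
    then have M: "borel_prob M"
      by (auto simp: borel_prob_def M_def sets intro!: prob_spaceI)
    have "char_fn M \<xi> = (1 / l) *\<^sub>R (LINT z|\<mu>. cis (\<xi> \<bullet> z))" for \<xi>
      unfolding char_fn_def M_def
      by (subst integral_density) (use l sets in \<open>auto simp: measurable_cong_sets[OF sets refl]\<close>)
    then have "exp (of_real l * (char_fn M \<xi> - 1)) = exp (LINT z|\<mu>. cis (\<xi> \<bullet> z) - 1)" for \<xi>
      using l unfolding eq by (simp add: scaleR_conv_of_real algebra_simps)
    then show ?thesis
      using compound_poisson_prob[OF M l] unfolding l_def by metis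
  qed
qed

section \<open>Fourier inversion with Gaussian regularisation\<close>

text \<open>\<open>lborel\<close> is the image of a product of one-dimensional copies, so Fubini
  applies coordinate by coordinate. This serves the Gaussian transform and, later, a majorant made
  of Cauchy kernels.\<close>

lemma lborel_prod:
  fixes f :: "'a::euclidean_space \<Rightarrow> real \<Rightarrow> 'b::{real_normed_field, banach, second_countable_topology}"
  assumes int: "\<And>b. b \<in> Basis \<Longrightarrow> integrable lborel (f b)"
  shows lborel_integrable_prod: "integrable (lborel :: 'a measure) (\<lambda>x. \<Prod>b\<in>Basis. f b (x \<bullet> b))"
    and lborel_integral_prod:
      "(\<integral>x. (\<Prod>b\<in>Basis. f b (x \<bullet> b)) \<partial>(lborel :: 'a measure)) = (\<Prod>b\<in>Basis. (LINT y|lborel. f b y))"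
proof -
  interpret product_sigma_finite "\<lambda>_::'a. lborel :: real measure" ..
  let ?P = "Pi\<^sub>M (Basis :: 'a set) (\<lambda>_. lborel :: real measure)"
  let ?T = "\<lambda>y :: 'a \<Rightarrow> real. \<Sum>b\<in>Basis. y b *\<^sub>R b"
  have fm [measurable]: "f b \<in> borel_measurable borel" if "b \<in> Basis" for b
    using int[OF that] by auto
  have m: "(\<lambda>x. \<Prod>b\<in>Basis. f b (x \<bullet> b)) \<in> borel_measurable borel"
    by (intro borel_measurable_prod measurable_compose[OF _ fm]) auto
  have T: "?T \<in> measurable ?P borel" by measurable
  have eq: "(\<Prod>b\<in>Basis. f b (?T y \<bullet> b)) = (\<Prod>b\<in>Basis. f b (y b))" for y
    by (rule prod.cong) auto
  show "integrable (lborel :: 'a measure) (\<lambda>x. \<Prod>b\<in>Basis. f b (x \<bullet> b))"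
    unfolding lborel_eq[where 'a='a] integrable_distr_eq[OF T m] eq
    by (rule product_integrable_prod) (auto intro: int)
  show "(\<integral>x. (\<Prod>b\<in>Basis. f b (x \<bullet> b)) \<partial>(lborel :: 'a measure)) = (\<Prod>b\<in>Basis. (LINT y|lborel. f b y))"
    unfolding lborel_eq[where 'a='a] integral_distr[OF T m] eq
    by (rule product_integral_prod) (auto intro: int)
qed

lemma norm_sq_Basis: "norm (x::'a::euclidean_space) ^ 2 = (\<Sum>b\<in>Basis. (x \<bullet> b) ^ 2)"
  unfolding power2_norm_eq_inner by (subst euclidean_inner) (simp add: power2_eq_square)

lemma cis_sum: "cis (\<Sum>i\<in>A. f i) = (\<Prod>i\<in>A. cis (f i))"
  by (induction A rule: infinite_finite_induct) (auto simp: cis_mult[symmetric])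

text \<open>The characteristic function of the centred normal law with covariance \<open>eps\<close>
  times the identity: multiplying by it on the frequency side adds a small independent normal
  variable.\<close>

definition gauss :: "real \<Rightarrow> 'a::euclidean_space \<Rightarrow> real" where
  "gauss eps \<xi> = exp (- (eps * norm \<xi> ^ 2 / 2))"

lemma gauss_prod: "gauss eps \<xi> = (\<Prod>b\<in>Basis. gauss eps (\<xi> \<bullet> b))"
  by (simp add: gauss_def norm_sq_Basis[of \<xi>] exp_sum[symmetric] sum_distrib_left sum_divide_distrib sum_negf)

lemma gauss_measurable [measurable]: "gauss eps \<in> borel_measurable borel"
  unfolding gauss_def by measurable

text \<open>The substitution s = x / sqrt eps reduces both claims to the characteristic function of
  the standard normal law.\<close>

lemma gauss_fourier_real:
  fixes u :: real
  assumes "eps > 0"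
  shows "integrable lborel (\<lambda>s. cis (s * u) * of_real (gauss eps s))"
    and "(LINT s|lborel. cis (s * u) * of_real (gauss eps s)) = of_real (sqrt (2 * pi / eps) * exp (- (u ^ 2 / (2 * eps))))"
proof -
  define e where "e = sqrt eps"
  have e: "e > 0" "e ^ 2 = eps" "e * e = eps" using assms by (auto simp: e_def power2_eq_square[symmetric])
  have g: "gauss eps ((1 / e) * x) = sqrt (2 * pi) * std_normal_density x" for x
    using e assms by (simp add: gauss_def std_normal_density_def power_divide)
  have c: "cis (1 / e * x * u) * of_real (gauss eps (1 / e * x)) =
      of_real (sqrt (2 * pi)) * (std_normal_density x *\<^sub>R iexp (u / e * x))" for x
    unfolding g by (simp add: scaleR_conv_of_real cis_conv_exp mult_ac)
  have i: "integrable lborel (\<lambda>x. std_normal_density x *\<^sub>R iexp (u / e * x))"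
    by (rule Bochner_Integration.integrable_bound[of _ "std_normal_density"]) auto
  have i2: "integrable lborel (\<lambda>x. cis ((0 + 1 / e * x) * u) * of_real (gauss eps (0 + 1 / e * x)))"
    unfolding add_0_left c by (rule integrable_mult_right[OF i])
  show "integrable lborel (\<lambda>s. cis (s * u) * of_real (gauss eps s))"
    using e i2 by (subst (asm) lborel_integrable_real_affine_iff) auto
  have "(LINT s|lborel. cis (s * u) * of_real (gauss eps s))
     = \<bar>1 / e\<bar> *\<^sub>R (LINT x|lborel. cis ((0 + 1 / e * x) * u) * of_real (gauss eps (0 + 1 / e * x)))"
    by (rule lborel_integral_real_affine) (use e in auto)
  also have "\<dots> = (1 / e) *\<^sub>R (of_real (sqrt (2 * pi)) * (LINT x|lborel. std_normal_density x *\<^sub>R iexp (u / e * x)))"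
    unfolding add_0_left c using e by (subst integral_mult_right_zero) simp
  also have "(LINT x|lborel. std_normal_density x *\<^sub>R iexp (u / e * x)) = char std_normal_distribution (u / e)"
    unfolding char_def by (subst integral_density) auto
  also have "\<dots> = of_real (exp (- (u ^ 2 / (2 * eps))))"
    unfolding char_std_normal_distribution using e by (simp add: power_divide field_simps)
  finally show "(LINT s|lborel. cis (s * u) * of_real (gauss eps s)) = of_real (sqrt (2 * pi / eps) * exp (- (u ^ 2 / (2 * eps))))"
    using e by (simp add: scaleR_conv_of_real real_sqrt_divide e_def[symmetric])
qed

lemma gauss_fourier:
  fixes x :: "'a::euclidean_space"
  assumes "eps > 0"
  shows integrable_cis_gauss: "integrable lborel (\<lambda>\<xi>. cis (\<xi> \<bullet> x) * of_real (gauss eps \<xi>))"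
    and integral_cis_gauss: "(LINT \<xi>|lborel. cis (\<xi> \<bullet> x) * of_real (gauss eps \<xi>))
       = of_real (sqrt (2 * pi / eps) ^ DIM('a) * gauss (1 / eps) x)"
proof -
  let ?f = "\<lambda>b s. cis (s * (x \<bullet> b)) * complex_of_real (gauss eps s)"
  have eq: "cis (\<xi> \<bullet> x) * of_real (gauss eps \<xi>) = (\<Prod>b\<in>Basis. ?f b (\<xi> \<bullet> b))" for \<xi>
    by (simp add: euclidean_inner[of \<xi> x] cis_sum gauss_prod[of eps \<xi>] prod.distrib)
  note G = gauss_fourier_real[OF assms]
  show "integrable lborel (\<lambda>\<xi>. cis (\<xi> \<bullet> x) * of_real (gauss eps \<xi>))"
    unfolding eq by (rule lborel_integrable_prod) (rule G)
  show "(LINT \<xi>|lborel. cis (\<xi> \<bullet> x) * of_real (gauss eps \<xi>))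
       = of_real (sqrt (2 * pi / eps) ^ DIM('a) * gauss (1 / eps) x)"
    unfolding eq by (subst lborel_integral_prod[OF G(1)])
      (simp add: G(2) prod.distrib gauss_prod[of _ x], simp add: gauss_def mult.commute)
qed

lemma integrable_gauss:
  assumes "eps > 0" shows "integrable lborel (gauss eps :: 'a::euclidean_space \<Rightarrow> real)"
proof -
  have "integrable lborel (\<lambda>\<xi>::'a. complex_of_real (gauss eps \<xi>))"
    using integrable_cis_gauss[OF assms, of 0] by simp
  from integrable_Re[OF this] show ?thesis by simp
qed

lemma integral_gauss:
  assumes "eps > 0"
  shows "(\<integral>\<xi>. gauss eps \<xi> \<partial>(lborel :: 'a::euclidean_space measure)) = sqrt (2 * pi / eps) ^ DIM('a)"
proof -
  have "complex_of_real (\<integral>\<xi>. gauss eps \<xi> \<partial>(lborel :: 'a measure)) = of_real (sqrt (2 * pi / eps) ^ DIM('a))"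
    using integral_cis_gauss[OF assms, of "0::'a"] by (simp add: gauss_def mult.commute)
  then show ?thesis by (simp only: of_real_eq_iff)
qed

text \<open>The inverse Fourier transform without its normalisation; the missing power of
  \<open>2 * pi\<close> reappears in \<open>gauss_inversion_lower_bound\<close>.\<close>

definition inv_ft :: "('a::euclidean_space \<Rightarrow> complex) \<Rightarrow> 'a \<Rightarrow> complex" where
  "inv_ft F x = (LINT \<xi>|lborel. cis (- (\<xi> \<bullet> x)) * F \<xi>)"

lemma inv_ft_gauss:
  fixes x :: "'a::euclidean_space"
  assumes "eps > 0"
  shows "inv_ft (\<lambda>\<xi>. of_real (gauss eps \<xi>)) x = of_real (sqrt (2 * pi / eps) ^ DIM('a) * gauss (1 / eps) x)"
  using integral_cis_gauss[OF assms, of "- x"] unfolding inv_ft_def by (simp add: gauss_def mult.commute)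

lemma integrable_cis_mult:
  assumes "integrable lborel F"
  shows "integrable lborel (\<lambda>\<xi>::'a::euclidean_space. cis (- (\<xi> \<bullet> x)) * F \<xi>)"
proof -
  have [measurable]: "F \<in> borel_measurable borel" using assms by auto
  show ?thesis
    by (rule Bochner_Integration.integrable_bound[OF assms]) (auto simp: norm_mult)
qed

lemma inv_ft_measurable [measurable]:
  assumes "integrable lborel F"
  shows "inv_ft F \<in> borel_measurable borel"
proof -
  have [measurable]: "F \<in> borel_measurable borel" using assms by auto
  show ?thesis unfolding inv_ft_def
    by (rule lborel.borel_measurable_lebesgue_integral) simp
qed

lemma norm_inv_ft_le:
  assumes "integrable lborel F"
  shows "norm (inv_ft F x) \<le> (LINT \<xi>|lborel. norm (F \<xi>))"
proof -
  have "norm (inv_ft F x) \<le> (LINT \<xi>|lborel. norm (cis (- (\<xi> \<bullet> x)) * F \<xi>))"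
    unfolding inv_ft_def by (rule integral_norm_bound)
  then show ?thesis by (simp add: norm_mult)
qed

text \<open>Fubini, with \<open>norm (F \<xi>)\<close> as majorant. Through this identity a factor
  on the frequency side becomes an average over random displacements, where positivity can be
  used.\<close>

lemma inv_ft_convolution:
  fixes F :: "'a::euclidean_space \<Rightarrow> complex"
  assumes F: "integrable lborel F" and Q: "borel_prob Q"
  shows "(LINT z|Q. inv_ft F (x - z)) = inv_ft (\<lambda>\<xi>. F \<xi> * char_fn Q \<xi>) x"
proof -
  interpret Q: prob_space Q using borel_probD[OF Q] by auto
  interpret pair_sigma_finite Q "lborel :: 'a measure" ..
  note [measurable_cong] = borel_probD(3)[OF Q]
  have [measurable]: "F \<in> borel_measurable borel" using F by auto
  have n: "norm (cis (- (\<xi> \<bullet> (x - z))) * F \<xi>) = norm (F \<xi>)" for \<xi> z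
    by (simp add: norm_mult)
  have int: "integrable (Q \<Otimes>\<^sub>M lborel) (\<lambda>(z, \<xi>). cis (- (\<xi> \<bullet> (x - z))) * F \<xi>)"
    by (rule Fubini_integrable) (auto simp: n intro!: integrable_cis_mult F)
  have "(LINT z|Q. inv_ft F (x - z)) = (LINT \<xi>|lborel. (LINT z|Q. cis (- (\<xi> \<bullet> (x - z))) * F \<xi>))"
    unfolding inv_ft_def by (rule Fubini_integral[OF int, symmetric])
  also have "\<dots> = inv_ft (\<lambda>\<xi>. F \<xi> * char_fn Q \<xi>) x"
    unfolding inv_ft_def
  proof (rule Bochner_Integration.integral_cong[OF refl])
    fix \<xi>
    have "cis (- (\<xi> \<bullet> (x - z))) * F \<xi> = (cis (- (\<xi> \<bullet> x)) * F \<xi>) * cis (\<xi> \<bullet> z)" for z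
    proof -
      have "cis (- (\<xi> \<bullet> (x - z))) = cis (- (\<xi> \<bullet> x)) * cis (\<xi> \<bullet> z)"
        by (simp add: cis_mult inner_diff_right)
      then show ?thesis by (metis mult.assoc mult.commute)
    qed
    then show "(LINT z|Q. cis (- (\<xi> \<bullet> (x - z))) * F \<xi>) = cis (- (\<xi> \<bullet> x)) * (F \<xi> * char_fn Q \<xi>)"
      by (simp only: char_fn_def mult.assoc integral_mult_right_zero)
  qed
  finally show ?thesis .
qed

text \<open>Working with a sequence of laws whose characteristic functions converge pointwise avoids having to
  show that the limit is itself a characteristic function.\<close>

definition cf_seq :: "(nat \<Rightarrow> 'a::euclidean_space measure) \<Rightarrow> ('a \<Rightarrow> complex) \<Rightarrow> bool" where
  "cf_seq Q \<phi> \<longleftrightarrow> (\<forall>j. borel_prob (Q j)) \<and> (\<forall>\<xi>. (\<lambda>j. char_fn (Q j) \<xi>) \<longlonglongrightarrow> \<phi> \<xi>)"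

lemma cf_seq_measurable:
  assumes "cf_seq Q \<phi>" shows "\<phi> \<in> borel_measurable borel"
proof (rule borel_measurable_LIMSEQ_metric)
  show "char_fn (Q j) \<in> borel_measurable borel" for j
    using assms by (simp add: cf_seq_def borel_measurable_char_fn)
  show "(\<lambda>j. char_fn (Q j) \<xi>) \<longlonglongrightarrow> \<phi> \<xi>" for \<xi>
    using assms by (simp add: cf_seq_def)
qed

lemma cf_seq_norm_le:
  assumes "cf_seq Q \<phi>" shows "norm (\<phi> \<xi>) \<le> 1"
proof (rule LIMSEQ_le_const2)
  show "(\<lambda>j. norm (char_fn (Q j) \<xi>)) \<longlonglongrightarrow> norm (\<phi> \<xi>)"
    using assms unfolding cf_seq_def by (intro tendsto_norm) auto
qed (use assms in \<open>auto simp: cf_seq_def intro: norm_char_fn_le\<close>)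

lemma cf_seq_integrable_mult:
  assumes "cf_seq Q \<phi>" "integrable lborel F"
  shows "integrable lborel (\<lambda>\<xi>. F \<xi> * \<phi> \<xi>)"
proof -
  have [measurable]: "F \<in> borel_measurable borel" "\<phi> \<in> borel_measurable borel"
    using assms(2) cf_seq_measurable[OF assms(1)] by auto
  show ?thesis
    by (rule Bochner_Integration.integrable_bound[OF assms(2)])
       (auto simp: norm_mult cf_seq_norm_le[OF assms(1)] mult_left_le)
qed

text \<open>Characteristic functions are bounded by 1, so \<open>norm (F \<xi>)\<close> dominates
  and the convolution identity passes to the limit.\<close>

lemma cf_seq_inv_ft:
  assumes Q: "cf_seq Q \<phi>" and F: "integrable lborel F"
  shows "(\<lambda>j. \<integral>z. Re (inv_ft F (x - z)) \<partial>Q j) \<longlonglongrightarrow> Re (inv_ft (\<lambda>\<xi>. F \<xi> * \<phi> \<xi>) x)"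
proof -
  have Qj: "borel_prob (Q j)" for j using Q by (simp add: cf_seq_def)
  have [measurable]: "F \<in> borel_measurable borel" "\<phi> \<in> borel_measurable borel"
     "char_fn (Q j) \<in> borel_measurable borel" for j
    using F cf_seq_measurable[OF Q] Qj by (auto intro: borel_measurable_char_fn)
  have "(\<lambda>j. \<integral>z. inv_ft F (x - z) \<partial>Q j) \<longlonglongrightarrow> inv_ft (\<lambda>\<xi>. F \<xi> * \<phi> \<xi>) x"
    unfolding inv_ft_convolution[OF F Qj]
    unfolding inv_ft_def
  proof (rule integral_dominated_convergence[where w = "\<lambda>\<xi>. norm (F \<xi>)"])
    show "AE \<xi> in lborel. (\<lambda>j. cis (- (\<xi> \<bullet> x)) * (F \<xi> * char_fn (Q j) \<xi>)) \<longlonglongrightarrow> cis (- (\<xi> \<bullet> x)) * (F \<xi> * \<phi> \<xi>)"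
      using Q unfolding cf_seq_def by (intro AE_I2 tendsto_intros) auto
    show "AE \<xi> in lborel. norm (cis (- (\<xi> \<bullet> x)) * (F \<xi> * char_fn (Q j) \<xi>)) \<le> norm (F \<xi>)" for j
      using norm_char_fn_le[OF Qj] by (intro AE_I2) (auto simp: norm_mult mult_left_le)
    show "integrable lborel (\<lambda>\<xi>. norm (F \<xi>))"
      by (rule integrable_norm[OF F])
    show "(\<lambda>\<xi>. cis (- (\<xi> \<bullet> x)) * (F \<xi> * \<phi> \<xi>)) \<in> borel_measurable lborel"
      by measurable
    show "(\<lambda>\<xi>. cis (- (\<xi> \<bullet> x)) * (F \<xi> * char_fn (Q j) \<xi>)) \<in> borel_measurable lborel" for j
      by measurable
  qed
  from tendsto_Re[OF this]
  have "(\<lambda>j. Re (LINT z|Q j. inv_ft F (x - z))) \<longlonglongrightarrow> Re (inv_ft (\<lambda>\<xi>. F \<xi> * \<phi> \<xi>) x)" .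
  moreover have "Re (LINT z|Q j. inv_ft F (x - z)) = (LINT z|Q j. Re (inv_ft F (x - z)))" for j
  proof -
    have [measurable]: "inv_ft F \<in> borel_measurable borel"
      by (rule inv_ft_measurable[OF F])
    show ?thesis
    by (subst integral_Re)
       (auto intro!: integrable_bounded_borel[OF borel_probD(2,3)[OF Qj]] norm_inv_ft_le[OF F])
  qed
  ultimately show ?thesis by simp
qed

lemma integrable_Re_inv_ft_shift:
  assumes F: "integrable lborel F" and Q: "borel_prob Q"
  shows "integrable Q (\<lambda>z. Re (inv_ft F (x - z)))" "integrable Q (\<lambda>z. Re (inv_ft F (x + z)))"
proof -
  have [measurable]: "inv_ft F \<in> borel_measurable borel"
    by (rule inv_ft_measurable[OF F])
  have "norm (Re (inv_ft F y)) \<le> (LINT \<xi>|lborel. norm (F \<xi>))" for y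
    using abs_Re_le_cmod[of "inv_ft F y"] norm_inv_ft_le[OF F, of y] by simp
  then show "integrable Q (\<lambda>z. Re (inv_ft F (x - z)))" "integrable Q (\<lambda>z. Re (inv_ft F (x + z)))"
    by (intro integrable_bounded_borel[OF borel_probD(2,3)[OF Q], where B = "\<integral>\<xi>. norm (F \<xi>) \<partial>lborel"];
        simp)+
qed

section \<open>Tail bounds from characteristic functions\<close>

text \<open>The law of a random frequency factor. At a single frequency 1 - cos vanishes for some
  large arguments; averaged over the frequencies \<open>s * w\<close> with s in [0,1] it controls
  \<open>min 1 (w ^ 2)\<close>.\<close>

definition unif01 :: "real measure" where
  "unif01 = density lborel (\<lambda>s. ennreal (indicator {0..1} s))"

lemma sets_unif01 [simp, measurable_cong]: "sets unif01 = sets borel"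
  by (simp add: unif01_def)

lemma prob_space_unif01: "prob_space unif01"
  by (rule prob_spaceI) (simp add: unif01_def emeasure_density ennreal_indicator)

lemma AE_unif01: "AE s in unif01. 0 \<le> s \<and> s \<le> 1"
  unfolding unif01_def by (subst AE_density) (auto simp: indicator_def)

lemma integral_unif01_one_minus_cos:
  assumes "w \<noteq> 0"
  shows "(LINT s|unif01. 1 - cos (s * w)) = 1 - sin w / w"
proof -
  have "(LINT s|unif01. 1 - cos (s * w)) = (LINT s|lborel. (1 - cos (s * w)) * indicator {0..1} s)"
    unfolding unif01_def by (subst integral_density) (auto simp: mult.commute)
  also have "\<dots> = (1 - sin (1 * w) / w) - (0 - sin (0 * w) / w)"
    by (rule integral_FTC_Icc_real[where F = "\<lambda>s. s - sin (s * w) / w"])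
       (use assms in \<open>auto intro!: derivative_eq_intros\<close>)
  finally show ?thesis by simp
qed

lemma min_one_square_le_sinc:
  assumes "w > (0::real)"
  shows "min 1 (w ^ 2) \<le> 9 * (1 - sin w / w)"
proof -
  have "(\<Sum>m<5. sin_coeff m * w ^ m) = w - w ^ 3 / 6"
  proof -
    have "{..<5} = {0, 1, 2, 3, 4 :: nat}" by auto
    then show ?thesis by (simp add: sin_coeff_def fact_numeral)
  qed
  then have "\<bar>sin w - (w - w ^ 3 / 6)\<bar> \<le> inverse (fact 5) * \<bar>w\<bar> ^ 5"
    using Maclaurin_sin_bound[of w 5] by simp
  then have "sin w \<le> w - w ^ 3 / 6 + w ^ 5 / 120"
    using assms abs_ge_self[of "sin w - (w - w ^ 3 / 6)"] by (simp add: fact_numeral)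
  then have "sin w / w \<le> (w - w ^ 3 / 6 + w ^ 5 / 120) / w"
    using assms by (intro divide_right_mono) auto
  also have "\<dots> = 1 - w ^ 2 / 6 + (w ^ 2) * (w ^ 2) / 120"
    using assms by (simp add: field_simps eval_nat_numeral)
  finally have taylor: "1 - sin w / w \<ge> w ^ 2 * (1 / 6 - w ^ 2 / 120)"
    by (simp add: algebra_simps)
  \<comment> \<open>For w > 9/8 the trivial bound sin w / w \<le> 1 / w already leaves 1/9. Up to
    9/8 the Taylor factor stays above 1/9. This is the origin of the 9 in all tail bounds.\<close>
  show ?thesis
  proof (cases "w \<le> 9 / 8")
    case True
    have "w ^ 2 \<le> (9 / 8) ^ 2" using True assms by (intro power_mono) auto
    then have "1 / 6 - w ^ 2 / 120 \<ge> 1 / 9" by (simp add: power2_eq_square)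
    then have "w ^ 2 * (1 / 6 - w ^ 2 / 120) \<ge> w ^ 2 * (1 / 9)"
      by (intro mult_left_mono) auto
    then show ?thesis using taylor by (simp add: min_def)
  next
    case False
    have "sin w / w \<le> 1 / w" using assms by (intro divide_right_mono) auto
    also have "1 / w \<le> 8 / 9" using False assms by (simp add: field_simps)
    finally show ?thesis by simp
  qed
qed

lemma min_one_square_le_average:
  "min 1 (w ^ 2) \<le> 9 * (LINT s|unif01. 1 - cos (s * w))"
proof (cases "w = 0")
  case False
  have "min 1 (\<bar>w\<bar> ^ 2) \<le> 9 * (1 - sin \<bar>w\<bar> / \<bar>w\<bar>)"
    by (rule min_one_square_le_sinc) (use False in auto)
  also have "sin \<bar>w\<bar> / \<bar>w\<bar> = sin w / w" by (simp add: abs_if)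
  finally show ?thesis using integral_unif01_one_minus_cos[OF False] by simp
qed simp

lemma min_one_sum_le:
  fixes f :: "'i \<Rightarrow> real"
  assumes "finite A" "\<And>i. i \<in> A \<Longrightarrow> 0 \<le> f i"
  shows "min 1 (\<Sum>i\<in>A. f i) \<le> (\<Sum>i\<in>A. min 1 (f i))"
proof (cases "\<exists>i\<in>A. f i > 1")
  case True
  then obtain i where i: "i \<in> A" "f i > 1" by auto
  have "min 1 (f i) \<le> (\<Sum>i\<in>A. min 1 (f i))"
    by (rule member_le_sum[OF i(1)]) (use assms in auto)
  then show ?thesis using i by auto
next
  case False
  then have "(\<Sum>i\<in>A. min 1 (f i)) = (\<Sum>i\<in>A. f i)" by (intro sum.cong) auto
  then show ?thesis by simp
qed

text \<open>Truncation at 1 is subadditive, so the coordinates can be treated one at a time. The sum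
  over \<open>Basis\<close> is the source of the later factor \<open>DIM('a)\<close>.\<close>

lemma min_one_norm_square_le_average:
  fixes z :: "'a::euclidean_space"
  shows "min 1 ((l * norm z) ^ 2) \<le> 9 * (\<Sum>b\<in>Basis. LINT s|unif01. 1 - cos (((s * l) *\<^sub>R b) \<bullet> z))"
proof -
  have "min 1 ((l * norm z) ^ 2) = min 1 (\<Sum>b\<in>Basis. (l * (z \<bullet> b)) ^ 2)"
    by (simp add: power_mult_distrib norm_sq_Basis sum_distrib_left)
  also have "\<dots> \<le> (\<Sum>b\<in>Basis. min 1 ((l * (z \<bullet> b)) ^ 2))"
    by (rule min_one_sum_le) auto
  also have "\<dots> \<le> (\<Sum>b\<in>Basis. 9 * (LINT s|unif01. 1 - cos (s * (l * (z \<bullet> b)))))"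
    by (intro sum_mono min_one_square_le_average)
  finally show ?thesis
    by (simp add: sum_distrib_left mult.assoc inner_commute)
qed

lemma ennreal_nine_sum:
  assumes "\<And>i. i \<in> A \<Longrightarrow> 0 \<le> f i"
  shows "ennreal (9 * (\<Sum>i\<in>A. f i)) = 9 * (\<Sum>i\<in>A. ennreal (f i))"
proof -
  have "ennreal (9 * (\<Sum>i\<in>A. f i)) = ennreal 9 * ennreal (\<Sum>i\<in>A. f i)"
    by (rule ennreal_mult) (use assms in \<open>simp_all add: sum_nonneg\<close>)
  then show ?thesis by (simp add: sum_ennreal[OF assms])
qed

text \<open>Stated with nonnegative integrals over a \<sigma>-finite measure, so that it yields both
  tail bounds for probability laws and bounds of \<open>h_fun\<close> for infinite Levy
  measures.\<close>

lemma nn_integral_min_one_le_average: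
  fixes M :: "'a::euclidean_space measure"
  assumes "sigma_finite_measure M" and sets: "sets M = sets borel"
  shows "(\<integral>\<^sup>+z. ennreal (min 1 ((l * norm z) ^ 2)) \<partial>M)
    \<le> 9 * (\<Sum>b\<in>Basis. \<integral>\<^sup>+s. (\<integral>\<^sup>+z. ennreal (1 - cos (((s * l) *\<^sub>R b) \<bullet> z)) \<partial>M) \<partial>unif01)"
proof -
  let ?c = "\<lambda>b s z. 1 - cos (((s * l) *\<^sub>R b) \<bullet> z)"
  interpret M: sigma_finite_measure M by fact
  interpret U: prob_space unif01 by (rule prob_space_unif01)
  interpret pair_sigma_finite M unif01 ..
  note [measurable_cong] = sets
  have "(\<integral>\<^sup>+z. ennreal (min 1 ((l * norm z) ^ 2)) \<partial>M)
    \<le> (\<integral>\<^sup>+z. 9 * (\<Sum>b\<in>Basis. \<integral>\<^sup>+s. ennreal (?c b s z) \<partial>unif01) \<partial>M)"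
  proof (rule nn_integral_mono)
    fix z :: 'a
    have "norm (1 - cos x) \<le> 2" for x :: real
      using cos_ge_minus_one[of x] cos_le_one[of x] by auto
    then have i: "integrable unif01 (\<lambda>s. ?c b s z)" for b
      by (intro U.integrable_const_bound[where B=2] AE_I2) auto
    have "ennreal (min 1 ((l * norm z) ^ 2)) \<le> ennreal (9 * (\<Sum>b\<in>Basis. LINT s|unif01. ?c b s z))"
      by (rule ennreal_leI) (rule min_one_norm_square_le_average)
    also have "\<dots> = 9 * (\<Sum>b\<in>Basis. ennreal (LINT s|unif01. ?c b s z))"
      by (rule ennreal_nine_sum) (simp add: integral_nonneg_AE)
    also have "\<dots> = 9 * (\<Sum>b\<in>Basis. \<integral>\<^sup>+s. ennreal (?c b s z) \<partial>unif01)"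
      using nn_integral_eq_integral[OF i] by simp
    finally show "ennreal (min 1 ((l * norm z) ^ 2))
      \<le> 9 * (\<Sum>b\<in>Basis. \<integral>\<^sup>+s. ennreal (?c b s z) \<partial>unif01)" .
  qed
  also have "\<dots> = 9 * (\<Sum>b\<in>Basis. \<integral>\<^sup>+z. (\<integral>\<^sup>+s. ennreal (?c b s z) \<partial>unif01) \<partial>M)"
    by (subst nn_integral_cmult) (auto simp: nn_integral_sum)
  also have "(\<Sum>b\<in>Basis. \<integral>\<^sup>+z. (\<integral>\<^sup>+s. ennreal (?c b s z) \<partial>unif01) \<partial>M)
    = (\<Sum>b\<in>Basis. \<integral>\<^sup>+s. (\<integral>\<^sup>+z. ennreal (?c b s z) \<partial>M) \<partial>unif01)"
    by (intro sum.cong refl Fubini'[symmetric]) simp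
  finally show ?thesis .
qed

lemma nn_integral_min_one_le:
  fixes M :: "'a::euclidean_space measure"
  assumes "sigma_finite_measure M" "sets M = sets borel" "0 \<le> l" "0 \<le> C"
    and C: "\<And>\<xi>. norm \<xi> \<le> l \<Longrightarrow> (\<integral>\<^sup>+z. ennreal (1 - cos (\<xi> \<bullet> z)) \<partial>M) \<le> ennreal C"
  shows "(\<integral>\<^sup>+z. ennreal (min 1 ((l * norm z) ^ 2)) \<partial>M) \<le> ennreal (9 * real DIM('a) * C)"
proof -
  interpret U: prob_space unif01 by (rule prob_space_unif01)
  have "(\<integral>\<^sup>+s. (\<integral>\<^sup>+z. ennreal (1 - cos (((s * l) *\<^sub>R b) \<bullet> z)) \<partial>M) \<partial>unif01) \<le> ennreal C"
    if "b \<in> Basis" for b :: 'a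
  proof -
    have "AE s in unif01. (\<integral>\<^sup>+z. ennreal (1 - cos (((s * l) *\<^sub>R b) \<bullet> z)) \<partial>M) \<le> ennreal C"
      using AE_unif01
    proof eventually_elim
      case (elim s)
      then show ?case using that assms(3)
        by (intro C) (auto simp: abs_mult mult_left_le_one_le)
    qed
    then have "(\<integral>\<^sup>+s. (\<integral>\<^sup>+z. ennreal (1 - cos (((s * l) *\<^sub>R b) \<bullet> z)) \<partial>M) \<partial>unif01) \<le> (\<integral>\<^sup>+s. ennreal C \<partial>unif01)"
      by (rule nn_integral_mono_AE)
    then show ?thesis by (simp add: U.emeasure_space_1)
  qed
  then have "(\<Sum>b\<in>(Basis :: 'a set). \<integral>\<^sup>+s. (\<integral>\<^sup>+z. ennreal (1 - cos (((s * l) *\<^sub>R b) \<bullet> z)) \<partial>M) \<partial>unif01)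
      \<le> (\<Sum>b\<in>(Basis :: 'a set). ennreal C)"
    by (rule sum_mono)
  also have "\<dots> = ennreal (real DIM('a) * C)"
    using assms(4) by (simp add: ennreal_mult ennreal_of_nat_eq_real_of_nat)
  finally have "9 * (\<Sum>b\<in>(Basis :: 'a set). \<integral>\<^sup>+s. (\<integral>\<^sup>+z. ennreal (1 - cos (((s * l) *\<^sub>R b) \<bullet> z)) \<partial>M) \<partial>unif01)
      \<le> ennreal (9 * (real DIM('a) * C))"
    using assms(4) by (subst ennreal_mult) (auto intro: mult_left_mono)
  with nn_integral_min_one_le_average[OF assms(1,2), of l] show ?thesis
    by (simp add: mult.assoc)
qed

text \<open>The indicator of a tail is at most the truncated square. The average over frequencies is
  kept instead of a supremum, since pointwise convergence of characteristic functions passes to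
  averages.\<close>

lemma borel_prob_tail_le:
  fixes Q :: "'a::euclidean_space measure"
  assumes Q: "borel_prob Q" and r: "0 < r"
  shows "measure Q {z. r \<le> norm z} \<le> 9 * (\<Sum>b\<in>Basis. LINT s|unif01. 1 - Re (char_fn Q ((s / r) *\<^sub>R b)))"
proof -
  interpret Q: prob_space Q using borel_probD[OF Q] by auto
  interpret U: prob_space unif01 by (rule prob_space_unif01)
  note [measurable_cong] = borel_probD(3)[OF Q]
  note [measurable] = borel_measurable_char_fn[OF Q]
  have i: "integrable Q (\<lambda>z. cos (\<xi> \<bullet> z))" for \<xi>
    by (rule integrable_bounded_borel[OF borel_probD(2,3)[OF Q], where B=1]) auto
  have c: "(\<integral>\<^sup>+z. ennreal (1 - cos (\<xi> \<bullet> z)) \<partial>Q) = ennreal (1 - Re (char_fn Q \<xi>))" for \<xi>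
    unfolding Re_char_fn[OF borel_probD(2,3)[OF Q]]
    using i[of \<xi>] by (subst nn_integral_eq_integral) (auto simp: Q.prob_space)
  have nn: "0 \<le> 1 - Re (char_fn Q \<xi>)" "1 - Re (char_fn Q \<xi>) \<le> 2" for \<xi>
    using norm_char_fn_le[OF Q, of \<xi>] abs_Re_le_cmod[of "char_fn Q \<xi>"] by auto
  have iu: "integrable unif01 (\<lambda>s. 1 - Re (char_fn Q ((s / r) *\<^sub>R b)))" for b
    by (rule U.integrable_const_bound[where B=2]) (use nn in auto)
  have i0: "0 \<le> (LINT s|unif01. 1 - Re (char_fn Q ((s / r) *\<^sub>R b)))" for b
    by (intro integral_nonneg_AE AE_I2 nn)
  have "{z. r \<le> norm z} \<in> sets Q" by (simp add: borel_probD(3)[OF Q])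
  then have "ennreal (measure Q {z. r \<le> norm z}) = (\<integral>\<^sup>+z. indicator {z. r \<le> norm z} z \<partial>Q)"
    by (simp add: Q.emeasure_eq_measure)
  also have "\<dots> \<le> (\<integral>\<^sup>+z. ennreal (min 1 ((1 / r * norm z) ^ 2)) \<partial>Q)"
    using r by (intro nn_integral_mono) (auto simp: indicator_def)
  also have "\<dots> \<le> 9 * (\<Sum>b\<in>Basis. \<integral>\<^sup>+s. (\<integral>\<^sup>+z. ennreal (1 - cos (((s * (1 / r)) *\<^sub>R b) \<bullet> z)) \<partial>Q) \<partial>unif01)"
    by (rule nn_integral_min_one_le_average[OF Q.sigma_finite_measure_axioms borel_probD(3)[OF Q]])
  also have "\<dots> = 9 * (\<Sum>b\<in>Basis. ennreal (LINT s|unif01. 1 - Re (char_fn Q ((s / r) *\<^sub>R b))))"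
    unfolding c using nn by (subst nn_integral_eq_integral) (use iu in auto)
  also have "\<dots> = ennreal (9 * (\<Sum>b\<in>Basis. LINT s|unif01. 1 - Re (char_fn Q ((s / r) *\<^sub>R b))))"
    by (rule ennreal_nine_sum[symmetric]) (rule i0)
  finally show ?thesis
    by (subst (asm) ennreal_le_iff) (simp_all add: sum_nonneg i0)
qed

text \<open>The tail probabilities themselves need not converge, but the averaged upper bounds of
  \<open>borel_prob_tail_le\<close> do; hence the detour through \<open>X\<close> and its
  limit.\<close>

lemma cf_seq_tail:
  fixes Q :: "nat \<Rightarrow> 'a::euclidean_space measure"
  assumes Q: "cf_seq Q \<phi>" and r: "0 < r"
    and C: "\<And>\<xi>. norm \<xi> \<le> 1 / r \<Longrightarrow> 1 - Re (\<phi> \<xi>) \<le> C"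
  shows "\<exists>X l. (\<forall>j. measure (Q j) {z. r \<le> norm z} \<le> X j) \<and> X \<longlonglongrightarrow> l \<and> l \<le> 9 * real DIM('a) * C"
proof -
  interpret U: prob_space unif01 by (rule prob_space_unif01)
  have Qj: "borel_prob (Q j)" for j using Q by (simp add: cf_seq_def)
  note [measurable] = borel_measurable_char_fn[OF Qj] cf_seq_measurable[OF Q]
  have n2: "norm (1 - Re w) \<le> 2" if "norm w \<le> 1" for w
    using that abs_Re_le_cmod[of w] by auto
  define X where "X = (\<lambda>j. 9 * (\<Sum>b\<in>Basis. LINT s|unif01. 1 - Re (char_fn (Q j) ((s / r) *\<^sub>R b))))"
  have "(\<lambda>j. LINT s|unif01. 1 - Re (char_fn (Q j) ((s / r) *\<^sub>R b)))
      \<longlonglongrightarrow> (LINT s|unif01. 1 - Re (\<phi> ((s / r) *\<^sub>R b)))" for b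
  proof (rule integral_dominated_convergence[where w = "\<lambda>_. 2"])
    show "AE s in unif01. (\<lambda>j. 1 - Re (char_fn (Q j) ((s / r) *\<^sub>R b))) \<longlonglongrightarrow> 1 - Re (\<phi> ((s / r) *\<^sub>R b))"
      using Q unfolding cf_seq_def by (intro AE_I2 tendsto_intros) auto
    show "AE s in unif01. norm (1 - Re (char_fn (Q j) ((s / r) *\<^sub>R b))) \<le> 2" for j
      by (intro AE_I2 n2 norm_char_fn_le Qj)
  qed measurable
  then have lim: "X \<longlonglongrightarrow> 9 * (\<Sum>b\<in>(Basis :: 'a set). LINT s|unif01. 1 - Re (\<phi> ((s / r) *\<^sub>R b)))"
    unfolding X_def by (intro tendsto_mult_left tendsto_sum)
  have "(LINT s|unif01. 1 - Re (\<phi> ((s / r) *\<^sub>R b))) \<le> C" if b: "b \<in> Basis" for b :: 'a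
  proof -
    have "(LINT s|unif01. 1 - Re (\<phi> ((s / r) *\<^sub>R b))) \<le> (LINT s|unif01. C)"
    proof (rule integral_mono_AE)
      show "integrable unif01 (\<lambda>s. 1 - Re (\<phi> ((s / r) *\<^sub>R b)))"
        by (rule U.integrable_const_bound[where B=2]) (auto intro!: n2[unfolded real_norm_def] cf_seq_norm_le[OF Q])
      show "AE s in unif01. 1 - Re (\<phi> ((s / r) *\<^sub>R b)) \<le> C"
        using AE_unif01
      proof eventually_elim
        case (elim s)
        then show ?case using b r by (intro C) (auto simp: divide_right_mono)
      qed
    qed simp
    then show ?thesis by (simp add: U.prob_space)
  qed
  then have "(\<Sum>b\<in>(Basis :: 'a set). LINT s|unif01. 1 - Re (\<phi> ((s / r) *\<^sub>R b))) \<le> (\<Sum>b\<in>(Basis :: 'a set). C)"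
    by (rule sum_mono)
  then have "9 * (\<Sum>b\<in>(Basis :: 'a set). LINT s|unif01. 1 - Re (\<phi> ((s / r) *\<^sub>R b))) \<le> 9 * real DIM('a) * C"
    by simp
  moreover have "measure (Q j) {z. r \<le> norm z} \<le> X j" for j
    unfolding X_def by (rule borel_prob_tail_le[OF Qj r])
  ultimately show ?thesis using lim by blast
qed

lemma integral_indicator_tail:
  fixes Q :: "'a::euclidean_space measure"
  assumes Q: "borel_prob Q"
  shows "integrable Q (indicator {z. r \<le> norm z} :: 'a \<Rightarrow> real)"
    "(LINT z|Q. indicator {z. r \<le> norm z} z) = measure Q {z. r \<le> norm z}"
proof -
  show "integrable Q (indicator {z. r \<le> norm z} :: 'a \<Rightarrow> real)"
    by (rule integrable_bounded_borel[OF borel_probD(2,3)[OF Q], where B=1]) (auto simp: indicator_def)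
  show "(LINT z|Q. indicator {z. r \<le> norm z} z) = measure Q {z. r \<le> norm z}"
    using borel_probD(4)[OF Q] by simp
qed

section \<open>Levy measures as limits of compound Poisson laws\<close>

lemma levy_sets: "levy_measure N \<Longrightarrow> sets N = sets borel"
  by (simp add: levy_measure_def)

lemma levy_space: "levy_measure N \<Longrightarrow> space N = UNIV"
  using sets_eq_imp_space_eq[OF levy_sets] by auto

lemma levy_integrable_min:
  assumes "levy_measure N"
  shows "integrable N (\<lambda>z. min 1 (norm z ^ 2))"
proof -
  note [measurable_cong] = levy_sets[OF assms]
  show ?thesis
    using assms by (intro integrableI_nonneg) (auto simp: levy_measure_def)
qed

lemma levy_integrable:
  fixes f :: "'a::euclidean_space \<Rightarrow> 'b::{banach, second_countable_topology}"
  assumes "levy_measure N" "f \<in> borel_measurable borel" "\<And>z. norm (f z) \<le> C * min 1 (norm z ^ 2)"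
  shows "integrable N f"
proof -
  note [measurable_cong] = levy_sets[OF assms(1)]
  show ?thesis
    by (rule Bochner_Integration.integrable_bound[OF integrable_mult_right[OF levy_integrable_min[OF assms(1)], of C]])
       (use assms(2,3) in \<open>auto intro: order_trans[OF _ abs_ge_self]\<close>)
qed

lemma one_le_min_norm:
  assumes "0 < r" "r \<le> norm z"
  shows "1 \<le> (1 + 1 / r ^ 2) * min 1 (norm z ^ 2)"
proof (cases "norm z ^ 2 \<le> 1")
  case True
  have "r ^ 2 \<le> norm z ^ 2" using assms by (intro power_mono) auto
  then have "1 \<le> 1 / r ^ 2 * norm z ^ 2" using assms(1) by (simp add: field_simps)
  moreover have "1 / r ^ 2 * norm z ^ 2 \<le> (1 + 1 / r ^ 2) * norm z ^ 2"
    by (intro mult_right_mono) auto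
  ultimately show ?thesis using True by (simp add: min_def)
qed (auto simp: min_def)

lemma levy_emeasure_outside_finite:
  assumes "levy_measure N" "0 < r"
  shows "emeasure N {z. r \<le> norm z} < \<infinity>"
proof -
  note [measurable_cong] = levy_sets[OF assms(1)]
  have "integrable N (indicator {z. r \<le> norm z} :: 'a \<Rightarrow> real)"
  proof (rule levy_integrable[OF assms(1)])
    fix z :: 'a
    show "norm (indicator {z. r \<le> norm z} z :: real) \<le> (1 + 1 / r ^ 2) * min 1 (norm z ^ 2)"
      using assms(2) one_le_min_norm[of r z] by (auto simp: indicator_def)
  qed auto
  moreover have "{z. r \<le> norm z} \<in> sets N" using levy_sets[OF assms(1)] by simp
  ultimately show ?thesis by (simp add: integrable_indicator_iff levy_space[OF assms(1)])
qed

text \<open>The origin is a null set and complements of balls around it have finite mass. This opens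
  the way to Fubini and Radon-Nikodym for infinite jump measures.\<close>

lemma levy_sigma_finite:
  fixes N :: "'a::euclidean_space measure"
  assumes "levy_measure N"
  shows "sigma_finite_measure N"
proof
  let ?A = "insert {0 :: 'a} (range (\<lambda>n. {z. 1 / real (Suc n) \<le> norm z}))"
  have "\<exists>n. 1 / real (Suc n) \<le> norm z" if z: "z \<noteq> 0" for z :: 'a
  proof -
    obtain n where "inverse (real (Suc n)) < norm z"
      using reals_Archimedean[of "norm z"] z by (metis zero_less_norm_iff)
    then show ?thesis by (intro exI[of _ n]) (simp add: inverse_eq_divide)
  qed
  then have "z \<in> \<Union>?A" for z :: 'a
    by (cases "z = 0") (simp, metis UnionI insertI2 mem_Collect_eq rangeI)
  then have "\<Union>?A = UNIV" by (intro UNIV_eq_I[symmetric])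
  moreover have "emeasure N a \<noteq> \<infinity>" if a: "a \<in> ?A" for a
  proof (cases "a = {0}")
    case True
    then show ?thesis using assms by (simp add: levy_measure_def)
  next
    case False
    then obtain n where "a = {z. 1 / real (Suc n) \<le> norm z}" using a by blast
    then show ?thesis
      using levy_emeasure_outside_finite[OF assms, of "1 / real (Suc n)"] by simp
  qed
  moreover have "?A \<subseteq> sets N"
    unfolding levy_sets[OF assms]
  proof (intro insert_subsetI image_subsetI)
    show "{z::'a. 1 / real (Suc n) \<le> norm z} \<in> sets borel" for n by measurable
  qed simp
  moreover have "countable ?A" by (intro countable_insert countable_image) simp
  ultimately show "\<exists>A. countable A \<and> A \<subseteq> sets N \<and> \<Union> A = space N \<and> (\<forall>a\<in>A. emeasure N a \<noteq> \<infinity>)"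
    unfolding levy_space[OF assms] by (intro exI[of _ ?A] conjI ballI)
qed

text \<open>For \<open>r = 1\<close> this is the integrand of \<open>levy_exp\<close>. The radius is
  left free because compensating the jumps below \<open>r\<close> replaces the drift
  \<open>b\<close> by \<open>drift_r N b r\<close>.\<close>

definition comp_kernel :: "real \<Rightarrow> 'a::euclidean_space \<Rightarrow> 'a \<Rightarrow> complex" where
  "comp_kernel r \<xi> z = 1 - cis (\<xi> \<bullet> z) + \<i> * of_real (\<xi> \<bullet> z) * indicator (ball 0 r) z"

text \<open>Parts of a jump measure are encoded as weights against one fixed measure, so that
  splitting the jumps amounts to adding weights.\<close>

abbreviation jump_exp :: "'a::euclidean_space measure \<Rightarrow> ('a \<Rightarrow> real) \<Rightarrow> real \<Rightarrow> 'a \<Rightarrow> complex" where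
  "jump_exp M w r \<xi> \<equiv> (LINT z|M. w z *\<^sub>R comp_kernel r \<xi> z)"

lemma comp_kernel_measurable [measurable]: "comp_kernel r \<xi> \<in> borel_measurable (borel :: 'a::euclidean_space measure)"
proof -
  have [measurable]: "ball (0::'a) r \<in> sets borel" by simp
  show ?thesis unfolding comp_kernel_def by measurable
qed

lemma norm_comp_kernel_inside:
  assumes "norm z < r"
  shows "norm (comp_kernel r \<xi> z) \<le> (norm \<xi> * norm z) ^ 2 / 2"
proof -
  let ?x = "\<xi> \<bullet> z"
  have "cmod (iexp ?x - (\<Sum>k\<le>1. (\<i> * ?x) ^ k / fact k)) \<le> \<bar>?x\<bar> ^ Suc 1 / fact (Suc 1)"
    by (rule iexp_approx1)
  moreover have "comp_kernel r \<xi> z = - (iexp ?x - (\<Sum>k\<le>1. (\<i> * ?x) ^ k / fact k))"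
    using assms by (simp add: comp_kernel_def cis_conv_exp)
  ultimately have "norm (comp_kernel r \<xi> z) \<le> \<bar>?x\<bar> ^ 2 / 2"
    by (simp only: norm_minus_cancel) (simp add: power2_eq_square)
  also have "\<bar>?x\<bar> ^ 2 / 2 \<le> (norm \<xi> * norm z) ^ 2 / 2"
    by (intro divide_right_mono power_mono Cauchy_Schwarz_ineq2) auto
  finally show ?thesis .
qed

lemma norm_comp_kernel_outside:
  assumes "r \<le> norm z"
  shows "norm (comp_kernel r \<xi> z) \<le> 2"
  using assms norm_triangle_ineq4[of 1 "cis (\<xi> \<bullet> z)"] by (simp add: comp_kernel_def)

lemma norm_comp_kernel_le:
  fixes z :: "'a::euclidean_space"
  assumes "0 < r"
  shows "norm (comp_kernel r \<xi> z) \<le> (norm \<xi> ^ 2 * (1 + r ^ 2) + 2 * (1 + 1 / r ^ 2)) * min 1 (norm z ^ 2)"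
proof (cases "norm z < r")
  case True
  have "norm z ^ 2 \<le> (1 + r ^ 2) * min 1 (norm z ^ 2)"
  proof (cases "norm z ^ 2 \<le> 1")
    case False
    have "norm z ^ 2 \<le> r ^ 2" using True by (intro power_mono) auto
    then show ?thesis using False by (simp add: min_def)
  qed (auto simp: min_def algebra_simps)
  then have "norm \<xi> ^ 2 * norm z ^ 2 \<le> norm \<xi> ^ 2 * ((1 + r ^ 2) * min 1 (norm z ^ 2))"
    by (intro mult_left_mono) auto
  moreover have "norm (comp_kernel r \<xi> z) \<le> norm \<xi> ^ 2 * norm z ^ 2"
    using order_trans[OF norm_comp_kernel_inside[OF True, of \<xi>], of "norm \<xi> ^ 2 * norm z ^ 2"]
    by (simp add: power_mult_distrib)
  moreover have "0 \<le> 2 * (1 + 1 / r ^ 2) * min 1 (norm z ^ 2)" by simp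
  ultimately show ?thesis
    unfolding distrib_right[of "norm \<xi> ^ 2 * (1 + r ^ 2)" _ "min 1 (norm z ^ 2)"] mult.assoc by linarith
next
  case False
  then have "1 \<le> (1 + 1 / r ^ 2) * min 1 (norm z ^ 2)"
    by (intro one_le_min_norm[OF assms]) simp
  moreover have "norm (comp_kernel r \<xi> z) \<le> 2"
    using False by (intro norm_comp_kernel_outside) auto
  moreover have "0 \<le> norm \<xi> ^ 2 * (1 + r ^ 2) * min 1 (norm z ^ 2)" by simp
  ultimately show ?thesis
    unfolding distrib_right[of "norm \<xi> ^ 2 * (1 + r ^ 2)" _ "min 1 (norm z ^ 2)"] mult.assoc by linarith
qed

lemma integrable_comp_kernel:
  fixes w :: "'a::euclidean_space \<Rightarrow> real"
  assumes N: "levy_measure N" and r: "0 < r" and w [measurable]: "w \<in> borel_measurable borel"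
    and W: "\<And>z. 0 \<le> w z" "\<And>z. w z \<le> W"
  shows "integrable N (\<lambda>z. w z *\<^sub>R comp_kernel r \<xi> z)"
proof (rule levy_integrable[OF N])
  fix z
  have "\<bar>w z\<bar> * norm (comp_kernel r \<xi> z) \<le> W * ((norm \<xi> ^ 2 * (1 + r ^ 2) + 2 * (1 + 1 / r ^ 2)) * min 1 (norm z ^ 2))"
    using W order_trans[OF W] by (intro mult_mono norm_comp_kernel_le r) auto
  then show "norm (w z *\<^sub>R comp_kernel r \<xi> z)
      \<le> (W * (norm \<xi> ^ 2 * (1 + r ^ 2) + 2 * (1 + 1 / r ^ 2))) * min 1 (norm z ^ 2)"
    by (simp add: mult.assoc)
qed measurable

lemma finite_measure_weighted_outside:
  fixes w :: "'a::euclidean_space \<Rightarrow> real"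
  assumes N: "levy_measure N" and r: "0 < r" and w [measurable]: "w \<in> borel_measurable borel"
    and W: "\<And>z. 0 \<le> w z" "\<And>z. w z \<le> W" and w0: "\<And>z. norm z < r \<Longrightarrow> w z = 0"
  shows "finite_measure (density N (\<lambda>z. ennreal (w z)))"
proof
  note [measurable_cong] = levy_sets[OF N]
  have s: "{z. r \<le> norm z} \<in> sets N" using levy_sets[OF N] by simp
  have "emeasure (density N (\<lambda>z. ennreal (w z))) (space N) = (\<integral>\<^sup>+z. ennreal (w z) * indicator (space N) z \<partial>N)"
    by (rule emeasure_density) auto
  also have "\<dots> \<le> (\<integral>\<^sup>+z. ennreal W * indicator {z. r \<le> norm z} z \<partial>N)"
  proof (rule nn_integral_mono)
    fix z
    show "ennreal (w z) * indicator (space N) z \<le> ennreal W * indicator {z. r \<le> norm z} z"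
    proof (cases "norm z < r")
      case False
      then show ?thesis using W(2)[of z] by (auto simp: indicator_def intro: ennreal_leI)
    qed (simp add: w0)
  qed
  also have "\<dots> = ennreal W * emeasure N {z. r \<le> norm z}"
    by (rule nn_integral_cmult_indicator[OF s])
  also have "\<dots> < \<infinity>"
    using levy_emeasure_outside_finite[OF N r] by (simp add: ennreal_mult_less_top)
  finally show "emeasure (density N (\<lambda>z. ennreal (w z))) (space (density N (\<lambda>z. ennreal (w z)))) \<noteq> \<infinity>"
    by simp
qed

text \<open>Where the weight lives the compensator is zero, so the law is compound Poisson without
  any shift and its no-jump atom sits exactly at the origin.\<close>

lemma compound_poisson_big_jumps:
  fixes w :: "'a::euclidean_space \<Rightarrow> real"
  assumes N: "levy_measure N" and r: "0 < r" and w [measurable]: "w \<in> borel_measurable borel"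
    and W: "\<And>z. 0 \<le> w z" "\<And>z. w z \<le> W" and w0: "\<And>z. norm z < r \<Longrightarrow> w z = 0"
  shows "\<exists>Q. borel_prob Q \<and> (\<forall>\<xi>. char_fn Q \<xi> = exp (- jump_exp N w r \<xi>)) \<and>
    measure Q {0} \<ge> exp (- (LINT z|N. w z))"
proof -
  note [measurable_cong] = levy_sets[OF N]
  let ?\<mu> = "density N (\<lambda>z. ennreal (w z))"
  have fin: "finite_measure ?\<mu>" by (rule finite_measure_weighted_outside[OF assms])
  have eq: "(\<integral>z. cis (\<xi> \<bullet> z) - 1 \<partial>?\<mu>) = - jump_exp N w r \<xi>" for \<xi>
  proof -
    have "w z *\<^sub>R (cis (\<xi> \<bullet> z) - 1) = - (w z *\<^sub>R comp_kernel r \<xi> z)" for z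
      by (cases "norm z < r") (auto simp: w0 comp_kernel_def algebra_simps)
    then show ?thesis by (subst integral_density) (use W in auto)
  qed
  have "measure ?\<mu> UNIV = (\<integral>z. 1 \<partial>?\<mu>)"
    using levy_space[OF N] by simp
  also have "\<dots> = (LINT z|N. w z)"
    by (subst integral_density) (use W in auto)
  finally show ?thesis
    using compound_poisson[OF fin] levy_sets[OF N] unfolding eq by simp
qed

lemma char_fn_shift:
  assumes P: "borel_prob P"
  shows "borel_prob (distr P borel (\<lambda>z. z - m))"
    "char_fn (distr P borel (\<lambda>z. z - m)) \<xi> = cis (- (\<xi> \<bullet> m)) * char_fn P \<xi>"
proof -
  note [measurable_cong] = borel_probD(3)[OF P]
  show "borel_prob (distr P borel (\<lambda>z. z - m))"
    using prob_space.prob_space_distr[OF borel_probD(1)[OF P], of "\<lambda>z. z - m" borel]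
    by (simp add: borel_prob_def)
  have "cis (\<xi> \<bullet> (z - m)) = cis (- (\<xi> \<bullet> m)) * cis (\<xi> \<bullet> z)" for z
    by (simp add: cis_mult inner_diff_right)
  then show "char_fn (distr P borel (\<lambda>z. z - m)) \<xi> = cis (- (\<xi> \<bullet> m)) * char_fn P \<xi>"
    unfolding char_fn_def by (subst integral_distr) auto
qed

text \<open>Dropping the jumps shorter than 1/(j+1) leaves a finite measure, hence a compound
  Poisson law. Centring it and letting j grow recovers the compensated exponent by dominated
  convergence.\<close>

lemma cf_seq_levy:
  fixes w :: "'a::euclidean_space \<Rightarrow> real"
  assumes N: "levy_measure N" and r: "0 < r" and w [measurable]: "w \<in> borel_measurable borel"
    and W: "\<And>z. 0 \<le> w z" "\<And>z. w z \<le> W"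
  shows "\<exists>Q. cf_seq Q (\<lambda>\<xi>. exp (- jump_exp N w r \<xi>))"
proof -
  note [measurable_cong] = levy_sets[OF N]
  define v where "v = (\<lambda>j z. w z * indicator {z. 1 / real (Suc j) \<le> norm z} z)"
  define \<mu> where "\<mu> = (\<lambda>j. density N (\<lambda>z. ennreal (v j z)))"
  have W0: "0 \<le> W" using W order_trans by blast
  have v [measurable]: "v j \<in> borel_measurable borel" for j
    unfolding v_def by measurable
  have v0: "0 \<le> v j z" "v j z \<le> W" for j z
    using W W0 by (auto simp: v_def indicator_def)
  have fin: "finite_measure (\<mu> j)" for j
    unfolding \<mu>_def
    by (rule finite_measure_weighted_outside[OF N _ v v0, where r = "1 / real (Suc j)"])
       (auto simp: v_def)
  have sets: "sets (\<mu> j) = sets borel" for j by (simp add: \<mu>_def levy_sets[OF N])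
  have "\<exists>Q. borel_prob Q \<and> (\<forall>\<xi>. char_fn Q \<xi> = exp (- jump_exp N (v j) r \<xi>))" for j
  proof -
    obtain P where P: "borel_prob P" "\<And>\<xi>. char_fn P \<xi> = exp (LINT z|\<mu> j. cis (\<xi> \<bullet> z) - 1)"
      using compound_poisson[OF fin[of j] sets[of j]] by auto
    \<comment> \<open>The total mean of the jumps below \<open>r\<close>. Translating by it turns
      the plain compound Poisson exponent into the compensated one.\<close>
    define m where "m = (LINT z|\<mu> j. indicator (ball 0 r) z *\<^sub>R z)"
    have i1: "integrable (\<mu> j) (\<lambda>z. indicator (ball 0 r) z *\<^sub>R z)"
      by (rule integrable_bounded_borel[OF fin sets, where B=r]) (use r in \<open>auto simp: indicator_def\<close>)
    have i2: "integrable (\<mu> j) (\<lambda>z. cis (\<xi> \<bullet> z) - 1)" for \<xi>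
      by (rule integrable_bounded_borel[OF fin sets, where B=2])
         (auto intro: order_trans[OF norm_triangle_ineq4])
    have "\<xi> \<bullet> m = (LINT z|\<mu> j. \<xi> \<bullet> (indicator (ball 0 r) z *\<^sub>R z))" for \<xi>
      unfolding m_def by (rule integral_inner_right[symmetric]) (use i1 in auto)
    then have "\<i> * of_real (\<xi> \<bullet> m) = (LINT z|\<mu> j. \<i> * of_real (\<xi> \<bullet> (indicator (ball 0 r) z *\<^sub>R z)))" for \<xi>
      by (simp only: integral_mult_right_zero integral_complex_of_real)
    moreover have "integrable (\<mu> j) (\<lambda>z. \<i> * complex_of_real (\<xi> \<bullet> (indicator (ball 0 r) z *\<^sub>R z)))" for \<xi>
      using i1 by (intro integrable_mult_right integrable_of_real integrable_inner_right) auto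
    ultimately have "(LINT z|\<mu> j. cis (\<xi> \<bullet> z) - 1) - \<i> * of_real (\<xi> \<bullet> m)
      = (LINT z|\<mu> j. (cis (\<xi> \<bullet> z) - 1) - \<i> * of_real (\<xi> \<bullet> (indicator (ball 0 r) z *\<^sub>R z)))" for \<xi>
      using i2 by simp
    also have "\<dots> \<xi> = (LINT z|\<mu> j. - comp_kernel r \<xi> z)" for \<xi>
      by (rule Bochner_Integration.integral_cong) (auto simp: comp_kernel_def indicator_def)
    also have "\<dots> \<xi> = - jump_exp N (v j) r \<xi>" for \<xi>
      unfolding \<mu>_def by (subst integral_density) (use v0 in auto)
    finally have e: "(LINT z|\<mu> j. cis (\<xi> \<bullet> z) - 1) - \<i> * of_real (\<xi> \<bullet> m) = - jump_exp N (v j) r \<xi>" for \<xi> .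
    have "char_fn (distr P borel (\<lambda>z. z - m)) \<xi> = exp (- jump_exp N (v j) r \<xi>)" for \<xi>
      unfolding char_fn_shift[OF P(1)] P(2) e[symmetric] cis_conv_exp
      by (simp add: exp_add[symmetric] algebra_simps)
    then show ?thesis using char_fn_shift(1)[OF P(1)] by blast
  qed
  then obtain Q where Q: "\<And>j. borel_prob (Q j)"
    "\<And>j \<xi>. char_fn (Q j) \<xi> = exp (- jump_exp N (v j) r \<xi>)"
    by metis
  have "(\<lambda>j. \<integral>z. v j z *\<^sub>R comp_kernel r \<xi> z \<partial>N) \<longlonglongrightarrow> jump_exp N w r \<xi>" for \<xi>
  proof (rule integral_dominated_convergence[where w = "\<lambda>z. norm (w z *\<^sub>R comp_kernel r \<xi> z)"])
    show "integrable N (\<lambda>z. norm (w z *\<^sub>R comp_kernel r \<xi> z))"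
      by (rule integrable_norm[OF integrable_comp_kernel[OF assms]])
    show "AE z in N. norm (v j z *\<^sub>R comp_kernel r \<xi> z) \<le> norm (w z *\<^sub>R comp_kernel r \<xi> z)" for j
      by (rule AE_I2) (auto simp: v_def indicator_def)
    show "AE z in N. (\<lambda>j. v j z *\<^sub>R comp_kernel r \<xi> z) \<longlonglongrightarrow> w z *\<^sub>R comp_kernel r \<xi> z"
    proof (rule AE_I2)
      fix z :: 'a
      show "(\<lambda>j. v j z *\<^sub>R comp_kernel r \<xi> z) \<longlonglongrightarrow> w z *\<^sub>R comp_kernel r \<xi> z"
      \<comment> \<open>At the origin every truncated weight is 0 and need not tend to
        \<open>w 0\<close>, but the kernel vanishes there.\<close>
      proof (cases "z = 0")
        case False
        have "(\<lambda>j. 1 / real (Suc j)) \<longlonglongrightarrow> 0" using LIMSEQ_inverse_real_of_nat by (simp add: inverse_eq_divide)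
        then have "eventually (\<lambda>j. 1 / real (Suc j) < norm z) sequentially"
          by (rule order_tendstoD) (use False in auto)
        then have "eventually (\<lambda>j. v j z *\<^sub>R comp_kernel r \<xi> z = w z *\<^sub>R comp_kernel r \<xi> z) sequentially"
          by eventually_elim (simp add: v_def)
        then show ?thesis by (rule tendsto_eventually)
      qed (simp add: comp_kernel_def)
    qed
  qed measurable
  then have "(\<lambda>j. char_fn (Q j) \<xi>) \<longlonglongrightarrow> exp (- jump_exp N w r \<xi>)" for \<xi>
    unfolding Q(2) by (intro tendsto_exp tendsto_minus)
  then show ?thesis using Q(1) unfolding cf_seq_def by blast
qed

section \<open>The functions h and Psi\<close>

lemma one_minus_cos_le: "1 - cos x \<le> x ^ 2 / (2::real)"
proof -
  have "1 - cos x = 2 * sin (x / 2) ^ 2"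
    using cos_double_sin[of "x / 2"] by simp
  also have "sin (x / 2) ^ 2 \<le> (x / 2) ^ 2"
    using abs_sin_x_le_abs_x[of "x / 2"] by (rule abs_le_square_iff[THEN iffD1])
  finally show ?thesis by (simp add: power_divide)
qed

lemma one_minus_cos_le_two: "1 - cos x \<le> (2::real)"
  using cos_ge_minus_one[of x] by linarith

lemma one_minus_cos_le_min:
  fixes z :: "'a::euclidean_space"
  assumes "0 < r" "norm \<xi> * r \<le> 1"
  shows "1 - cos (\<xi> \<bullet> z) \<le> 2 * min 1 (norm z ^ 2 / r ^ 2)"
proof -
  have "norm \<xi> \<le> 1 / r" using assms by (simp add: field_simps)
  then have "\<bar>\<xi> \<bullet> z\<bar> \<le> 1 / r * norm z"
    using Cauchy_Schwarz_ineq2[of \<xi> z] by (meson mult_right_mono norm_ge_zero order_trans)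
  then have "\<bar>\<xi> \<bullet> z\<bar> ^ 2 \<le> (1 / r * norm z) ^ 2" by (intro power_mono) auto
  then have "(\<xi> \<bullet> z) ^ 2 \<le> norm z ^ 2 / r ^ 2"
    by (simp add: power_mult_distrib power_divide)
  moreover have "0 \<le> norm z ^ 2 / r ^ 2" by simp
  ultimately have "(\<xi> \<bullet> z) ^ 2 / 2 \<le> 2 * (norm z ^ 2 / r ^ 2)" by linarith
  then show ?thesis
    using one_minus_cos_le[of "\<xi> \<bullet> z"] one_minus_cos_le_two[of "\<xi> \<bullet> z"] by (auto simp: min_def)
qed

lemma h_fun_integrable:
  assumes "levy_measure \<nu>" "0 < r"
  shows "integrable \<nu> (\<lambda>z. min 1 (norm z ^ 2 / r ^ 2))"
proof (rule levy_integrable[OF assms(1)])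
  fix z :: 'a
  have "min 1 (norm z ^ 2 / r ^ 2) \<le> (1 + 1 / r ^ 2) * min 1 (norm z ^ 2)"
  proof (cases "norm z ^ 2 \<le> 1")
    case True
    have "norm z ^ 2 / r ^ 2 \<le> (1 + 1 / r ^ 2) * norm z ^ 2" by (simp add: algebra_simps)
    then show ?thesis using True by (simp add: min_def)
  next
    case False
    have "1 \<le> 1 + 1 / r ^ 2" by simp
    moreover have "min 1 (norm z ^ 2) = 1" using False by simp
    ultimately show ?thesis by (simp add: min.coboundedI1)
  qed
  then show "norm (min 1 (norm z ^ 2 / r ^ 2)) \<le> (1 + 1 / r ^ 2) * min 1 (norm z ^ 2)" by simp
qed measurable

lemma h_fun_nonneg: "0 \<le> h_fun \<nu> r"
  unfolding h_fun_def by (rule integral_nonneg_AE) auto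

lemma h_fun_antimono:
  assumes "levy_measure \<nu>" "0 < r" "r \<le> r'"
  shows "h_fun \<nu> r' \<le> h_fun \<nu> r"
  unfolding h_fun_def
proof (rule integral_mono)
  fix z :: 'a
  have "norm z ^ 2 / r' ^ 2 \<le> norm z ^ 2 / r ^ 2"
    using assms by (intro divide_left_mono power_mono mult_pos_pos) auto
  then show "min 1 (norm z ^ 2 / r' ^ 2) \<le> min 1 (norm z ^ 2 / r ^ 2)" by (auto simp: min_def)
qed (use assms in \<open>auto intro!: h_fun_integrable\<close>)

text \<open>The converse of monotonicity up to a constant: replacing a scale by one that is
  \<open>k\<close> times smaller costs at most \<open>k ^ 2\<close>.\<close>

lemma h_fun_scale:
  assumes "levy_measure \<nu>" "0 < r" "1 \<le> k"
  shows "h_fun \<nu> r \<le> k ^ 2 * h_fun \<nu> (k * r)"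
proof -
  have "h_fun \<nu> r \<le> (LINT z|\<nu>. k ^ 2 * min 1 (norm z ^ 2 / (k * r) ^ 2))"
    unfolding h_fun_def
  proof (rule integral_mono)
    fix z :: 'a
    have "1 \<le> k ^ 2" using assms by simp
    moreover have "k ^ 2 * (norm z ^ 2 / (k * r) ^ 2) = norm z ^ 2 / r ^ 2"
      using assms by (simp add: power_mult_distrib)
    ultimately show "min 1 (norm z ^ 2 / r ^ 2) \<le> k ^ 2 * min 1 (norm z ^ 2 / (k * r) ^ 2)"
      by (cases "1 \<le> norm z ^ 2 / (k * r) ^ 2") (auto simp: min_def)
  qed (use assms in \<open>auto intro!: h_fun_integrable integrable_mult_right\<close>)
  then show ?thesis by (simp add: h_fun_def)
qed

lemma one_minus_cos_integrable:
  assumes "levy_measure \<nu>"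
  shows "integrable \<nu> (\<lambda>z. 1 - cos (\<xi> \<bullet> z))"
proof -
  define r where "r = 1 / (1 + norm \<xi>)"
  have r: "0 < r" "norm \<xi> * r \<le> 1" by (auto simp: r_def field_simps add_pos_nonneg)
  note [measurable_cong] = levy_sets[OF assms]
  have "norm (1 - cos (\<xi> \<bullet> z)) \<le> norm (2 * min 1 (norm z ^ 2 / r ^ 2))" for z
    using one_minus_cos_le_min[OF r, of z] by simp
  then show ?thesis
    by (intro Bochner_Integration.integrable_bound[OF integrable_mult_right[OF h_fun_integrable[OF assms r(1)], of 2]]) auto
qed

lemma Psi_s_nonneg: "0 \<le> Psi_s \<nu> \<xi>"
  unfolding Psi_s_def by (rule integral_nonneg_AE) auto

lemma Psi_s_le_h_fun:
  assumes "levy_measure \<nu>" "0 < r" "norm \<xi> * r \<le> 1"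
  shows "Psi_s \<nu> \<xi> \<le> 2 * h_fun \<nu> r"
proof -
  have "Psi_s \<nu> \<xi> \<le> (LINT z|\<nu>. 2 * min 1 (norm z ^ 2 / r ^ 2))"
    unfolding Psi_s_def
    by (rule integral_mono)
       (use assms one_minus_cos_le_min in \<open>auto intro!: one_minus_cos_integrable h_fun_integrable\<close>)
  then show ?thesis by (simp add: h_fun_def)
qed

text \<open>Converse of \<open>Psi_s_le_h_fun\<close> up to a dimensional constant, by averaging
  over frequencies of norm at most \<open>1 / r\<close>. All of them are involved, as the exponent
  may be small at particular ones.\<close>

lemma h_fun_le_Psi_s:
  fixes N :: "'a::euclidean_space measure"
  assumes N: "levy_measure N" and r: "0 < r" and C: "\<And>\<xi>. norm \<xi> \<le> 1 / r \<Longrightarrow> Psi_s N \<xi> \<le> C"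
  shows "h_fun N r \<le> 9 * real DIM('a) * C"
proof -
  have "0 \<le> C" using C[of 0] Psi_s_nonneg[of N 0] r by simp
  have "(\<integral>\<^sup>+z. ennreal (1 - cos (\<xi> \<bullet> z)) \<partial>N) \<le> ennreal C" if "norm \<xi> \<le> 1 / r" for \<xi>
    using C[OF that] nn_integral_eq_integral[OF one_minus_cos_integrable[OF N, of \<xi>]]
    by (simp add: Psi_s_def ennreal_leI)
  then have "(\<integral>\<^sup>+z. ennreal (min 1 ((1 / r * norm z) ^ 2)) \<partial>N) \<le> ennreal (9 * real DIM('a) * C)"
    using r \<open>0 \<le> C\<close> by (intro nn_integral_min_one_le levy_sigma_finite[OF N] levy_sets[OF N]) auto
  moreover have "(\<integral>\<^sup>+z. ennreal (min 1 ((1 / r * norm z) ^ 2)) \<partial>N) = ennreal (h_fun N r)"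
    using nn_integral_eq_integral[OF h_fun_integrable[OF N r]]
    by (simp add: h_fun_def power_mult_distrib power_divide)
  ultimately show ?thesis using \<open>0 \<le> C\<close> by simp
qed

lemma levy_exp_eq:
  "levy_exp N b \<xi> = - \<i> * of_real (b \<bullet> \<xi>) + (LINT z|N. comp_kernel 1 \<xi> z)"
  unfolding levy_exp_def comp_kernel_def ..

text \<open>Drift and compensator are purely imaginary. Therefore \<open>Psi_s\<close> is used from
  here on also for \<open>N\<close>, which may be asymmetric.\<close>

lemma Re_levy_exp:
  assumes "levy_measure N"
  shows "Re (levy_exp N b \<xi>) = Psi_s N \<xi>"
proof -
  have "integrable N (\<lambda>z. 1 *\<^sub>R comp_kernel 1 \<xi> z)"
    by (rule integrable_comp_kernel[OF assms, where W=1]) auto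
  then have "Re (LINT z|N. comp_kernel 1 \<xi> z) = (LINT z|N. Re (comp_kernel 1 \<xi> z))"
    by simp
  also have "\<dots> = Psi_s N \<xi>"
    unfolding Psi_s_def by (rule Bochner_Integration.integral_cong) (auto simp: comp_kernel_def indicator_def)
  finally show ?thesis by (simp add: levy_exp_eq)
qed

section \<open>Continuity and inversion of the function h\<close>

lemma h_fun_LIMSEQ:
  fixes \<nu> :: "'a::euclidean_space measure"
  assumes \<nu>: "levy_measure \<nu>" and X: "X \<longlonglongrightarrow> x" and x: "0 < x"
  shows "(\<lambda>n. h_fun \<nu> (X n)) \<longlonglongrightarrow> h_fun \<nu> x"
proof -
  note [measurable_cong] = levy_sets[OF \<nu>]
  \<comment> \<open>Clipping at x/2 changes only finitely many terms and provides one integrable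
    majorant, the integrand at the radius x/2.\<close>
  define Y where "Y = (\<lambda>n. max (X n) (x / 2))"
  have Y: "Y \<longlonglongrightarrow> x"
    using tendsto_max[OF X tendsto_const[of "x / 2"]] x by (simp add: Y_def max_def)
  have "(\<lambda>n. h_fun \<nu> (Y n)) \<longlonglongrightarrow> h_fun \<nu> x"
    unfolding h_fun_def
  proof (rule integral_dominated_convergence[where w = "\<lambda>z. min 1 (norm z ^ 2 / (x / 2) ^ 2)"])
    show "integrable \<nu> (\<lambda>z. min 1 (norm z ^ 2 / (x / 2) ^ 2))"
      by (rule h_fun_integrable[OF \<nu>]) (use x in simp)
    show "AE z in \<nu>. (\<lambda>n. min 1 (norm z ^ 2 / Y n ^ 2)) \<longlonglongrightarrow> min 1 (norm z ^ 2 / x ^ 2)"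
      using x by (intro AE_I2 tendsto_intros Y) auto
    show "AE z in \<nu>. norm (min 1 (norm z ^ 2 / Y n ^ 2)) \<le> min 1 (norm z ^ 2 / (x / 2) ^ 2)" for n
    proof (rule AE_I2)
      fix z :: 'a
      have "x / 2 \<le> Y n" by (simp add: Y_def)
      then have "norm z ^ 2 / Y n ^ 2 \<le> norm z ^ 2 / (x / 2) ^ 2"
        using x by (intro divide_left_mono power_mono mult_pos_pos zero_less_power) auto
      then show "norm (min 1 (norm z ^ 2 / Y n ^ 2)) \<le> min 1 (norm z ^ 2 / (x / 2) ^ 2)"
        by (auto simp: min_def)
    qed
  qed measurable
  moreover have "eventually (\<lambda>n. h_fun \<nu> (Y n) = h_fun \<nu> (X n)) sequentially"
    using order_tendstoD(1)[OF X, of "x / 2"] x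
    by (auto elim!: eventually_mono simp: Y_def max_def)
  ultimately show ?thesis by (rule Lim_transform_eventually)
qed

lemma h_fun_continuous:
  assumes "levy_measure \<nu>"
  shows "continuous_on {0<..} (h_fun \<nu>)"
  unfolding continuous_on_sequentially by (auto simp: comp_def intro!: h_fun_LIMSEQ[OF assms])

lemma h_fun_at_infinity:
  fixes \<nu> :: "'a::euclidean_space measure"
  assumes \<nu>: "levy_measure \<nu>"
  shows "(\<lambda>n. h_fun \<nu> (real (Suc n))) \<longlonglongrightarrow> 0"
proof -
  note [measurable_cong] = levy_sets[OF \<nu>]
  have "(\<lambda>n. h_fun \<nu> (real (Suc n))) \<longlonglongrightarrow> (LINT z|\<nu>. 0)"
    unfolding h_fun_def
  proof (rule integral_dominated_convergence[where w = "\<lambda>z. min 1 (norm z ^ 2 / 1 ^ 2)"])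
    show "integrable \<nu> (\<lambda>z. min 1 (norm z ^ 2 / 1 ^ 2))"
      by (rule h_fun_integrable[OF \<nu>]) simp
    show "AE z in \<nu>. (\<lambda>n. min 1 (norm z ^ 2 / real (Suc n) ^ 2)) \<longlonglongrightarrow> 0"
    proof (rule AE_I2)
      fix z :: 'a
      have "(\<lambda>n. min 1 (norm z ^ 2 * (inverse (real (Suc n))) ^ 2)) \<longlonglongrightarrow> min 1 (norm z ^ 2 * 0 ^ 2)"
        by (intro tendsto_intros LIMSEQ_inverse_real_of_nat)
      then show "(\<lambda>n. min 1 (norm z ^ 2 / real (Suc n) ^ 2)) \<longlonglongrightarrow> 0"
        by (simp add: divide_inverse power_inverse del: of_nat_Suc)
    qed
    show "AE z in \<nu>. norm (min 1 (norm z ^ 2 / real (Suc n) ^ 2)) \<le> min 1 (norm z ^ 2 / 1 ^ 2)" for n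
    proof (rule AE_I2)
      fix z :: 'a
      have "norm z ^ 2 / real (Suc n) ^ 2 \<le> norm z ^ 2 / 1 ^ 2"
        by (intro divide_left_mono power_mono mult_pos_pos zero_less_power) auto
      then show "norm (min 1 (norm z ^ 2 / real (Suc n) ^ 2)) \<le> min 1 (norm z ^ 2 / 1 ^ 2)"
        by (auto simp: min_def simp del: of_nat_Suc)
    qed
  qed measurable
  then show ?thesis by simp
qed

lemma h_inv_works:
  fixes \<nu> :: "'a::euclidean_space measure"
  assumes \<nu>: "levy_measure \<nu>" and unb: "\<And>u. \<exists>r>0. h_fun \<nu> r > u" and u: "0 < u"
  shows "0 < h_inv \<nu> u" "h_fun \<nu> (h_inv \<nu> u) = u"
proof -
  note [measurable_cong] = levy_sets[OF \<nu>]
  obtain r1 where r1: "r1 > 0" "h_fun \<nu> r1 > u" using unb by blast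
  obtain n where n: "h_fun \<nu> (real (Suc n)) < u"
    using order_tendstoD(2)[OF h_fun_at_infinity[OF \<nu>] u] by (auto simp: eventually_sequentially)
  define r2 where "r2 = real (Suc n)"
  have r2: "r2 > 0" "h_fun \<nu> r2 < u" using n by (auto simp: r2_def)
  have le: "r1 \<le> r2" using h_fun_antimono[OF \<nu> r2(1), of r1] r1 r2 by linarith
  have "\<exists>r\<ge>r1. r \<le> r2 \<and> h_fun \<nu> r = u"
    using r1 r2 le by (intro IVT2' continuous_on_subset[OF h_fun_continuous[OF \<nu>]]) auto
  then obtain r where r: "r > 0" "h_fun \<nu> r = u" using r1 by (metis order_less_le_trans)
  \<comment> \<open>If \<open>h_fun\<close> took the same value at x < y, almost every jump would
    have length at least y. Then \<open>h_fun\<close> would be constant below y, against its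
    unboundedness at small radii.\<close>
  have strict: "h_fun \<nu> y \<noteq> h_fun \<nu> x" if xy: "0 < x" "x < y" for x y
  proof
    assume eq: "h_fun \<nu> y = h_fun \<nu> x"
    let ?m = "\<lambda>r z. min 1 (norm (z::'a) ^ 2 / r ^ 2)"
    have le: "?m y z \<le> ?m x z" for z
    proof -
      have "norm z ^ 2 / y ^ 2 \<le> norm z ^ 2 / x ^ 2"
        using xy by (intro divide_left_mono power_mono mult_pos_pos zero_less_power) auto
      then show ?thesis by (auto simp: min_def)
    qed
    have ix: "integrable \<nu> (?m x)" and iy: "integrable \<nu> (?m y)"
      using h_fun_integrable[OF \<nu>] xy by auto
    have "(LINT z|\<nu>. ?m x z - ?m y z) = 0"
      using eq ix iy by (simp add: h_fun_def)
    then have "AE z in \<nu>. ?m x z - ?m y z = 0"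
      using le by (subst (asm) integral_nonneg_eq_0_iff_AE) (use ix iy in auto)
    moreover have "AE z in \<nu>. z \<noteq> 0"
      using \<nu> by (intro AE_I[of _ _ "{0}"]) (auto simp: levy_measure_def)
    ultimately have ae: "AE z in \<nu>. y \<le> norm z"
    proof eventually_elim
      case (elim z)
      show ?case
      proof (rule ccontr)
        assume "\<not> y \<le> norm z"
        then have *: "norm z ^ 2 < y ^ 2" by (intro power_strict_mono) auto
        then have "norm z ^ 2 / y ^ 2 < 1" using xy by simp
        moreover have "norm z ^ 2 / y ^ 2 < norm z ^ 2 / x ^ 2"
          using xy elim by (intro divide_strict_left_mono power_strict_mono) auto
        ultimately show False using elim by (auto simp: min_def split: if_splits)
      qed
    qed
    obtain r0 where r0: "r0 > 0" "h_fun \<nu> r0 > h_fun \<nu> y" using unb by blast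
    then have "r0 < y" using h_fun_antimono[OF \<nu>, of y r0] xy by force
    have "h_fun \<nu> r0 = h_fun \<nu> y"
      unfolding h_fun_def
    proof (rule integral_cong_AE)
      show "AE z in \<nu>. ?m r0 z = ?m y z"
        using ae
      proof eventually_elim
        case (elim z)
        have "y ^ 2 \<le> norm z ^ 2" "r0 ^ 2 \<le> norm z ^ 2"
          using elim \<open>r0 < y\<close> r0 xy by (auto intro!: power_mono)
        then show ?case using r0 xy by simp
      qed
    qed measurable
    then show False using r0 by simp
  qed
  have "\<exists>!r. r > 0 \<and> h_fun \<nu> r = u"
    using r strict by (metis linorder_neqE_linordered_idom)
  from theI'[OF this] show "0 < h_inv \<nu> u" "h_fun \<nu> (h_inv \<nu> u) = u"
    unfolding h_inv_def by auto
qed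

text \<open>Domination of measures becomes a bound on the Radon-Nikodym density. With it, parts of
  \<open>\<nu>\<close> can be subtracted from \<open>N\<close> pointwise, as weights.\<close>

lemma levy_density_RN:
  fixes N \<nu> :: "'a::euclidean_space measure"
  assumes N: "levy_measure N" and \<nu>: "levy_measure \<nu>" and a1: "0 < a1"
    and dom: "\<forall>B\<in>sets borel. ennreal a1 * emeasure \<nu> B \<le> emeasure N B"
  shows "\<exists>g. g \<in> borel_measurable borel \<and> (\<forall>z. 0 \<le> g z) \<and> (\<forall>z. a1 * g z \<le> 1) \<and>
    \<nu> = density N (\<lambda>z. ennreal (g z))"
proof -
  interpret N: sigma_finite_measure N by (rule levy_sigma_finite[OF N])
  note [measurable_cong] = levy_sets[OF N]
  have "absolutely_continuous N \<nu>"
    unfolding absolutely_continuous_def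
  proof
    fix B assume "B \<in> null_sets N"
    then have B: "B \<in> sets borel" "emeasure N B = 0" by (auto simp: null_sets_def levy_sets[OF N])
    then have "ennreal a1 * emeasure \<nu> B \<le> 0" using dom by metis
    then show "B \<in> null_sets \<nu>" using B a1 by (auto simp: null_sets_def levy_sets[OF \<nu>])
  qed
  then obtain f where f [measurable]: "f \<in> borel_measurable N" and \<nu>f: "density N f = \<nu>"
    using N.Radon_Nikodym levy_sets[OF N] levy_sets[OF \<nu>] by blast
  have "AE z in N. 1 / real (Suc n) \<le> norm z \<longrightarrow> ennreal a1 * f z \<le> 1" for n
  proof -
    \<comment> \<open>Keeping away from the origin makes the \<open>N\<close>-mass of
      \<open>D\<close> finite, so that a violation of the bound on a set of positive mass gives a
      strict inequality of integrals.\<close>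
    define D where "D = {z. 1 / real (Suc n) \<le> norm z \<and> 1 < ennreal a1 * f z}"
    have [measurable]: "D \<in> sets N"
      using levy_space[OF N] unfolding D_def by measurable
    let ?F = "indicator D :: 'a \<Rightarrow> ennreal" and ?G = "\<lambda>z. ennreal a1 * (f z * indicator D z)"
    have "emeasure N D \<le> emeasure N {z. 1 / real (Suc n) \<le> norm z}"
      by (intro emeasure_mono) (auto simp: D_def levy_sets[OF N])
    then have fin: "integral\<^sup>N N ?F \<noteq> \<infinity>"
      using levy_emeasure_outside_finite[OF N, of "1 / real (Suc n)"] by (auto simp: top_unique)
    have "integral\<^sup>N N ?G = ennreal a1 * emeasure \<nu> D"
      by (simp add: nn_integral_cmult \<nu>f[symmetric] emeasure_density)
    also have "\<dots> \<le> emeasure N D"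
      using dom \<open>D \<in> sets N\<close> by (auto simp: levy_sets[OF N])
    finally have GF: "\<not> integral\<^sup>N N ?F < integral\<^sup>N N ?G" by simp
    have "AE z in N. ?G z \<le> ?F z"
    proof (rule ccontr)
      assume "\<not> (AE z in N. ?G z \<le> ?F z)"
      then have "integral\<^sup>N N ?F < integral\<^sup>N N ?G"
        using fin by (intro nn_integral_less AE_I2) (auto simp: D_def less_imp_le split: split_indicator)
      then show False using GF by simp
    qed
    then show ?thesis
      by (rule AE_mp) (auto simp: D_def indicator_def intro!: AE_I2 split: if_splits)
  qed
  then have "AE z in N. \<forall>n. 1 / real (Suc n) \<le> norm z \<longrightarrow> ennreal a1 * f z \<le> 1"
    by (intro AE_all_countable[THEN iffD2] allI)
  moreover have "AE z in N. z \<noteq> 0"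
    using N by (intro AE_I[of _ _ "{0}"]) (auto simp: levy_measure_def)
  ultimately have le: "AE z in N. ennreal a1 * f z \<le> 1"
  proof eventually_elim
    case (elim z)
    then obtain n where "inverse (real (Suc n)) < norm z"
      using reals_Archimedean[of "norm z"] by (metis zero_less_norm_iff)
    then show ?case using elim by (auto simp: inverse_eq_divide simp del: of_nat_Suc intro: less_imp_le)
  qed
  \<comment> \<open>Clipping alters \<open>f\<close> only on a null set and makes the bound hold at
    every point.\<close>
  define g where "g = (\<lambda>z. min (1 / a1) (enn2real (f z)))"
  have "\<nu> = density N (\<lambda>z. ennreal (g z))"
    unfolding \<nu>f[symmetric]
  proof (rule density_cong)
    show "AE z in N. f z = ennreal (g z)"
      using le
    proof eventually_elim
      case (elim z)
      then have "f z \<noteq> \<infinity>" using a1 by (auto simp: ennreal_mult_top top_unique)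
      then obtain y where y: "f z = ennreal y" "0 \<le> y" by (cases "f z") auto
      then have "a1 * y \<le> 1" using elim a1 by (simp add: ennreal_mult[symmetric])
      then have "y \<le> 1 / a1" using a1 by (simp add: field_simps)
      then show ?case using y by (simp add: g_def)
    qed
  qed (auto simp: g_def)
  moreover have "g \<in> borel_measurable borel"
    using f unfolding g_def by (simp add: measurable_cong_sets[OF levy_sets[OF N] refl])
  moreover have "0 \<le> g z" "a1 * g z \<le> 1" for z
    using a1 by (auto simp: g_def min_def field_simps)
  ultimately show ?thesis by blast
qed

section \<open>Consequences of condition (C3)\<close>

text \<open>\<open>levy_density\<close> asks only for an integrable nonnegative function; total mass
  1 is the value of its transform at frequency 0.\<close>

lemma levy_density_prob:
  assumes p: "levy_density N b p" and t: "0 < t"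
  shows "borel_prob (density lborel (\<lambda>y. ennreal (p t y)))"
    "char_fn (density lborel (\<lambda>y. ennreal (p t y))) \<xi> = exp (- (of_real t * levy_exp N b \<xi>))"
proof -
  have p0: "\<And>y. 0 \<le> p t y" and pi: "integrable lborel (p t)"
    and pc: "\<And>\<xi>. (LINT y|lborel. cis (\<xi> \<bullet> y) * complex_of_real (p t y)) = exp (- (of_real t * levy_exp N b \<xi>))"
    using p t by (auto simp: levy_density_def)
  have [measurable]: "p t \<in> borel_measurable borel" using pi by auto
  have "levy_exp N b 0 = 0" by (simp add: levy_exp_def)
  then have "complex_of_real (LINT y|lborel. p t y) = 1" using pc[of 0] by simp
  then have "(LINT y|lborel. p t y) = 1" by (simp only: of_real_eq_1_iff)
  then have "(\<integral>\<^sup>+y. ennreal (p t y) \<partial>lborel) = 1"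
    using nn_integral_eq_integral[OF pi] p0 by simp
  then show "borel_prob (density lborel (\<lambda>y. ennreal (p t y)))"
    unfolding borel_prob_def by (auto intro!: prob_spaceI simp: emeasure_density)
  show "char_fn (density lborel (\<lambda>y. ennreal (p t y))) \<xi> = exp (- (of_real t * levy_exp N b \<xi>))"
    unfolding char_fn_def pc[symmetric]
    by (subst integral_density) (auto simp: p0 scaleR_conv_of_real mult.commute)
qed

locale levy_setup =
  fixes N :: "'a::euclidean_space measure" and b p and T3 :: ereal and c3 \<alpha> a1 a2 :: real and \<nu>
  assumes hyps: "thm43_hyps N b p T3 c3 \<alpha> \<nu> a1 a2"
    and \<nu>: "levy_measure \<nu>" and sym: "symmetric_measure \<nu>"
    and a1: "0 < a1" "a1 \<le> 1" and a2: "1 \<le> a2"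
begin

lemma N: "levy_measure N" and dens: "levy_density N b p"
  and dom: "\<forall>B\<in>sets borel. ennreal a1 * emeasure \<nu> B \<le> emeasure N B"
  and Psi_le: "ereal (norm x) > 1 / T3 \<Longrightarrow> Psi_s N x \<le> a2 * Psi_s \<nu> x"
  and C3: "0 < T3" "0 < c3" "c3 \<le> 1" "0 < \<alpha>" "\<alpha> \<le> 2"
    "ereal (norm x) > 1 / T3 \<Longrightarrow> c3 * Psi_star N b (norm x) \<le> Psi_s N x"
    "l \<ge> 1 \<Longrightarrow> ereal r > 1 / T3 \<Longrightarrow> c3 * l powr \<alpha> * Psi_star N b r \<le> Psi_star N b (l * r)"
  using hyps by (auto simp: thm43_hyps_def cond_C3_def Re_levy_exp)

lemma Psi_s_le_Psi_star:
  assumes "0 < R" "norm \<xi> \<le> R"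
  shows "Psi_s N \<xi> \<le> Psi_star N b R"
proof -
  \<comment> \<open>A real supremum says something about its members only for a bounded set;
    \<open>Psi_s_le_h_fun\<close> gives the bound.\<close>
  have "bdd_above ((\<lambda>z. Re (levy_exp N b z)) ` cball 0 R)"
    using assms(1)
    by (intro bdd_aboveI[of _ "2 * h_fun N (1 / R)"])
       (auto simp: Re_levy_exp[OF N] intro!: Psi_s_le_h_fun[OF N] simp: field_simps)
  then show ?thesis
    unfolding Psi_star_def Re_levy_exp[OF N, of b \<xi>, symmetric]
    by (rule cSUP_upper2[of _ _ \<xi>]) (use assms in auto)
qed

lemma h_N_le_Psi_star:
  assumes "0 < \<rho>"
  shows "h_fun N \<rho> \<le> 9 * real DIM('a) * Psi_star N b (1 / \<rho>)"
  by (rule h_fun_le_Psi_s[OF N assms]) (use assms in \<open>auto intro!: Psi_s_le_Psi_star\<close>)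

lemma nu_density: "\<exists>g. g \<in> borel_measurable borel \<and> (\<forall>z. 0 \<le> g z) \<and> (\<forall>z. a1 * g z \<le> 1) \<and>
    \<nu> = density N (\<lambda>z. ennreal (g z))"
  by (rule levy_density_RN[OF N \<nu> a1(1) dom])

lemma h_nu_le_h_N:
  assumes "0 < \<rho>"
  shows "a1 * h_fun \<nu> \<rho> \<le> h_fun N \<rho>"
proof -
  obtain g where g [measurable]: "g \<in> borel_measurable borel" and g0: "\<And>z. 0 \<le> g z" "\<And>z. a1 * g z \<le> 1"
    and eq: "\<nu> = density N (\<lambda>z. ennreal (g z))"
    using nu_density by auto
  note [measurable_cong] = levy_sets[OF N]
  let ?m = "\<lambda>z::'a. min 1 (norm z ^ 2 / \<rho> ^ 2)"
  have "a1 * h_fun \<nu> \<rho> = (LINT z|N. (a1 * g z) * ?m z)"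
    unfolding h_fun_def eq by (subst integral_density) (auto simp: g0 mult.assoc)
  also have "\<dots> \<le> (LINT z|N. ?m z)"
  proof (rule integral_mono_AE')
    show "AE z in N. a1 * g z * ?m z \<le> ?m z"
      using g0 a1 by (intro AE_I2 mult_left_le_one_le) auto
  qed (use h_fun_integrable[OF N assms] in auto)
  finally show ?thesis by (simp add: h_fun_def)
qed

text \<open>Transfers (C3) from \<open>N\<close> to \<open>\<nu>\<close>: \<open>h_fun \<nu>\<close>
  is below \<open>h_fun N\<close>, which is below \<open>Psi_star\<close> at
  \<open>1 / \<rho>\<close>; the scaling in (C3) raises this to \<open>Psi_star\<close> at
  \<open>norm \<xi>\<close>, then (C3) passes to the real part at \<open>\<xi>\<close> itself, and
  \<open>Psi_le\<close> returns to \<open>\<nu>\<close>. Each step costs a constant.\<close>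

lemma Psi_nu_lower:
  assumes \<rho>: "0 < \<rho>" "1 / T3 < ereal (1 / \<rho>)" and \<xi>: "1 \<le> norm \<xi> * \<rho>"
  shows "c3^2 * a1 / (9 * real DIM('a) * a2) * (norm \<xi> * \<rho>) powr \<alpha> * h_fun \<nu> \<rho> \<le> Psi_s \<nu> \<xi>"
proof -
  have "1 / \<rho> \<le> norm \<xi>" using \<xi> \<rho> by (simp add: field_simps)
  then have big: "1 / T3 < ereal (norm \<xi>)" using \<rho>(2) by (meson ereal_less_eq(3) order_less_le_trans)
  have S: "Psi_star N b (norm \<xi> * \<rho> * (1 / \<rho>)) \<ge> c3 * (norm \<xi> * \<rho>) powr \<alpha> * Psi_star N b (1 / \<rho>)"
    by (rule C3(7)[OF \<xi> \<rho>(2)])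
  then have S: "Psi_star N b (norm \<xi>) \<ge> c3 * (norm \<xi> * \<rho>) powr \<alpha> * Psi_star N b (1 / \<rho>)"
    using \<rho> by simp
  have "c3^2 * (norm \<xi> * \<rho>) powr \<alpha> * (a1 * h_fun \<nu> \<rho>)
      \<le> c3^2 * (norm \<xi> * \<rho>) powr \<alpha> * (9 * real DIM('a) * Psi_star N b (1 / \<rho>))"
    using h_nu_le_h_N[OF \<rho>(1)] h_N_le_Psi_star[OF \<rho>(1)] C3 by (intro mult_left_mono) auto
  also have "\<dots> = 9 * real DIM('a) * (c3 * (c3 * (norm \<xi> * \<rho>) powr \<alpha> * Psi_star N b (1 / \<rho>)))"
    by (simp add: power2_eq_square mult_ac)
  also have "\<dots> \<le> 9 * real DIM('a) * (c3 * Psi_star N b (norm \<xi>))"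
    using S C3 by (intro mult_left_mono) auto
  also have "\<dots> \<le> 9 * real DIM('a) * (a2 * Psi_s \<nu> \<xi>)"
    using C3(6)[OF big] Psi_le[OF big] by (intro mult_left_mono) auto
  finally have "c3^2 * (norm \<xi> * \<rho>) powr \<alpha> * (a1 * h_fun \<nu> \<rho>) / (9 * real DIM('a) * a2) \<le> Psi_s \<nu> \<xi>"
    using a2 by (subst pos_divide_le_eq) (auto simp: mult_ac)
  then show ?thesis by (simp add: mult_ac)
qed

text \<open>One frequency of norm \<open>1 / \<rho>\<close>, in any direction, is enough, because
  (C3) bounds \<open>Psi_star\<close> by the real part of the exponent in every direction.\<close>

lemma h_N_upper:
  assumes \<rho>: "0 < \<rho>" "1 / T3 < ereal (1 / \<rho>)"
  shows "c3 * h_fun N \<rho> \<le> 18 * real DIM('a) * a2 * h_fun \<nu> \<rho>"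
proof -
  obtain e :: 'a where e: "norm e = 1" using vector_choose_size[of 1] by auto
  define \<xi> where "\<xi> = (1 / \<rho>) *\<^sub>R e"
  have n: "norm \<xi> = 1 / \<rho>" using e \<rho> by (simp add: \<xi>_def)
  have "c3 * h_fun N \<rho> \<le> c3 * (9 * real DIM('a) * Psi_star N b (1 / \<rho>))"
    using h_N_le_Psi_star[OF \<rho>(1)] C3 by (intro mult_left_mono) auto
  also have "\<dots> = 9 * real DIM('a) * (c3 * Psi_star N b (norm \<xi>))" by (simp add: n)
  also have "\<dots> \<le> 9 * real DIM('a) * (a2 * Psi_s \<nu> \<xi>)"
    using C3(6)[of \<xi>] Psi_le[of \<xi>] \<rho> n by (intro mult_left_mono) auto
  also have "\<dots> \<le> 9 * real DIM('a) * (a2 * (2 * h_fun \<nu> \<rho>))"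
    using a2 \<rho> n by (intro mult_left_mono Psi_s_le_h_fun[OF \<nu>]) auto
  finally show ?thesis by (simp add: mult_ac)
qed

lemma exists_scale: "\<exists>\<rho>>0. 1 / T3 < ereal (1 / \<rho>)"
proof (cases T3)
  case (real x)
  then have "0 < x" using C3(1) by simp
  then have "1 / T3 < ereal (1 / (x / 2))" using real by (simp add: field_simps one_ereal_def)
  then show ?thesis using \<open>0 < x\<close> by (intro exI[of _ "x / 2"]) auto
next
  case PInf
  then show ?thesis by (intro exI[of _ 1]) auto
qed (use C3(1) in auto)

text \<open>If \<open>h_fun \<nu>\<close> vanished at one scale it would vanish at all of them, and
  by \<open>h_N_upper\<close> there would be no jumps in \<open>N\<close>. The law at time 1 would
  then be the point mass at \<open>b\<close>: after a shift its transform is 1, so all tail bounds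
  are 0. This contradicts the existence of a density.\<close>

lemma h_nu_pos:
  assumes "0 < \<rho>"
  shows "0 < h_fun \<nu> \<rho>"
proof (rule ccontr)
  assume "\<not> 0 < h_fun \<nu> \<rho>"
  then have h0: "h_fun \<nu> \<rho> = 0" using h_fun_nonneg[of \<nu> \<rho>] by simp
  have h00: "h_fun \<nu> \<rho>' = 0" if "0 < \<rho>'" for \<rho>'
  proof (cases "\<rho> \<le> \<rho>'")
    case True
    then show ?thesis using h_fun_antimono[OF \<nu> assms True] h0 h_fun_nonneg[of \<nu> \<rho>'] by simp
  next
    case False
    then show ?thesis using h_fun_scale[OF \<nu> that, of "\<rho> / \<rho>'"] that h0 h_fun_nonneg[of \<nu> \<rho>'] by simp
  qed
  obtain \<rho>0 where r0: "\<rho>0 > 0" "1 / T3 < ereal (1 / \<rho>0)" using exists_scale by auto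
  have "c3 * h_fun N \<rho>0 \<le> 0" using h_N_upper[OF r0] h00[OF r0(1)] by simp
  then have "h_fun N \<rho>0 = 0"
    using C3(2) h_fun_nonneg[of N \<rho>0] by (metis mult_le_0_iff order_antisym less_le_not_le)
  then have "AE z in N. min 1 (norm z ^ 2 / \<rho>0 ^ 2) = 0"
    unfolding h_fun_def
    by (subst (asm) integral_nonneg_eq_0_iff_AE) (use h_fun_integrable[OF N r0(1)] in auto)
  moreover have "AE z in N. z \<noteq> 0"
    using N by (intro AE_I[of _ _ "{0}"]) (auto simp: levy_measure_def)
  ultimately have "AE z in N. False"
    by eventually_elim (use r0 in \<open>auto simp: min_def split: if_splits\<close>)
  then have "(LINT z|N. comp_kernel 1 \<xi> z) = 0" for \<xi>
    by (intro integral_eq_zero_AE) auto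
  then have le: "levy_exp N b \<xi> = - \<i> * of_real (b \<bullet> \<xi>)" for \<xi>
    by (simp add: levy_exp_eq)
  define Q0 where "Q0 = density lborel (\<lambda>y. ennreal (p 1 y))"
  define Q where "Q = distr Q0 borel (\<lambda>z. z - b)"
  have Q0: "borel_prob Q0" "char_fn Q0 \<xi> = exp (\<i> * of_real (b \<bullet> \<xi>))" for \<xi>
    using levy_density_prob[OF dens, of 1] by (auto simp: Q0_def le)
  have Q: "borel_prob Q" "char_fn Q \<xi> = 1" for \<xi>
    using char_fn_shift[OF Q0(1), of b] unfolding Q_def
    by (auto simp: Q0(2) cis_conv_exp exp_add[symmetric] inner_commute)
  interpret Q: prob_space Q using borel_probD[OF Q(1)] by auto
  have [measurable_cong]: "sets Q0 = sets borel" using borel_probD[OF Q0(1)] by auto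
  have "AE z in Q. norm z < inverse (real (Suc n))" for n
  proof (rule AE_I)
    show "{z \<in> space Q. \<not> norm z < inverse (real (Suc n))} \<subseteq> {z. inverse (real (Suc n)) \<le> norm z}" by auto
    show "emeasure Q {z. inverse (real (Suc n)) \<le> norm z} = 0"
      using borel_prob_tail_le[OF Q(1), of "inverse (real (Suc n))"] measure_nonneg[of Q "{z. inverse (real (Suc n)) \<le> norm z}"]
      by (simp add: Q(2) Q.emeasure_eq_measure measure_le_0_iff)
    show "{z. inverse (real (Suc n)) \<le> norm z} \<in> sets Q"
      unfolding borel_probD(3)[OF Q(1)] by measurable
  qed
  then have "AE z in Q. \<forall>n. norm z < inverse (real (Suc n))"
    by (intro AE_all_countable[THEN iffD2] allI)
  moreover have "AE z in Q. z \<noteq> 0"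
  proof (rule AE_I)
    have "(\<lambda>z. z - b) -` {0} \<inter> space Q0 = {b}"
      using borel_probD(4)[OF Q0(1)] by auto
    then have "emeasure Q {0} = emeasure Q0 {b}"
      unfolding Q_def by (subst emeasure_distr) auto
    also have "\<dots> = 0"
    proof -
      have "continuous_on UNIV (p 1)" using dens by (auto simp: levy_density_def)
      then have "p 1 \<in> borel_measurable borel" by (rule borel_measurable_continuous_onI)
      then have "absolutely_continuous lborel Q0"
        unfolding Q0_def by (intro absolutely_continuousI_density) auto
      moreover have "{b} \<in> null_sets lborel" by (simp add: null_sets_def)
      ultimately show ?thesis by (auto simp: absolutely_continuous_def)
    qed
    finally show "emeasure Q {0} = 0" .
  qed (auto simp: borel_probD[OF Q(1)])
  ultimately have "AE z in Q. False"
  proof eventually_elim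
    case (elim z)
    then show ?case using reals_Archimedean[of "norm z"] by (metis zero_less_norm_iff less_asym)
  qed
  then show False by simp
qed

text \<open>By \<open>Psi_nu_lower\<close> the exponent grows at least like the power \<alpha> along
  a ray, and \<open>Psi_s_le_h_fun\<close> passes this growth to \<open>h_fun\<close> at small
  radii. The factor \<open>l\<close> is chosen so that \<open>c * l powr \<alpha>\<close> exceeds
  \<open>2 * \<bar>u\<bar>\<close>.\<close>

lemma h_nu_unbounded: "\<exists>r>0. h_fun \<nu> r > u"
proof -
  obtain \<rho> where \<rho>: "\<rho> > 0" "1 / T3 < ereal (1 / \<rho>)" using exists_scale by auto
  obtain e :: 'a where e: "norm e = 1" using vector_choose_size[of 1] by auto
  define c where "c = c3^2 * a1 / (9 * real DIM('a) * a2) * h_fun \<nu> \<rho>"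
  have c: "0 < c" using C3 a1 a2 h_nu_pos[OF \<rho>(1)] by (simp add: c_def)
  define l where "l = max 1 ((2 * (\<bar>u\<bar> + 1) / c) powr (1 / \<alpha>))"
  have l: "1 \<le> l" by (simp add: l_def)
  have "2 * (\<bar>u\<bar> + 1) / c = ((2 * (\<bar>u\<bar> + 1) / c) powr (1 / \<alpha>)) powr \<alpha>"
    using C3(4) c by (simp add: powr_powr)
  also have "\<dots> \<le> l powr \<alpha>" using C3(4) by (intro powr_mono2) (auto simp: l_def)
  finally have "2 * (\<bar>u\<bar> + 1) \<le> c * l powr \<alpha>" using c by (simp add: field_simps)
  also have "\<dots> \<le> Psi_s \<nu> ((l / \<rho>) *\<^sub>R e)"
    using Psi_nu_lower[OF \<rho>, of "(l / \<rho>) *\<^sub>R e"] l \<rho> e by (simp add: c_def mult_ac)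
  also have "\<dots> \<le> 2 * h_fun \<nu> (\<rho> / l)"
    using l \<rho> e by (intro Psi_s_le_h_fun[OF \<nu>]) auto
  finally have "u < h_fun \<nu> (\<rho> / l)" by simp
  then show ?thesis using l \<rho> by (intro exI[of _ "\<rho> / l"]) auto
qed

lemma h_inv_nu:
  assumes "0 < u"
  shows "0 < h_inv \<nu> u" "h_fun \<nu> (h_inv \<nu> u) = u"
  using h_inv_works[OF \<nu> h_nu_unbounded assms] by auto

end

section \<open>Propagation of lower bounds\<close>

lemma cf_seq_nonneg:
  assumes Q: "cf_seq Q \<phi>" and F: "integrable lborel F" and f0: "\<And>x. 0 \<le> Re (inv_ft F x)"
  shows "0 \<le> Re (inv_ft (\<lambda>\<xi>. F \<xi> * \<phi> \<xi>) x)"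
  by (rule LIMSEQ_le_const[OF cf_seq_inv_ft[OF Q F]]) (auto intro!: integral_nonneg_AE f0)

text \<open>The approximating laws need not be symmetric, but a real limit is shared by their
  reflections. Averages over x - z and over x + z thus have the same limit.\<close>

lemma cf_seq_reflect:
  assumes Q: "cf_seq Q \<phi>" and real: "\<And>\<xi>. Im (\<phi> \<xi>) = 0"
  shows "cf_seq (\<lambda>j. distr (Q j) borel uminus) \<phi>"
  unfolding cf_seq_def
proof (intro conjI allI)
  fix j
  have Qj: "borel_prob (Q j)" for j using Q by (simp add: cf_seq_def)
  note [measurable_cong] = borel_probD(3)[OF Qj]
  show "borel_prob (distr (Q j) borel uminus)"
    using prob_space.prob_space_distr[OF borel_probD(1)[OF Qj[of j]], of uminus borel]
    by (simp add: borel_prob_def)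
  fix \<xi>
  have "char_fn (distr (Q j) borel uminus) \<xi> = cnj (char_fn (Q j) \<xi>)" for j
  proof -
    have "char_fn (distr (Q j) borel uminus) \<xi> = (LINT z|Q j. cnj (cis (\<xi> \<bullet> z)))"
      unfolding char_fn_def by (subst integral_distr) (auto simp: cis_cnj)
    then show ?thesis by (simp add: char_fn_def)
  qed
  moreover have "(\<lambda>j. cnj (char_fn (Q j) \<xi>)) \<longlonglongrightarrow> cnj (\<phi> \<xi>)"
    using Q by (intro tendsto_cnj) (simp add: cf_seq_def)
  moreover have "cnj (\<phi> \<xi>) = \<phi> \<xi>" using real[of \<xi>] by (simp add: complex_eq_iff)
  ultimately show "(\<lambda>j. char_fn (distr (Q j) borel uminus) \<xi>) \<longlonglongrightarrow> \<phi> \<xi>" by simp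
qed

text \<open>The displacement lowers the squared norm by at least 2 s a through its radial part and
  adds at most \<beta>^2. The condition \<beta>^2 \<le> \<rho> a pays for the curvature of the
  sphere and still lets the radius grow by a/2.\<close>

lemma step_into_ball:
  fixes x z :: "'a::real_inner"
  assumes "x = s *\<^sub>R u" "norm u = 1" "0 \<le> s" "s \<le> \<rho> + a / 2" "u \<bullet> z \<le> - a" "norm z \<le> \<beta>"
    "0 < a" "0 \<le> \<beta>" "\<beta> \<le> \<rho>" "\<beta>^2 \<le> \<rho> * a"
  shows "norm (x + z) \<le> \<rho>"
proof -
  have "norm (x + z) ^ 2 = s^2 + 2 * s * (u \<bullet> z) + norm z ^ 2"
  proof -
    have "norm (x + z) ^ 2 = norm x ^ 2 + 2 * (x \<bullet> z) + norm z ^ 2"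
      by (simp add: power2_norm_eq_inner inner_add_left inner_add_right inner_commute)
    then show ?thesis using assms(1-3) by simp
  qed
  also have "\<dots> \<le> s^2 + 2 * s * (- a) + \<beta>^2"
    using assms by (intro add_mono mult_left_mono power_mono) auto
  also have "\<dots> = s * (s - 2 * a) + \<beta>^2" by (simp add: algebra_simps power2_eq_square)
  \<comment> \<open>Beyond s = 2a both factors increase with s, so the worst case is s = \<rho> +
    a/2. There the product falls short of \<rho>^2 by at least \<rho> a, which absorbs
    \<beta>^2.\<close>
  also have "\<dots> \<le> \<rho>^2"
  proof (cases "s \<le> 2 * a")
    case True
    then have "s * (s - 2 * a) \<le> 0" using assms by (intro mult_nonneg_nonpos) auto
    moreover have "\<beta>^2 \<le> \<rho>^2" using assms by (intro power_mono) auto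
    ultimately show ?thesis by simp
  next
    case False
    then have "s * (s - 2 * a) \<le> (\<rho> + a / 2) * (\<rho> + a / 2 - 2 * a)"
      using assms by (intro mult_mono) auto
    also have "\<dots> = \<rho>^2 - \<rho> * a - 3 / 4 * a^2" by (simp add: algebra_simps power2_eq_square)
    also have "\<dots> \<le> \<rho>^2 - \<rho> * a" by simp
    finally show ?thesis using assms by simp
  qed
  finally show ?thesis by (rule power2_le_imp_le) (use assms(8,9) in linarith)
qed

text \<open>Symmetry moves the walk towards the origin with probability at least half of the
  probability of a displacement by \<open>a\<close> in the direction of \<open>x\<close>, and \<open>1 - cos\<close>
  bounds the indicator of such a displacement from below.\<close>

lemma cf_seq_enlarge_ball:
  fixes F :: "'a::euclidean_space \<Rightarrow> complex"
  assumes F: "integrable lborel F" and f0: "\<And>x. 0 \<le> Re (inv_ft F x)"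
    and fc: "\<And>x. norm x \<le> \<rho> \<Longrightarrow> c \<le> Re (inv_ft F x)" and c: "0 \<le> c"
    and Q: "cf_seq Q \<phi>" and real: "\<And>\<xi>. Im (\<phi> \<xi>) = 0"
    and low: "\<And>u. norm u = 1 \<Longrightarrow> \<eta> \<le> 1 - Re (\<phi> (k *\<^sub>R u))"
    and up: "\<And>\<xi>. norm \<xi> \<le> 1 / \<beta> \<Longrightarrow> 1 - Re (\<phi> \<xi>) \<le> C"
    and par: "0 < a" "0 < \<beta>" "\<beta> \<le> \<rho>" "\<beta>^2 \<le> \<rho> * a" "k^2 * a^2 \<le> \<eta>"
    and x: "norm x \<le> \<rho> + a / 2"
  shows "c / 2 * (\<eta> / 4 - 9 * real DIM('a) * C) \<le> Re (inv_ft (\<lambda>\<xi>. F \<xi> * \<phi> \<xi>) x)"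
proof -
  define f where "f = (\<lambda>x. Re (inv_ft F x))"
  define L where "L = Re (inv_ft (\<lambda>\<xi>. F \<xi> * \<phi> \<xi>) x)"
  have Qj: "borel_prob (Q j)" for j using Q by (simp add: cf_seq_def)
  obtain u s where u: "norm u = 1" "x = s *\<^sub>R u" "0 \<le> s"
  proof (cases "x = 0")
    case True
    obtain e :: 'a where "norm e = 1" using vector_choose_size[of 1] by auto
    then show ?thesis using that[of e 0] True by simp
  next
    case False
    then show ?thesis using that[of "sgn x" "norm x"] by (simp add: norm_sgn sgn_div_norm)
  qed
  have s: "s \<le> \<rho> + a / 2" using x u by simp
  \<comment> \<open>The left side is nonpositive for a long z, where the indicator outweighs 1 - cos
    \<le> 2, and for a z with component below a along u, where k^2 a^2 \<le> \<eta> gives 1 - cos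
    \<le> \<eta>/2. In the remaining case x + z or x - z lies in the ball and the left side is at
    most c.\<close>
  have point: "c * ((1 - cos ((k *\<^sub>R u) \<bullet> z) - \<eta> / 2) / 2 - indicator {z. \<beta> \<le> norm z} z) \<le> f (x - z) + f (x + z)" for z
  proof -
    have nn: "0 \<le> f (x - z) + f (x + z)" using f0 by (simp add: f_def add_nonneg_nonneg)
    have eta: "0 \<le> \<eta>" using par(5) by (meson order_trans zero_le_mult_iff zero_le_power2)
    have c2: "1 - cos ((k *\<^sub>R u) \<bullet> z) \<le> 2" by (rule one_minus_cos_le_two)
    consider "\<beta> \<le> norm z" | "norm z < \<beta>" "\<bar>u \<bullet> z\<bar> < a" | "norm z < \<beta>" "a \<le> \<bar>u \<bullet> z\<bar>" by linarith
    then show ?thesis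
    proof cases
      case 1
      then have ind: "indicator {z. \<beta> \<le> norm z} z = (1 :: real)" by simp
      have "(1 - cos ((k *\<^sub>R u) \<bullet> z) - \<eta> / 2) / 2 - indicator {z. \<beta> \<le> norm z} z \<le> 0"
        unfolding ind diff_le_0_iff_le using c2 eta by argo
      then show ?thesis using nn c by (meson mult_nonneg_nonpos order_trans)
    next
      case 2
      have "1 - cos ((k *\<^sub>R u) \<bullet> z) \<le> ((k *\<^sub>R u) \<bullet> z)^2 / 2" by (rule one_minus_cos_le)
      also have "\<dots> = k^2 * \<bar>u \<bullet> z\<bar>^2 / 2" by (simp add: power_mult_distrib)
      also have "\<dots> \<le> k^2 * a^2 / 2"
        using 2 par by (intro divide_right_mono mult_left_mono power_mono) auto
      also have "\<dots> \<le> \<eta> / 2" using par by simp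
      finally have "(1 - cos ((k *\<^sub>R u) \<bullet> z) - \<eta> / 2) / 2 - indicator {z. \<beta> \<le> norm z} z \<le> 0"
        using 2 by simp
      then show ?thesis using nn c by (meson mult_nonneg_nonpos order_trans)
    next
      case 3
      have "c \<le> f (x - z) + f (x + z)"
      proof (cases "u \<bullet> z \<le> 0")
        case True
        then have "norm (x + z) \<le> \<rho>"
          using 3 par by (intro step_into_ball[OF u(2,1,3) s, of z \<beta>]) auto
        then show ?thesis using fc[of "x + z"] f0[of "x - z"] by (simp add: f_def)
      next
        case False
        then have "norm (x + - z) \<le> \<rho>"
          using 3 par by (intro step_into_ball[OF u(2,1,3) s, of "- z" \<beta>]) auto
        then show ?thesis using fc[of "x - z"] f0[of "x + z"] by (simp add: f_def)
      qed
      moreover have "c * ((1 - cos ((k *\<^sub>R u) \<bullet> z) - \<eta> / 2) / 2 - indicator {z. \<beta> \<le> norm z} z) \<le> c * 1"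
      proof (rule mult_left_mono[OF _ c])
        have ind: "indicator {z. \<beta> \<le> norm z} z = (0 :: real)" using 3 by simp
        show "(1 - cos ((k *\<^sub>R u) \<bullet> z) - \<eta> / 2) / 2 - indicator {z. \<beta> \<le> norm z} z \<le> 1"
          unfolding ind using c2 eta by argo
      qed
      ultimately show ?thesis by simp
    qed
  qed
  have step: "c * ((1 - Re (char_fn (Q j) (k *\<^sub>R u)) - \<eta> / 2) / 2 - measure (Q j) {z. \<beta> \<le> norm z})
      \<le> (LINT z|Q j. f (x - z)) + (LINT z|Q j. f (x + z))" for j
  proof -
    interpret Q: prob_space "Q j" using borel_probD[OF Qj] by auto
    note [measurable_cong] = borel_probD(3)[OF Qj]
    have i1: "integrable (Q j) (\<lambda>z. cos ((k *\<^sub>R u) \<bullet> z))"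
      by (rule integrable_bounded_borel[OF borel_probD(2,3)[OF Qj], where B=1]) auto
    note i2 = integral_indicator_tail[OF Qj[of j], of \<beta>]
    have "c * ((1 - Re (char_fn (Q j) (k *\<^sub>R u)) - \<eta> / 2) / 2 - measure (Q j) {z. \<beta> \<le> norm z})
       = (LINT z|Q j. c * ((1 - cos ((k *\<^sub>R u) \<bullet> z) - \<eta> / 2) / 2 - indicator {z. \<beta> \<le> norm z} z))"
      unfolding Re_char_fn[OF borel_probD(2,3)[OF Qj]] i2(2)[symmetric]
      using i1 i2(1) by (simp add: Q.prob_space)
    also have "\<dots> \<le> (LINT z|Q j. f (x - z) + f (x + z))"
    proof (rule integral_mono)
      show "integrable (Q j) (\<lambda>z. c * ((1 - cos ((k *\<^sub>R u) \<bullet> z) - \<eta> / 2) / 2 - indicator {z. \<beta> \<le> norm z} z))"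
        by (intro integrable_mult_right Bochner_Integration.integrable_diff integrable_divide i1 i2(1)) auto
      show "integrable (Q j) (\<lambda>z. f (x - z) + f (x + z))"
        unfolding f_def by (intro Bochner_Integration.integrable_add integrable_Re_inv_ft_shift[OF F Qj])
    qed (rule point)
    also have "\<dots> = (LINT z|Q j. f (x - z)) + (LINT z|Q j. f (x + z))"
      unfolding f_def by (intro Bochner_Integration.integral_add integrable_Re_inv_ft_shift[OF F Qj])
    finally show ?thesis .
  qed
  have l1: "(\<lambda>j. \<integral>z. f (x - z) \<partial>Q j) \<longlonglongrightarrow> L"
    unfolding f_def L_def by (rule cf_seq_inv_ft[OF Q F])
  have "(\<integral>z. Re (inv_ft F (x - z)) \<partial>distr (Q j) borel uminus) = (LINT z|Q j. f (x + z))" for j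
  proof -
    note [measurable_cong] = borel_probD(3)[OF Qj]
    have [measurable]: "inv_ft F \<in> borel_measurable borel" by (rule inv_ft_measurable[OF F])
    show ?thesis unfolding f_def by (subst integral_distr) auto
  qed
  then have l2: "(\<lambda>j. \<integral>z. f (x + z) \<partial>Q j) \<longlonglongrightarrow> L"
    using cf_seq_inv_ft[OF cf_seq_reflect[OF Q real] F, of x] by (simp add: L_def)
  obtain X l where X: "\<And>j. measure (Q j) {z. \<beta> \<le> norm z} \<le> X j" "X \<longlonglongrightarrow> l" "l \<le> 9 * real DIM('a) * C"
    using cf_seq_tail[OF Q par(2) up] by blast
  \<comment> \<open>Both averages tend to \<open>L\<close>; this doubling is the origin of the
    factor 1/2 in the conclusion.\<close>
  have "c * ((1 - Re (\<phi> (k *\<^sub>R u)) - \<eta> / 2) / 2 - l) \<le> L + L"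
  proof (rule LIMSEQ_le[OF _ tendsto_add[OF l1 l2]])
    show "(\<lambda>j. c * ((1 - Re (char_fn (Q j) (k *\<^sub>R u)) - \<eta> / 2) / 2 - X j))
       \<longlonglongrightarrow> c * ((1 - Re (\<phi> (k *\<^sub>R u)) - \<eta> / 2) / 2 - l)"
      using Q by (intro tendsto_intros X) (auto simp: cf_seq_def)
    have "c * ((1 - Re (char_fn (Q j) (k *\<^sub>R u)) - \<eta> / 2) / 2 - X j)
       \<le> c * ((1 - Re (char_fn (Q j) (k *\<^sub>R u)) - \<eta> / 2) / 2 - measure (Q j) {z. \<beta> \<le> norm z})" for j
      using X(1)[of j] c by (intro mult_left_mono) auto
    then show "\<exists>n. \<forall>j\<ge>n. c * ((1 - Re (char_fn (Q j) (k *\<^sub>R u)) - \<eta> / 2) / 2 - X j)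
       \<le> (LINT z|Q j. f (x - z)) + (LINT z|Q j. f (x + z))"
      using step by (meson order_trans)
  qed
  moreover have "c * (\<eta> / 4 - 9 * real DIM('a) * C) \<le> c * ((1 - Re (\<phi> (k *\<^sub>R u)) - \<eta> / 2) / 2 - l)"
  proof (rule mult_left_mono[OF _ c])
    show "\<eta> / 4 - 9 * real DIM('a) * C \<le> (1 - Re (\<phi> (k *\<^sub>R u)) - \<eta> / 2) / 2 - l"
      using low[OF u(1)] X(3) by argo
  qed
  ultimately show ?thesis by (simp add: L_def)
qed

text \<open>The counterpart of the enlargement for a possibly asymmetric law: displacements shorter
  than \<beta> stay inside the larger ball and the others are discarded. The radius shrinks by
  \<beta>.\<close>

lemma cf_seq_shrink_ball:
  fixes F :: "'a::euclidean_space \<Rightarrow> complex"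
  assumes F: "integrable lborel F" and f0: "\<And>x. 0 \<le> Re (inv_ft F x)"
    and fc: "\<And>x. norm x \<le> \<rho> + \<beta> \<Longrightarrow> c \<le> Re (inv_ft F x)" and c: "0 \<le> c"
    and Q: "cf_seq Q \<phi>" and \<beta>: "0 < \<beta>"
    and up: "\<And>\<xi>. norm \<xi> \<le> 1 / \<beta> \<Longrightarrow> 1 - Re (\<phi> \<xi>) \<le> C"
    and x: "norm x \<le> \<rho>"
  shows "c * (1 - 9 * real DIM('a) * C) \<le> Re (inv_ft (\<lambda>\<xi>. F \<xi> * \<phi> \<xi>) x)"
proof -
  define L where "L = Re (inv_ft (\<lambda>\<xi>. F \<xi> * \<phi> \<xi>) x)"
  have Qj: "borel_prob (Q j)" for j using Q by (simp add: cf_seq_def)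
  have step: "c * (1 - measure (Q j) {z. \<beta> \<le> norm z}) \<le> (LINT z|Q j. Re (inv_ft F (x - z)))" for j
  proof -
    interpret Q: prob_space "Q j" using borel_probD[OF Qj] by auto
    note [measurable_cong] = borel_probD(3)[OF Qj]
    note i2 = integral_indicator_tail[OF Qj[of j], of \<beta>]
    have "c * (1 - measure (Q j) {z. \<beta> \<le> norm z}) = (LINT z|Q j. c * (1 - indicator {z. \<beta> \<le> norm z} z))"
      unfolding i2(2)[symmetric] using i2(1) by (simp add: Q.prob_space)
    also have "\<dots> \<le> (LINT z|Q j. Re (inv_ft F (x - z)))"
    proof (rule integral_mono)
      show "integrable (Q j) (\<lambda>z. c * (1 - indicator {z. \<beta> \<le> norm z} z))"
        using i2(1) by (intro integrable_mult_right Bochner_Integration.integrable_diff) auto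
      show "c * (1 - indicator {z. \<beta> \<le> norm z} z) \<le> Re (inv_ft F (x - z))" for z
        using f0[of "x - z"] fc[of "x - z"] x norm_triangle_ineq4[of x z] by (cases "\<beta> \<le> norm z") auto
    qed (rule integrable_Re_inv_ft_shift[OF F Qj])
    finally show ?thesis .
  qed
  obtain X l where X: "\<And>j. measure (Q j) {z. \<beta> \<le> norm z} \<le> X j" "X \<longlonglongrightarrow> l" "l \<le> 9 * real DIM('a) * C"
    using cf_seq_tail[OF Q \<beta> up] by blast
  have "c * (1 - l) \<le> L"
  proof (rule LIMSEQ_le[OF _ cf_seq_inv_ft[OF Q F, of x, folded L_def]])
    show "(\<lambda>j. c * (1 - X j)) \<longlonglongrightarrow> c * (1 - l)" by (intro tendsto_intros X)
    have "c * (1 - X j) \<le> c * (1 - measure (Q j) {z. \<beta> \<le> norm z})" for j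
      using X(1)[of j] c by (intro mult_left_mono) auto
    then show "\<exists>n. \<forall>j\<ge>n. c * (1 - X j) \<le> (LINT z|Q j. Re (inv_ft F (x - z)))"
      using step by (meson order_trans)
  qed
  moreover have "c * (1 - 9 * real DIM('a) * C) \<le> c * (1 - l)"
    using c X(3) by (intro mult_left_mono) auto
  ultimately show ?thesis by (simp add: L_def)
qed

text \<open>As the function is nonnegative, the contribution of every nonzero displacement may be
  dropped.\<close>

lemma atom_lower_bound:
  assumes F: "integrable lborel F" and f0: "\<And>x. 0 \<le> Re (inv_ft F x)"
    and Q: "borel_prob Q" and m: "m \<le> measure Q {0}"
  shows "m * Re (inv_ft F x) \<le> Re (inv_ft (\<lambda>\<xi>. F \<xi> * char_fn Q \<xi>) x)"
proof -
  note [measurable_cong] = borel_probD(3)[OF Q]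
  interpret Q: prob_space Q using borel_probD[OF Q] by auto
  have "m * Re (inv_ft F x) \<le> measure Q {0} * Re (inv_ft F x)"
    using m f0 by (intro mult_right_mono) auto
  also have "\<dots> = (LINT z|Q. indicator {0} z * Re (inv_ft F x))"
    using borel_probD(4)[OF Q] by simp
  also have "\<dots> \<le> (LINT z|Q. Re (inv_ft F (x - z)))"
  proof (rule integral_mono)
    show "integrable Q (\<lambda>z. indicator {0} z * Re (inv_ft F x))"
      by (rule integrable_bounded_borel[OF borel_probD(2,3)[OF Q], where B="\<bar>Re (inv_ft F x)\<bar>"])
         (auto simp: indicator_def)
    show "indicator {0} z * Re (inv_ft F x) \<le> Re (inv_ft F (x - z))" for z
      using f0[of "x - z"] by (auto simp: indicator_def)
  qed (rule integrable_Re_inv_ft_shift[OF F Q])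
  also have "\<dots> = Re (LINT z|Q. inv_ft F (x - z))"
  proof -
    have [measurable]: "inv_ft F \<in> borel_measurable borel" by (rule inv_ft_measurable[OF F])
    have "integrable Q (\<lambda>z. inv_ft F (x - z))"
      by (rule integrable_bounded_borel[OF borel_probD(2,3)[OF Q]]) (auto intro: norm_inv_ft_le[OF F])
    then show ?thesis by simp
  qed
  finally show ?thesis unfolding inv_ft_convolution[OF F Q] .
qed

section \<open>Gaussian inversion and the initial lower bound\<close>

lemma lborel_reflect: "(lborel :: 'a::euclidean_space measure) = distr lborel borel (\<lambda>y. x - y)"
  using lborel_affine[of "-1" x] by (simp add: density_1)

text \<open>By the convolution identity the regularised integral averages \<open>p\<close> against a
  Gaussian kernel \<open>K\<close> around \<open>x\<close>, of total mass
  \<open>(2 * pi) ^ DIM('a)\<close>. If \<open>p x\<close> were too small, \<open>p\<close> would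
  stay below some smaller c' near \<open>x\<close> by continuity, and the far part of the kernel
  would be too small to make up the difference.\<close>

lemma gauss_inversion_lower_bound:
  fixes p :: "'a::euclidean_space \<Rightarrow> real"
  assumes cont: "continuous_on UNIV p" and p0: "\<And>y. 0 \<le> p y"
    and Q: "borel_prob (density lborel (\<lambda>y. ennreal (p y)))" and eps1: "0 < eps1"
    and m: "\<And>eps. 0 < eps \<Longrightarrow> eps \<le> eps1 \<Longrightarrow>
      m \<le> Re (inv_ft (\<lambda>\<xi>. of_real (gauss eps \<xi>) * char_fn (density lborel (\<lambda>y. ennreal (p y))) \<xi>) x)"
  shows "m \<le> (2 * pi) ^ DIM('a) * p x"
proof (rule ccontr)
  let ?d = "DIM('a)" and ?Q = "density lborel (\<lambda>y. ennreal (p y))"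
  define P where "P = (2 * pi) ^ ?d"
  have P: "0 < P" by (simp add: P_def)
  assume "\<not> m \<le> (2 * pi) ^ ?d * p x"
  then have less: "P * p x < m" by (simp add: P_def)
  have "p x < m / P" using less P by (simp add: field_simps)
  then obtain c' where c': "p x < c'" "c' < m / P" using dense by blast
  have c0: "0 \<le> c'" using c' p0[of x] by linarith
  have c'm: "c' * P < m" using c'(2) P by (simp add: field_simps)
  have pm [measurable]: "p \<in> borel_measurable borel" by (rule borel_measurable_continuous_onI[OF cont])
  have "isCont p x" using cont by (simp add: continuous_on_eq_continuous_at)
  then have "eventually (\<lambda>y. p y < c') (at x)"
    using c'(1) by (auto simp: isCont_def intro: order_tendstoD)
  then obtain \<eta> where \<eta>: "0 < \<eta>" "\<And>y. y \<noteq> x \<Longrightarrow> dist y x < \<eta> \<Longrightarrow> p y < c'"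
    by (auto simp: eventually_at)
  then have near: "p y \<le> c'" if "dist y x < \<eta>" for y
    using that c'(1) by (cases "y = x") (auto intro: less_imp_le)
  \<comment> \<open>X stands for \<eta>^2 / (2 eps), the exponent of the kernel at distance \<eta>.
    In terms of X, the kernel outside that distance is at most a constant times X^d exp(-X).\<close>
  have "((\<lambda>X. (4 * pi / \<eta>^2) ^ ?d * (X ^ ?d / exp X)) \<longlongrightarrow> (4 * pi / \<eta>^2) ^ ?d * 0) at_top"
    by (intro tendsto_mult_left tendsto_power_div_exp_0)
  then have "eventually (\<lambda>X. (4 * pi / \<eta>^2) ^ ?d * (X ^ ?d / exp X) < m - c' * P) at_top"
    by (rule order_tendstoD) (use c'm in simp)
  then obtain X0 where X0: "\<And>X. X \<ge> X0 \<Longrightarrow> (4 * pi / \<eta>^2) ^ ?d * (X ^ ?d / exp X) < m - c' * P"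
    by (auto simp: eventually_at_top_linorder)
  define M where "M = min 1 eps1"
  have M: "0 < M" "M \<le> 1" "M \<le> eps1" using eps1 by (auto simp: M_def)
  \<comment> \<open>The last entry of the maximum forces eps \<le> M \<le> 1, so that
    \<open>eps\<close> is admissible in \<open>m\<close> and 2 pi / eps \<ge> 1, which the bound of
    the square root requires.\<close>
  define X where "X = max (max X0 1) (\<eta>^2 / (2 * M))"
  define eps where "eps = \<eta>^2 / (2 * X)"
  have X: "0 < X" "X \<ge> X0" "\<eta>^2 / (2 * M) \<le> X" by (auto simp: X_def)
  have "\<eta>^2 \<le> 2 * M * X" using X(3) M by (simp add: pos_divide_le_eq mult_ac)
  then have eps: "0 < eps" "eps \<le> M" "\<eta>^2 / (2 * eps) = X"
    using X(1) \<eta>(1) by (auto simp: eps_def pos_divide_le_eq mult_ac)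
  define K where "K = (\<lambda>y::'a. sqrt (2 * pi / eps) ^ ?d * gauss (1 / eps) y)"
  define S where "S = sqrt (2 * pi / eps) ^ ?d * exp (- X)"
  have K0: "0 \<le> K y" for y using eps by (simp add: K_def gauss_def)
  have Km [measurable]: "K \<in> borel_measurable borel" unfolding K_def by measurable
  have S: "S < m - c' * P"
  proof -
    have "1 \<le> 2 * pi / eps" using eps M pi_gt3 by (simp add: pos_le_divide_eq)
    moreover have "sqrt y \<le> y" if "1 \<le> y" for y :: real
      using mult_left_mono[of 1 "sqrt y" "sqrt y"] that by simp
    ultimately have "sqrt (2 * pi / eps) \<le> 2 * pi / eps" by blast
    also have "\<dots> = 4 * pi / \<eta>^2 * X" using eps \<eta>(1) X(1) by (simp add: eps_def field_simps)
    finally have "sqrt (2 * pi / eps) ^ ?d \<le> (4 * pi / \<eta>^2 * X) ^ ?d"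
      using eps by (intro power_mono) auto
    then have "S \<le> (4 * pi / \<eta>^2 * X) ^ ?d * exp (- X)" unfolding S_def by (intro mult_right_mono) auto
    also have "\<dots> = (4 * pi / \<eta>^2) ^ ?d * (X ^ ?d / exp X)"
      by (simp only: power_mult_distrib exp_minus divide_inverse mult.assoc)
    finally show ?thesis using X0[OF X(2)] by linarith
  qed
  have gi: "integrable lborel (\<lambda>\<xi>::'a. complex_of_real (gauss eps \<xi>))"
    by (intro integrable_of_real integrable_gauss eps)
  have "inv_ft (\<lambda>\<xi>. of_real (gauss eps \<xi>) * char_fn ?Q \<xi>) x = (LINT z|?Q. of_real (K (x - z)))"
    unfolding inv_ft_convolution[OF gi Q, symmetric] inv_ft_gauss[OF eps(1)] K_def ..
  also have "\<dots> = of_real (LINT z|?Q. K (x - z))" by (rule integral_complex_of_real)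
  also have "(LINT z|?Q. K (x - z)) = (LINT y|lborel. p y * K (x - y))"
    by (subst integral_density) (auto simp: p0)
  finally have eq: "Re (inv_ft (\<lambda>\<xi>. of_real (gauss eps \<xi>) * char_fn ?Q \<xi>) x) = (LINT y|lborel. p y * K (x - y))"
    by simp
  have KI: "integrable lborel K" unfolding K_def using eps by (intro integrable_mult_right integrable_gauss) auto
  have "(LINT y|lborel. K y) = sqrt (2 * pi / eps) ^ ?d * sqrt (2 * pi / (1 / eps)) ^ ?d"
    unfolding K_def using eps integral_gauss[of "1 / eps", where 'a='a] by simp
  also have "\<dots> = P"
  proof -
    have "2 * pi / eps * (2 * pi / (1 / eps)) = (2 * pi)^2" using eps by (simp add: power2_eq_square)
    then have "sqrt (2 * pi / eps) * sqrt (2 * pi / (1 / eps)) = 2 * pi"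
      unfolding real_sqrt_mult[symmetric] by (simp only: real_sqrt_unique[of "2 * pi"] real_sqrt_abs abs_of_pos) simp
    then show ?thesis unfolding power_mult_distrib[symmetric] P_def by simp
  qed
  finally have KP: "(LINT y|lborel. K y) = P" .
  have KI': "integrable lborel (\<lambda>y. K (x - y))"
    using KI by (subst (asm) lborel_reflect[of x], subst (asm) integrable_distr_eq) auto
  have KP': "(LINT y|lborel. K (x - y)) = P"
    using KP by (subst (asm) lborel_reflect[of x], subst (asm) integral_distr) auto
  interpret Q: prob_space ?Q using borel_probD[OF Q] by auto
  have p1: "(\<integral>\<^sup>+y. ennreal (p y) \<partial>lborel) = 1"
    using Q.emeasure_space_1 by (simp add: emeasure_density)
  have pI: "integrable lborel p" by (rule integrableI_nonneg) (auto simp: p0 p1)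
  have pint: "(LINT y|lborel. p y) = 1"
    using p1 nn_integral_eq_integral[OF pI] p0 by (simp add: ennreal_eq_1)
  have point: "p y * K (x - y) \<le> c' * K (x - y) + S * p y" for y
  proof (cases "dist y x < \<eta>")
    case True
    then have "p y * K (x - y) \<le> c' * K (x - y)" using near K0 by (intro mult_right_mono) auto
    moreover have "0 \<le> S * p y" using p0 eps by (auto simp: S_def)
    ultimately show ?thesis by linarith
  next
    case False
    then have "\<eta>^2 \<le> norm (x - y) ^ 2"
      using \<eta>(1) by (intro power_mono) (auto simp: dist_norm norm_minus_commute)
    then have "X \<le> 1 / eps * norm (x - y) ^ 2 / 2"
      unfolding eps(3)[symmetric] using eps(1) by (simp add: field_simps)
    then have "gauss (1 / eps) (x - y) \<le> exp (- X)" by (simp add: gauss_def)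
    then have "K (x - y) \<le> S" unfolding K_def S_def using eps by (intro mult_left_mono) auto
    then have "p y * K (x - y) \<le> S * p y" using p0 by (metis mult.commute mult_left_mono)
    moreover have "0 \<le> c' * K (x - y)" using c0 K0 by simp
    ultimately show ?thesis by linarith
  qed
  have "m \<le> (LINT y|lborel. p y * K (x - y))" using m[of eps] eps M eq by simp
  also have "\<dots> \<le> (LINT y|lborel. c' * K (x - y) + S * p y)"
  proof (rule integral_mono_AE')
    show "integrable lborel (\<lambda>y. c' * K (x - y) + S * p y)"
      using KI' pI by (intro Bochner_Integration.integrable_add integrable_mult_right)
    show "AE y in lborel. p y * K (x - y) \<le> c' * K (x - y) + S * p y" using point by simp
    show "AE y in lborel. 0 \<le> c' * K (x - y) + S * p y" using p0 K0 c0 eps by (simp add: S_def)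
  qed
  also have "\<dots> = c' * P + S" using KI' pI KP' pint by simp
  also have "\<dots> < m" using S by simp
  finally show False by simp
qed

section \<open>A lower bound on a small ball from the growth of the exponent\<close>

lemma cauchy_integrable: "integrable lborel (\<lambda>s::real. 1 / (1 + s^2))"
  using integrable_inverse_1_plus_square
  by (simp add: set_integrable_def inverse_eq_divide)

text \<open>For y > 1 compare with the k-th term of the exponential series, where k is so large that
  \<alpha> k \<ge> 2d + 1.\<close>

lemma stretched_exp_bound:
  fixes c \<alpha> :: real
  assumes "0 < c" "0 < \<alpha>"
  shows "\<exists>B>0. \<forall>y\<ge>0. y * (if y \<le> 1 then 1 else exp (- (c * y powr \<alpha>))) * (1 + y^2) ^ d \<le> B"
proof -
  obtain k where k: "(2 * real d + 1) / \<alpha> \<le> real k" using real_arch_simple by blast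
  then have k: "2 * real d + 1 \<le> \<alpha> * real k" using assms by (simp add: field_simps)
  define B where "B = 2 ^ d * (1 + fact k / c ^ k)"
  have B1: "2 ^ d \<le> B" using assms by (simp add: B_def)
  have "y * (if y \<le> 1 then 1 else exp (- (c * y powr \<alpha>))) * (1 + y^2) ^ d \<le> B" if y: "0 \<le> y" for y
  proof (cases "y \<le> 1")
    case True
    have "y^2 \<le> 1" using y True by (simp add: power_le_one)
    then have "y * (1 + y^2) ^ d \<le> 1 * 2 ^ d"
      using y True by (intro mult_mono power_mono) auto
    then show ?thesis using True B1 by simp
  next
    case False
    let ?x = "c * y powr \<alpha>"
    have x: "0 \<le> ?x" using assms by simp
    have "?x ^ k / fact k \<le> exp ?x"
    proof -
      have "(\<Sum>n\<in>{k}. ?x ^ n /\<^sub>R fact n) \<le> (\<Sum>n. ?x ^ n /\<^sub>R fact n)"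
        by (rule sum_le_suminf[OF summable_exp_generic]) (use x in auto)
      then show ?thesis by (simp add: exp_def divide_inverse mult.commute)
    qed
    moreover have "c ^ k * (y * (y^2) ^ d) / fact k \<le> ?x ^ k / fact k"
    proof (rule divide_right_mono)
      have "y * (y^2) ^ d = y ^ (2 * d + 1)" by (simp add: power_mult)
      also have "\<dots> = y powr real (2 * d + 1)"
        using False by (intro powr_realpow[symmetric]) simp
      also have "\<dots> \<le> y powr (\<alpha> * real k)"
        using k False by (intro powr_mono) auto
      finally have "c ^ k * (y * (y^2) ^ d) \<le> c ^ k * y powr (\<alpha> * real k)"
        using assms by (intro mult_left_mono) auto
      also have "\<dots> = ?x ^ k"
        using False by (simp add: power_mult_distrib powr_powr[symmetric] powr_realpow)
      finally show "c ^ k * (y * (y^2) ^ d) \<le> ?x ^ k" .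
    qed simp
    ultimately have "c ^ k * (y * (y^2) ^ d) / fact k \<le> exp ?x" by linarith
    then have "y * (y^2) ^ d * exp (- ?x) \<le> fact k / c ^ k"
      using assms by (simp add: exp_minus field_simps)
    then have le: "2 ^ d * (y * (y^2) ^ d * exp (- ?x)) \<le> B" unfolding B_def
      by (intro mult_left_mono) auto
    have "(1 + y^2) ^ d \<le> (2 * y^2) ^ d"
      using False by (intro power_mono) auto
    then have "y * exp (- ?x) * (1 + y^2) ^ d \<le> y * exp (- ?x) * (2 * y^2) ^ d"
      using y by (intro mult_left_mono) auto
    also have "\<dots> = 2 ^ d * (y * (y^2) ^ d * exp (- ?x))"
      by (simp only: power_mult_distrib mult_ac)
    also note le
    finally show ?thesis using False by simp
  qed
  moreover have "0 < B" using B1 by (smt (verit) zero_less_power)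
  ultimately show ?thesis by blast
qed

lemma one_minus_cos_le_abs: "1 - cos x \<le> \<bar>x::real\<bar>"
proof -
  have "1 - cos x = 2 * (\<bar>sin (x / 2)\<bar> * \<bar>sin (x / 2)\<bar>)"
    using cos_double_sin[of "x / 2"] by (simp add: power2_eq_square)
  also have "\<bar>sin (x / 2)\<bar> * \<bar>sin (x / 2)\<bar> \<le> \<bar>x / 2\<bar> * 1"
    using abs_sin_x_le_abs_x[of "x / 2"] by (intro mult_mono) auto
  finally show ?thesis by simp
qed

text \<open>A predicate, so that \<open>c0\<close> and \<open>e0\<close> are fixed before the
  exponent, the scale \<open>q\<close>, \<open>eps\<close> and the point. The type argument carries
  the dimension, which the real parameters do not determine.\<close>

definition small_ball_bound :: "'a::euclidean_space itself \<Rightarrow> real \<Rightarrow> real \<Rightarrow> real \<Rightarrow> real \<Rightarrow> real \<Rightarrow> bool" where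
  "small_ball_bound _ A c \<alpha> c0 e0 \<longleftrightarrow> (\<forall>q \<psi> eps. \<forall>x::'a. 0 < q \<longrightarrow> \<psi> \<in> borel_measurable borel \<longrightarrow> (\<forall>\<xi>. 0 \<le> \<psi> \<xi>) \<longrightarrow>
     (\<forall>\<xi>. norm \<xi> * q \<le> 1 \<longrightarrow> \<psi> \<xi> \<le> A) \<longrightarrow> (\<forall>\<xi>. 1 \<le> norm \<xi> * q \<longrightarrow> c * (norm \<xi> * q) powr \<alpha> \<le> \<psi> \<xi>) \<longrightarrow>
     0 < eps \<longrightarrow> eps \<le> q^2 \<longrightarrow> norm x \<le> e0 * q \<longrightarrow>
     c0 * (1 / q) ^ DIM('a) \<le> Re (inv_ft (\<lambda>\<xi>. of_real (exp (- \<psi> \<xi>) * gauss eps \<xi>)) x))"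

text \<open>At the origin the integral is that of a positive function, bounded below by its part
  over frequencies of norm at most \<open>1 / q\<close>. Moving to x costs at most |x| times the
  integral of |\<xi>| H, which the growth of \<psi> makes of order (1/q)^(d+1). Hence half of the
  bound survives for |x| \<le> e0 q.\<close>

lemma small_ball_bound_exists:
  fixes A c \<alpha> :: real
  assumes c: "0 < c" and \<alpha>: "0 < \<alpha>"
  shows "\<exists>c0>0. \<exists>e0>0. small_ball_bound TYPE('a::euclidean_space) A c \<alpha> c0 e0"
proof -
  let ?d = "DIM('a)"
  define G where "G = (\<lambda>y::real. if y \<le> 1 then 1 else exp (- (c * y powr \<alpha>)))"
  obtain B where B: "0 < B" "\<And>y. 0 \<le> y \<Longrightarrow> y * G y * (1 + y^2) ^ ?d \<le> B"
    using stretched_exp_bound[OF c \<alpha>, of ?d] unfolding G_def by blast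
  define J where "J = (\<integral>s. 1 / (1 + s^2) \<partial>(lborel :: real measure))"
  have J0: "0 \<le> J" unfolding J_def by (rule integral_nonneg_AE) auto
  define v where "v = unit_ball_vol (real ?d)"
  have v: "0 < v" by (simp add: v_def unit_ball_vol_pos)
  \<comment> \<open>On frequencies of norm at most \<open>1 / q\<close> the exponent is at most
    \<open>A\<close>, and \<open>eps \<le> q^2\<close> limits the Gaussian exponent to 1/2;
    \<open>v\<close> is the volume of the unit ball.\<close>
  define E where "E = exp (- A - 1 / 2) * v"
  define e0 where "e0 = E / (2 * B * (J ^ ?d + 1))"
  have E: "0 < E" using v by (simp add: E_def)
  have e0: "0 < e0" using E B J0 by (simp add: e0_def add_nonneg_pos)
  show ?thesis unfolding small_ball_bound_def
  proof (rule exI[of _ "E / 2"], rule conjI, use E in simp, rule exI[of _ e0], rule conjI, rule e0, intro allI impI)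
    fix q eps :: real and \<psi> :: "'a \<Rightarrow> real" and x :: 'a
    assume q: "0 < q" and \<psi> [measurable]: "\<psi> \<in> borel_measurable borel" and \<psi>0: "\<forall>\<xi>. 0 \<le> \<psi> \<xi>"
      and \<psi>A: "\<forall>\<xi>. norm \<xi> * q \<le> 1 \<longrightarrow> \<psi> \<xi> \<le> A"
      and \<psi>c: "\<forall>\<xi>. 1 \<le> norm \<xi> * q \<longrightarrow> c * (norm \<xi> * q) powr \<alpha> \<le> \<psi> \<xi>"
      and eps: "0 < eps" "eps \<le> q^2" and x: "norm x \<le> e0 * q"
    define H where "H = (\<lambda>\<xi>. exp (- \<psi> \<xi>) * gauss eps \<xi>)"
    have H [measurable]: "H \<in> borel_measurable borel" unfolding H_def by measurable
    have g01: "0 \<le> gauss eps \<xi>" "gauss eps \<xi> \<le> 1" for \<xi> :: 'a using eps by (auto simp: gauss_def)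
    have H0: "0 \<le> H \<xi>" "H \<xi> \<le> gauss eps \<xi>" "H \<xi> \<le> exp (- \<psi> \<xi>)" for \<xi>
      using \<psi>0 g01[of \<xi>] by (auto simp: H_def mult_left_le_one_le mult_left_le)
    have HI: "integrable lborel H"
      by (rule Bochner_Integration.integrable_bound[OF integrable_gauss[OF eps(1)]]) (use H0 g01 in auto)
    \<comment> \<open>A product of one-dimensional Cauchy kernels can be integrated by coordinates
      and lies above \<open>1 / (1 + y^2) ^ DIM('a)\<close>; this explains the power in
      \<open>stretched_exp_bound\<close>.\<close>
    define D where "D = (\<lambda>\<xi>::'a. (1 / q * B) * (\<Prod>b\<in>Basis. 1 / (1 + (q * (\<xi> \<bullet> b))^2)))"
    have qi: "integrable lborel (\<lambda>s. 1 / (1 + (q * s)^2))"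
      using lborel_integrable_real_affine[OF cauchy_integrable, of q 0] q by simp
    have qJ: "(LINT s|lborel. 1 / (1 + (q * s)^2)) = J / q"
      using lborel_integral_real_affine[of q "\<lambda>s. 1 / (1 + s^2)" 0] q by (simp add: J_def field_simps)
    have DI: "integrable lborel D" unfolding D_def
      by (intro integrable_mult_right lborel_integrable_prod qi)
    have Dint: "(LINT \<xi>|lborel. D \<xi>) = (1 / q * B) * (J / q) ^ ?d" unfolding D_def
      by (subst integral_mult_right_zero, subst lborel_integral_prod[OF qi]) (simp add: qJ)
    have HD: "norm \<xi> * H \<xi> \<le> D \<xi>" for \<xi>
    proof -
      define y where "y = norm \<xi> * q"
      have y: "0 \<le> y" using q by (simp add: y_def)
      have "exp (- \<psi> \<xi>) \<le> G y" using \<psi>0 \<psi>c by (auto simp: G_def y_def)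
      then have "H \<xi> \<le> G y" using H0(3)[of \<xi>] by linarith
      then have "norm \<xi> * H \<xi> \<le> 1 / q * (y * G y)"
        using q by (simp add: y_def mult_left_mono)
      also have "\<dots> \<le> 1 / q * (B / (1 + y^2) ^ ?d)"
        using q B(2)[OF y] by (intro mult_left_mono) (auto simp: pos_le_divide_eq add_pos_nonneg)
      also have "\<dots> = 1 / q * B * (1 / (1 + y^2) ^ ?d)" by simp
      also have "\<dots> \<le> D \<xi>" unfolding D_def
      proof (rule mult_left_mono)
        have "(1 / (1 + y^2)) ^ ?d = (\<Prod>b\<in>(Basis::'a set). 1 / (1 + y^2))" by simp
        also have "\<dots> \<le> (\<Prod>b\<in>Basis. 1 / (1 + (q * (\<xi> \<bullet> b))^2))"
        proof (rule prod_mono)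
          fix b :: 'a assume b: "b \<in> Basis"
          have "\<bar>q * (\<xi> \<bullet> b)\<bar> \<le> y" using Basis_le_norm[OF b, of \<xi>] q by (simp add: y_def abs_mult)
          then have "\<bar>q * (\<xi> \<bullet> b)\<bar>^2 \<le> y^2" by (intro power_mono) auto
          then show "0 \<le> 1 / (1 + y^2) \<and> 1 / (1 + y^2) \<le> 1 / (1 + (q * (\<xi> \<bullet> b))^2)"
            by (auto intro!: divide_left_mono mult_pos_pos add_pos_nonneg)
        qed
        finally show "1 / (1 + y^2) ^ ?d \<le> (\<Prod>b\<in>Basis. 1 / (1 + (q * (\<xi> \<bullet> b))^2))"
          by (simp add: power_one_over)
      qed (use q B in auto)
      finally show ?thesis .
    qed
    have "exp (- A - 1 / 2) * (v * (1 / q) ^ ?d) = (LINT \<xi>|lborel. exp (- A - 1 / 2) * indicator (cball (0::'a) (1 / q)) \<xi>)"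
      using q content_cball[of "1 / q" "0::'a"] by (simp add: v_def)
    also have "\<dots> \<le> (LINT \<xi>|lborel. H \<xi>)"
    proof (rule integral_mono_AE'[OF HI])
      show "AE \<xi> in lborel. exp (- A - 1 / 2) * indicator (cball 0 (1 / q)) \<xi> \<le> H \<xi>"
      proof (rule AE_I2)
        fix \<xi> :: 'a
        show "exp (- A - 1 / 2) * indicator (cball 0 (1 / q)) \<xi> \<le> H \<xi>"
        proof (cases "norm \<xi> \<le> 1 / q")
          case True
          then have n: "norm \<xi> * q \<le> 1" using q by (simp add: field_simps)
          have "eps * norm \<xi> ^ 2 \<le> q^2 * norm \<xi> ^ 2" using eps by (intro mult_right_mono) auto
          also have "\<dots> = (norm \<xi> * q)^2" by (simp add: power_mult_distrib)
          also have "\<dots> \<le> 1" using n q by (simp add: power_le_one)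
          finally have "exp (- A - 1 / 2) \<le> exp (- \<psi> \<xi> - eps * norm \<xi> ^ 2 / 2)"
            using \<psi>A n by auto
          also have "\<dots> = H \<xi>" by (simp add: H_def gauss_def exp_add[symmetric])
          finally show ?thesis using True by simp
        qed (use H0 in simp)
      qed
    qed (use H0 in simp)
    finally have lowH: "E * (1 / q) ^ ?d \<le> (LINT \<xi>|lborel. H \<xi>)" by (simp add: E_def)
    have "norm x * (LINT \<xi>|lborel. D \<xi>) \<le> e0 * q * ((1 / q * B) * (J / q) ^ ?d)"
      unfolding Dint using x q B J0 by (intro mult_right_mono) auto
    also have "\<dots> = e0 * B * J ^ ?d * (1 / q) ^ ?d" using q by (simp add: power_divide)
    also have "\<dots> \<le> E / 2 * (1 / q) ^ ?d"
    proof (rule mult_right_mono)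
      have "e0 * B * J ^ ?d \<le> e0 * B * (J ^ ?d + 1)" using e0 B by (intro mult_left_mono) auto
      also have "\<dots> = E / 2"
      proof -
        define K where "K = J ^ ?d + 1"
        have "0 < K" using J0 by (simp add: K_def add_nonneg_pos)
        then show ?thesis using B(1) unfolding e0_def K_def[symmetric] by (simp add: field_simps)
      qed
      finally show "e0 * B * J ^ ?d \<le> E / 2" .
    qed (use q in simp)
    finally have "E / 2 * (1 / q) ^ ?d \<le> (LINT \<xi>|lborel. H \<xi>) - norm x * (LINT \<xi>|lborel. D \<xi>)"
      using lowH by simp
    also have "\<dots> = (LINT \<xi>|lborel. H \<xi> - norm x * D \<xi>)" using HI DI by simp
    also have "\<dots> \<le> (LINT \<xi>|lborel. cos (\<xi> \<bullet> x) * H \<xi>)"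
    proof (rule integral_mono)
      show "integrable lborel (\<lambda>\<xi>. cos (\<xi> \<bullet> x) * H \<xi>)"
        by (rule Bochner_Integration.integrable_bound[OF HI]) (auto simp: abs_mult mult_left_le_one_le H0)
      fix \<xi>
      have "(1 - cos (\<xi> \<bullet> x)) * H \<xi> \<le> (norm \<xi> * norm x) * H \<xi>"
        using one_minus_cos_le_abs[of "\<xi> \<bullet> x"] Cauchy_Schwarz_ineq2[of \<xi> x] H0
        by (intro mult_right_mono) auto
      also have "\<dots> \<le> norm x * D \<xi>"
        using mult_left_mono[OF HD[of \<xi>], of "norm x"] by (simp add: mult_ac)
      finally show "H \<xi> - norm x * D \<xi> \<le> cos (\<xi> \<bullet> x) * H \<xi>" by (simp add: algebra_simps)
    qed (use HI DI in auto)
    also have "\<dots> = Re (inv_ft (\<lambda>\<xi>. of_real (H \<xi>)) x)"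
    proof -
      have "integrable lborel (\<lambda>\<xi>. cis (- (\<xi> \<bullet> x)) * complex_of_real (H \<xi>))"
        using HI by (intro integrable_cis_mult integrable_of_real)
      from integral_Re[OF this] show ?thesis by (simp add: inv_ft_def)
    qed
    finally show "E / 2 * (1 / q) ^ ?d \<le> Re (inv_ft (\<lambda>\<xi>. of_real (exp (- \<psi> \<xi>) * gauss eps \<xi>)) x)"
      by (simp add: H_def)
  qed
qed

section \<open>Splitting off small symmetric jumps\<close>

lemma symmetric_distr:
  assumes "levy_measure \<nu>" "symmetric_measure \<nu>"
  shows "distr \<nu> borel uminus = \<nu>"
proof (rule measure_eqI)
  note [measurable_cong] = levy_sets[OF assms(1)]
  fix B assume "B \<in> sets (distr \<nu> borel uminus)"
  then have B: "B \<in> sets borel" by simp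
  have "uminus -` B \<inter> space \<nu> = uminus ` B"
    using levy_space[OF assms(1)] by (auto simp: image_iff) (metis minus_minus)
  then show "emeasure (distr \<nu> borel uminus) B = emeasure \<nu> B"
    using B assms(2) by (subst emeasure_distr) (auto simp: symmetric_measure_def)
qed (simp add: levy_sets[OF assms(1)])

text \<open>The imaginary part of the kernel, compensator included, is odd in z, so it integrates to
  0 against an even weight.\<close>

lemma symmetric_comp_kernel:
  fixes v :: "'a::euclidean_space \<Rightarrow> real"
  assumes \<nu>: "levy_measure \<nu>" and sym: "symmetric_measure \<nu>" and r: "0 < r"
    and v [measurable]: "v \<in> borel_measurable borel" and v0: "\<And>z. 0 \<le> v z" "\<And>z. v z \<le> V"
    and even: "\<And>z. v (- z) = v z"
  shows "jump_exp \<nu> v r \<xi> = of_real (LINT z|\<nu>. v z * (1 - cos (\<xi> \<bullet> z)))"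
proof -
  note [measurable_cong] = levy_sets[OF \<nu>]
  note int = integrable_comp_kernel[OF \<nu> r v v0, of \<xi>]
  let ?o = "\<lambda>z. Im (v z *\<^sub>R comp_kernel r \<xi> z)"
  have odd: "?o (- z) = - ?o z" for z
    by (simp add: comp_kernel_def even indicator_def algebra_simps)
  have "(LINT z|\<nu>. ?o z) = (\<integral>z. ?o z \<partial>distr \<nu> borel uminus)"
    by (simp add: symmetric_distr[OF \<nu> sym])
  also have "\<dots> = (LINT z|\<nu>. ?o (- z))" by (subst integral_distr) auto
  also have "\<dots> = - (LINT z|\<nu>. ?o z)" unfolding odd by simp
  finally have "Im (jump_exp \<nu> v r \<xi>) = 0"
    using integral_Im[OF int] by simp
  moreover have "Re (jump_exp \<nu> v r \<xi>) = (LINT z|\<nu>. v z * (1 - cos (\<xi> \<bullet> z)))"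
    unfolding integral_Re[OF int, symmetric]
    by (rule Bochner_Integration.integral_cong) (auto simp: comp_kernel_def indicator_def)
  ultimately show ?thesis by (simp add: complex_eq_iff)
qed

text \<open>Two truncation radii give kernels that differ by a term linear in z; its integral is the
  change of drift.\<close>

lemma comp_kernel_drift:
  fixes N :: "'a::euclidean_space measure"
  assumes N: "levy_measure N" and r: "0 < r"
  shows "(LINT z|N. comp_kernel r \<xi> z) = levy_exp N b \<xi> + \<i> * of_real (\<xi> \<bullet> drift_r N b r)"
proof -
  let ?D = "\<lambda>z::'a. (indicator (ball 0 r) z - indicator (ball 0 1) z) *\<^sub>R z"
  \<comment> \<open>The two truncations disagree only for lengths between \<open>m\<close> and
    \<open>M\<close>, where z is bounded and the jump measure is finite.\<close>
  define m where "m = min r 1"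
  define M where "M = max r 1"
  have m: "0 < m" "m \<le> 1" "m \<le> r" using r by (auto simp: m_def)
  have M: "0 < M" "1 \<le> M" "r \<le> M" by (auto simp: M_def)
  have [measurable]: "ball (0::'a) s \<in> sets borel" for s by simp
  have D: "integrable N ?D"
  proof (rule levy_integrable[OF N])
    fix z :: 'a
    show "norm (?D z) \<le> (M / m^2) * min 1 (norm z ^ 2)"
    proof (cases "m \<le> norm z \<and> norm z \<le> M")
      case True
      have "m^2 \<le> norm z ^ 2" using True m by (intro power_mono) auto
      moreover have "m^2 \<le> 1" using m by (simp add: power_le_one)
      ultimately have "m^2 \<le> min 1 (norm z ^ 2)" by simp
      then have "M / m^2 * m^2 \<le> M / m^2 * min 1 (norm z ^ 2)"
        using M by (intro mult_left_mono) auto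
      then have "M \<le> M / m^2 * min 1 (norm z ^ 2)" using m by simp
      moreover have "norm (?D z) \<le> M" using True M by (auto simp: indicator_def)
      ultimately show ?thesis by linarith
    next
      case False
      then have "?D z = 0" using m M by (auto simp: indicator_def m_def M_def)
      then have "norm (?D z) = 0" by (simp only: norm_zero)
      moreover have "0 \<le> (M / m^2) * min 1 (norm z ^ 2)" using M by simp
      ultimately show ?thesis by linarith
    qed
  qed measurable
  have ck: "integrable N (comp_kernel s \<xi>)" if "0 < s" for s
    using integrable_comp_kernel[OF N that, of "\<lambda>_. 1" 1 \<xi>] by simp
  have "(LINT z|N. comp_kernel r \<xi> z) - (LINT z|N. comp_kernel 1 \<xi> z) = (LINT z|N. comp_kernel r \<xi> z - comp_kernel 1 \<xi> z)"
    using ck r by simp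
  also have "\<dots> = (LINT z|N. \<i> * of_real (\<xi> \<bullet> ?D z))"
    by (rule Bochner_Integration.integral_cong) (auto simp: comp_kernel_def indicator_def)
  also have "\<dots> = \<i> * of_real (LINT z|N. \<xi> \<bullet> ?D z)"
    by (simp only: integral_mult_right_zero integral_complex_of_real)
  also have "(LINT z|N. \<xi> \<bullet> ?D z) = \<xi> \<bullet> (LINT z|N. ?D z)"
    by (rule integral_inner_right) (use D in auto)
  finally show ?thesis
    by (simp add: levy_exp_eq drift_r_def inner_add_right inner_commute algebra_simps)
qed

lemma inv_ft_shift:
  "inv_ft F (x + a) = inv_ft (\<lambda>\<xi>. F \<xi> * cis (- (\<xi> \<bullet> a))) x"
proof -
  have "cis (- (\<xi> \<bullet> (x + a))) = cis (- (\<xi> \<bullet> x)) * cis (- (\<xi> \<bullet> a))" for \<xi>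
    by (simp add: cis_mult inner_add_right)
  then show ?thesis unfolding inv_ft_def by (simp add: mult_ac)
qed

definition small_Psi :: "'a::euclidean_space measure \<Rightarrow> real \<Rightarrow> 'a \<Rightarrow> real" where
  "small_Psi \<nu> s \<xi> = (LINT z|\<nu>. indicator (cball 0 s) z * (1 - cos (\<xi> \<bullet> z)))"

lemma small_Psi_integrable:
  fixes \<nu> :: "'a::euclidean_space measure"
  assumes "levy_measure \<nu>"
  shows "integrable \<nu> (\<lambda>z. indicator (cball 0 s) z * (1 - cos (\<xi> \<bullet> z)))"
proof -
  note [measurable_cong] = levy_sets[OF assms]
  have [measurable]: "cball (0::'a) s \<in> sets borel" by simp
  show ?thesis
    by (rule Bochner_Integration.integrable_bound[OF one_minus_cos_integrable[OF assms, of \<xi>]])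
       (auto simp: indicator_def)
qed

text \<open>As no jump is longer than \<open>s\<close>, the bound is quadratic at every frequency.
  At frequencies well below \<open>1 / s\<close> it therefore gains a small factor, which makes
  moves much longer than \<open>s\<close> unlikely.\<close>

lemma small_Psi_le:
  assumes \<nu>: "levy_measure \<nu>" and s: "0 < s"
  shows "small_Psi \<nu> s \<xi> \<le> norm \<xi> ^ 2 * s^2 / 2 * h_fun \<nu> s"
proof -
  have "small_Psi \<nu> s \<xi> \<le> (LINT z|\<nu>. norm \<xi> ^ 2 * s^2 / 2 * min 1 (norm z ^ 2 / s^2))"
    unfolding small_Psi_def
  proof (rule integral_mono)
    fix z :: 'a
    show "indicator (cball 0 s) z * (1 - cos (\<xi> \<bullet> z)) \<le> norm \<xi> ^ 2 * s^2 / 2 * min 1 (norm z ^ 2 / s^2)"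
    proof (cases "norm z \<le> s")
      case True
      then have "norm z ^ 2 \<le> s^2" by (intro power_mono) auto
      then have m: "min 1 (norm z ^ 2 / s^2) = norm z ^ 2 / s^2" using s by simp
      have "1 - cos (\<xi> \<bullet> z) \<le> \<bar>\<xi> \<bullet> z\<bar>^2 / 2" using one_minus_cos_le[of "\<xi> \<bullet> z"] by simp
      also have "\<dots> \<le> (norm \<xi> * norm z)^2 / 2"
        by (intro divide_right_mono power_mono Cauchy_Schwarz_ineq2) auto
      also have "\<dots> = norm \<xi> ^ 2 * s^2 / 2 * (norm z ^ 2 / s^2)" using s by (simp add: power_mult_distrib)
      finally show ?thesis using True m by simp
    qed simp
  qed (use \<nu> s in \<open>auto intro!: small_Psi_integrable h_fun_integrable integrable_mult_right\<close>)
  then show ?thesis by (simp add: h_fun_def)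
qed

text \<open>The choice of \<open>K\<close> makes the full exponent at least 4 h(s) at frequencies of
  norm \<open>K / s\<close>, and the jumps longer than \<open>s\<close> account for at most 2 h(s)
  of it.\<close>

lemma (in levy_setup) small_Psi_lower:
  assumes s: "0 < s" "1 / T3 < ereal (1 / s)" and K: "1 \<le> K" "36 * real DIM('a) * a2 \<le> c3^2 * a1 * K powr \<alpha>"
    and u: "norm u = 1"
  shows "2 * h_fun \<nu> s \<le> small_Psi \<nu> s ((K / s) *\<^sub>R u)"
proof -
  let ?\<xi> = "(K / s) *\<^sub>R u"
  have n: "norm ?\<xi> * s = K" using s K u by simp
  have "4 \<le> c3^2 * a1 / (9 * real DIM('a) * a2) * K powr \<alpha>" using K(2) a2 by (simp add: field_simps)
  then have "4 * h_fun \<nu> s \<le> c3^2 * a1 / (9 * real DIM('a) * a2) * K powr \<alpha> * h_fun \<nu> s"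
    using h_fun_nonneg by (rule mult_right_mono)
  also have "\<dots> \<le> Psi_s \<nu> ?\<xi>" using Psi_nu_lower[OF s, of ?\<xi>] n K by simp
  finally have 4: "4 * h_fun \<nu> s \<le> Psi_s \<nu> ?\<xi>" .
  have "Psi_s \<nu> ?\<xi> \<le> (LINT z|\<nu>. indicator (cball 0 s) z * (1 - cos (?\<xi> \<bullet> z)) + 2 * min 1 (norm z ^ 2 / s^2))"
    unfolding Psi_s_def
  proof (rule integral_mono)
    fix z :: 'a
    show "1 - cos (?\<xi> \<bullet> z) \<le> indicator (cball 0 s) z * (1 - cos (?\<xi> \<bullet> z)) + 2 * min 1 (norm z ^ 2 / s^2)"
    proof (cases "norm z \<le> s")
      case False
      then have "s^2 \<le> norm z ^ 2" using s by (intro power_mono) auto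
      then have "min 1 (norm z ^ 2 / s^2) = 1" using s by simp
      then show ?thesis using False one_minus_cos_le_two[of "?\<xi> \<bullet> z"] by simp
    qed simp
  next
    show "integrable \<nu> (\<lambda>z. 1 - cos (?\<xi> \<bullet> z))" by (rule one_minus_cos_integrable[OF \<nu>])
    show "integrable \<nu> (\<lambda>z. indicator (cball 0 s) z * (1 - cos (?\<xi> \<bullet> z)) + 2 * min 1 (norm z ^ 2 / s^2))"
      by (intro Bochner_Integration.integrable_add small_Psi_integrable integrable_mult_right h_fun_integrable \<nu> s)
  qed
  also have "\<dots> = small_Psi \<nu> s ?\<xi> + (LINT z|\<nu>. 2 * min 1 (norm z ^ 2 / s^2))"
    unfolding small_Psi_def
    by (intro Bochner_Integration.integral_add small_Psi_integrable integrable_mult_right h_fun_integrable \<nu> s)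
  also have "(LINT z|\<nu>. 2 * min 1 (norm z ^ 2 / s^2)) = 2 * h_fun \<nu> s"
    by (simp add: h_fun_def)
  finally show ?thesis using 4 by simp
qed

text \<open>Each factor enlarges the ball by a/2 and multiplies the bound by
  \<open>\<gamma>\<close>. The geometric conditions on \<beta> only become easier as the radius
  grows, so the same parameters serve in every step.\<close>

lemma cf_seq_spread:
  fixes F :: "'a::euclidean_space \<Rightarrow> complex"
  assumes F: "integrable lborel F" and f0: "\<And>x. 0 \<le> Re (inv_ft F x)"
    and fc: "\<And>x. norm x \<le> \<rho> \<Longrightarrow> c \<le> Re (inv_ft F x)" and c: "0 \<le> c"
    and Q: "cf_seq Q \<phi>" and real: "\<And>\<xi>. Im (\<phi> \<xi>) = 0"
    and low: "\<And>u. norm u = 1 \<Longrightarrow> \<eta> \<le> 1 - Re (\<phi> (k *\<^sub>R u))"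
    and up: "\<And>\<xi>. norm \<xi> \<le> 1 / \<beta> \<Longrightarrow> 1 - Re (\<phi> \<xi>) \<le> C"
    and par: "0 < a" "0 < \<beta>" "\<beta> \<le> \<rho>" "\<beta>^2 \<le> \<rho> * a" "k^2 * a^2 \<le> \<eta>"
    and \<gamma>: "0 \<le> \<gamma>" "\<gamma> \<le> (\<eta> / 4 - 9 * real DIM('a) * C) / 2"
  shows "integrable lborel (\<lambda>\<xi>. F \<xi> * \<phi> \<xi> ^ m) \<and> (\<forall>x. 0 \<le> Re (inv_ft (\<lambda>\<xi>. F \<xi> * \<phi> \<xi> ^ m) x)) \<and>
    (\<forall>x. norm x \<le> \<rho> + real m * a / 2 \<longrightarrow> c * \<gamma> ^ m \<le> Re (inv_ft (\<lambda>\<xi>. F \<xi> * \<phi> \<xi> ^ m) x))"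
proof (induction m)
  case 0
  then show ?case using F f0 fc by simp
next
  case (Suc m)
  define G where "G = (\<lambda>\<xi>. F \<xi> * \<phi> \<xi> ^ m)"
  have G: "integrable lborel G" "\<And>x. 0 \<le> Re (inv_ft G x)"
    "\<And>x. norm x \<le> \<rho> + real m * a / 2 \<Longrightarrow> c * \<gamma> ^ m \<le> Re (inv_ft G x)"
    using Suc unfolding G_def by auto
  have eq: "(\<lambda>\<xi>. F \<xi> * \<phi> \<xi> ^ Suc m) = (\<lambda>\<xi>. G \<xi> * \<phi> \<xi>)" by (simp add: G_def fun_eq_iff mult_ac)
  have cm: "0 \<le> c * \<gamma> ^ m" using c \<gamma> by simp
  have \<rho>: "\<beta> \<le> \<rho> + real m * a / 2" "\<beta>^2 \<le> (\<rho> + real m * a / 2) * a"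
  proof -
    have "0 \<le> real m * a / 2" using par by simp
    then show "\<beta> \<le> \<rho> + real m * a / 2" using par by linarith
    have "\<rho> * a \<le> (\<rho> + real m * a / 2) * a" using par by (intro mult_right_mono) auto
    then show "\<beta>^2 \<le> (\<rho> + real m * a / 2) * a" using par by linarith
  qed
  have "c * \<gamma> ^ Suc m \<le> Re (inv_ft (\<lambda>\<xi>. G \<xi> * \<phi> \<xi>) x)" if "norm x \<le> \<rho> + real (Suc m) * a / 2" for x
  proof -
    have "c * \<gamma> ^ Suc m = c * \<gamma> ^ m * \<gamma>" by simp
    also have "\<dots> \<le> c * \<gamma> ^ m * ((\<eta> / 4 - 9 * real DIM('a) * C) / 2)"
      using cm \<gamma>(2) by (rule mult_left_mono[rotated])
    also have "\<dots> = c * \<gamma> ^ m / 2 * (\<eta> / 4 - 9 * real DIM('a) * C)" by simp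
    also have "\<dots> \<le> Re (inv_ft (\<lambda>\<xi>. G \<xi> * \<phi> \<xi>) x)"
    proof (rule cf_seq_enlarge_ball[OF G cm Q real low up par(1,2) \<rho> par(5)])
      show "norm x \<le> \<rho> + real m * a / 2 + a / 2" using that by (simp add: algebra_simps add_divide_distrib)
    qed
    finally show ?thesis .
  qed
  then show ?case unfolding eq using cf_seq_integrable_mult[OF Q G(1)] cf_seq_nonneg[OF Q G(1,2)] by auto
qed

text \<open>In terms of the random walk the conditions say: success probability of one piece in the
  linear range of exp, total travel at least \<open>L\<close>, curvature, step bound inside the
  initial ball, and available intensity.\<close>

lemma spread_parameters:
  fixes K L e A \<alpha> d :: real
  assumes K: "1 \<le> K" and L: "0 < L" and e: "0 < e" and A: "0 < A" and \<alpha>: "0 < \<alpha>" and d: "1 \<le> d"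
  shows "\<exists>H \<kappa>. \<exists>n::nat. 1 \<le> H \<and> 0 < \<kappa> \<and> \<kappa> \<le> 1 \<and> H \<le> real n \<and> 8 * K^2 * L^2 \<le> real n * H * \<kappa>^2 \<and>
    36 * d^2 * \<kappa> * K \<le> e * sqrt (H / (2 * real n)) \<and> 6 * d * \<kappa> \<le> e \<and> H \<le> A * \<kappa> powr (- \<alpha>)"
proof -
  define Z where "Z = K^2 * L * d^2 / e"
  have Z: "0 < Z" using assms by (simp add: Z_def)
  \<comment> \<open>204 exceeds 36 sqrt 32: the travel condition fixes n in terms of \<kappa>, after
    which \<kappa> cancels from the curvature condition and leaves H \<ge> 36 sqrt 32 Z.\<close>
  define H where "H = 204 * Z + 1"
  have H: "1 \<le> H" "0 < H" "204 * Z \<le> H" using Z by (auto simp: H_def)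
  define \<kappa> where "\<kappa> = min (min 1 (e / (6 * d))) (min (K * L / H) ((A / H) powr (1 / \<alpha>)))"
  have k: "0 < \<kappa>" "\<kappa> \<le> 1" "\<kappa> \<le> e / (6 * d)" "\<kappa> \<le> K * L / H" "\<kappa> \<le> (A / H) powr (1 / \<alpha>)"
    using assms H by (auto simp: \<kappa>_def)
  \<comment> \<open>The real solution of the travel condition with equality. As
    \<open>\<kappa> \<le> K * L / H\<close> implies \<open>Y \<ge> H \<ge> 1\<close>, rounding up to
    \<open>n\<close> at most doubles it.\<close>
  define Y where "Y = 8 * (K * L)^2 / (\<kappa>^2 * H)"
  have YH: "Y * (\<kappa>^2 * H) = 8 * (K * L)^2" using k H by (simp add: Y_def)
  have "\<kappa> * H \<le> K * L" using k H by (simp add: field_simps)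
  then have "(\<kappa> * H)^2 \<le> (K * L)^2" using k H by (intro power_mono) auto
  then have "(\<kappa> * H)^2 \<le> 8 * (K * L)^2" using zero_le_power2[of "K * L"] by linarith
  moreover have "H * (\<kappa>^2 * H) = (\<kappa> * H)^2" by (simp add: power2_eq_square mult_ac)
  ultimately have "H * (\<kappa>^2 * H) \<le> Y * (\<kappa>^2 * H)" unfolding YH by simp
  then have HY: "H \<le> Y" using k H by (simp add: mult_le_cancel_right)
  define n where "n = nat \<lceil>Y\<rceil>"
  have n1: "Y \<le> real n" by (simp add: n_def real_nat_ceiling_ge)
  have "real n < Y + 1" using HY H unfolding n_def by linarith
  then have n2: "real n \<le> 2 * Y" using HY H by linarith
  have n0: "0 < real n" using n1 HY H by linarith
  have "8 * K^2 * L^2 \<le> real n * H * \<kappa>^2"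
  proof -
    have "Y * (\<kappa>^2 * H) \<le> real n * (\<kappa>^2 * H)" using n1 H by (intro mult_right_mono) auto
    then show ?thesis unfolding YH by (simp add: power_mult_distrib mult_ac)
  qed
  moreover have "36 * d^2 * \<kappa> * K \<le> e * sqrt (H / (2 * real n))"
  proof -
    have "(36 * d^2 * \<kappa> * K / e)^2 * (2 * real n) \<le> (36 * d^2 * \<kappa> * K / e)^2 * (4 * Y)"
      using n2 by (intro mult_left_mono) auto
    also have "\<dots> * H = (36 * d^2 * K / e)^2 * 4 * (Y * (\<kappa>^2 * H))"
      by (simp add: power_mult_distrib power_divide)
    also have "\<dots> = 41472 * Z^2"
      unfolding YH Z_def by (simp add: power_mult_distrib power_divide power_mult[symmetric])
    also have "\<dots> \<le> (204 * Z)^2" by (simp add: power_mult_distrib)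
    also have "\<dots> \<le> H^2" using H Z by (intro power_mono) auto
    finally have "(36 * d^2 * \<kappa> * K / e)^2 * (2 * real n) * H \<le> H * H"
      using H by (simp add: power2_eq_square mult_right_mono)
    then have "(36 * d^2 * \<kappa> * K / e)^2 * (2 * real n) \<le> H" using H by simp
    then have "(36 * d^2 * \<kappa> * K / e)^2 \<le> H / (2 * real n)" using n0 by (simp add: pos_le_divide_eq)
    then have "36 * d^2 * \<kappa> * K / e \<le> sqrt (H / (2 * real n))" by (rule real_le_rsqrt)
    then show ?thesis using e by (simp add: pos_divide_le_eq mult.commute)
  qed
  moreover have "6 * d * \<kappa> \<le> e" using k(3) d by (simp add: field_simps)
  moreover have "H \<le> A * \<kappa> powr (- \<alpha>)"
  proof -
    have "\<kappa> powr \<alpha> \<le> ((A / H) powr (1 / \<alpha>)) powr \<alpha>" using k \<alpha> by (intro powr_mono2) auto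
    also have "\<dots> = A / H" using \<alpha> A H by (simp add: powr_powr)
    finally show ?thesis using H k by (simp add: powr_minus field_simps)
  qed
  moreover have "H \<le> real n" using HY n1 by linarith
  ultimately show ?thesis using H k by blast
qed

section \<open>The remaining, possibly asymmetric jumps\<close>

lemma one_minus_Re_exp_le:
  assumes "0 \<le> Re y"
  shows "1 - Re (exp (- y)) \<le> 2 * norm y"
proof -
  have e: "exp (- Re y) \<le> 1" using assms by simp
  have "1 - Re (exp (- y)) = (1 - exp (- Re y)) + exp (- Re y) * (1 - cos (Im y))"
    by (simp add: Re_exp algebra_simps)
  also have "exp (- Re y) * (1 - cos (Im y)) \<le> 1 * \<bar>Im y\<bar>"
    using e one_minus_cos_le_abs[of "Im y"] by (intro mult_mono) auto
  also have "1 - exp (- Re y) \<le> Re y" using exp_ge_add_one_self[of "- Re y"] by linarith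
  finally show ?thesis using abs_Re_le_cmod[of y] abs_Im_le_cmod[of y] by linarith
qed

text \<open>\<open>CN\<close> controls both parts of the jumps. For those below \<open>r\<close> it
  bounds the truncated second moment, so their compensated sum exceeds R r with limiting probability
  at most 9 d CN / R^2 \<le> 1/2. For the others it bounds their expected number, so none occurs
  with probability at least exp(-CN).\<close>

lemma jumps_lower_bound:
  fixes N :: "'a::euclidean_space measure" and F :: "'a \<Rightarrow> complex"
  assumes N: "levy_measure N" and r: "0 < r" and t: "0 < t" and CN: "t * h_fun N r \<le> CN"
    and w [measurable]: "w \<in> borel_measurable borel" and w0: "\<And>z. 0 \<le> w z" "\<And>z. w z \<le> t"
    and F: "integrable lborel F" and f0: "\<And>x. 0 \<le> Re (inv_ft F x)"
    and fc: "\<And>x. norm x \<le> (\<theta> + R) * r \<Longrightarrow> c \<le> Re (inv_ft F x)" and c: "0 \<le> c"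
    and R: "1 \<le> R" "18 * real DIM('a) * CN \<le> R" and x: "norm x \<le> \<theta> * r"
  shows "exp (- CN) * (c / 2) \<le> Re (inv_ft (\<lambda>\<xi>. F \<xi> * exp (- jump_exp N w r \<xi>)) x)"
proof -
  note [measurable_cong] = levy_sets[OF N]
  have [measurable]: "ball (0::'a) r \<in> sets borel" by simp
  define w1 where "w1 = (\<lambda>z. w z * indicator (ball 0 r) z)"
  define w2 where "w2 = (\<lambda>z. w z * (1 - indicator (ball 0 r) z))"
  have m1 [measurable]: "w1 \<in> borel_measurable borel" unfolding w1_def by measurable
  have m2 [measurable]: "w2 \<in> borel_measurable borel" unfolding w2_def by measurable
  have w1: "0 \<le> w1 z" "w1 z \<le> t" for z using w0 t by (auto simp: w1_def indicator_def)
  have w2: "0 \<le> w2 z" "w2 z \<le> t" for z using w0 t by (auto simp: w2_def indicator_def)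
  have CN0: "0 \<le> CN" using CN t h_fun_nonneg[of N r] by (meson mult_nonneg_nonneg less_imp_le order_trans)
  let ?m = "\<lambda>z::'a. min 1 (norm z ^ 2 / r^2)"
  note i1 = integrable_comp_kernel[OF N r m1 w1] and i2 = integrable_comp_kernel[OF N r m2 w2]
  define y1 where "y1 = (\<lambda>\<xi>. \<integral>z. w1 z *\<^sub>R comp_kernel r \<xi> z \<partial>N)"
  obtain Q where Q: "cf_seq Q (\<lambda>\<xi>. exp (- y1 \<xi>))"
    unfolding y1_def using cf_seq_levy[OF N r m1 w1] by auto
  have up: "1 - Re (exp (- y1 \<xi>)) \<le> CN / R^2" if \<xi>: "norm \<xi> \<le> 1 / (R * r)" for \<xi>
  proof -
    have "Re (y1 \<xi>) = (LINT z|N. w1 z * (1 - cos (\<xi> \<bullet> z)))"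
      unfolding y1_def integral_Re[OF i1, symmetric]
      by (rule Bochner_Integration.integral_cong) (auto simp: comp_kernel_def indicator_def)
    also have "\<dots> \<ge> 0" using w1 by (intro integral_nonneg_AE) auto
    finally have "1 - Re (exp (- y1 \<xi>)) \<le> 2 * norm (y1 \<xi>)" by (rule one_minus_Re_exp_le)
    also have "norm (y1 \<xi>) \<le> (LINT z|N. norm (w1 z *\<^sub>R comp_kernel r \<xi> z))"
      unfolding y1_def by (rule integral_norm_bound)
    also have "\<dots> \<le> (LINT z|N. t * (1 / (2 * R^2)) * ?m z)"
    proof (rule integral_mono)
      show "integrable N (\<lambda>z. norm (w1 z *\<^sub>R comp_kernel r \<xi> z))" by (rule integrable_norm[OF i1])
      show "integrable N (\<lambda>z. t * (1 / (2 * R^2)) * ?m z)" by (intro integrable_mult_right h_fun_integrable N r)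
      fix z :: 'a
      show "norm (w1 z *\<^sub>R comp_kernel r \<xi> z) \<le> t * (1 / (2 * R^2)) * ?m z"
      proof (cases "norm z < r")
        case True
        then have "norm z ^ 2 \<le> r^2" by (intro power_mono) auto
        then have m: "?m z = norm z ^ 2 / r^2" using r by simp
        have "norm (comp_kernel r \<xi> z) \<le> (norm \<xi> * norm z)^2 / 2"
          by (rule norm_comp_kernel_inside[OF True])
        also have "\<dots> \<le> (1 / (R * r) * norm z)^2 / 2"
          using \<xi> by (intro divide_right_mono power_mono mult_right_mono) auto
        also have "\<dots> = 1 / (2 * R^2) * ?m z" unfolding m by (simp add: power_mult_distrib power_divide)
        finally have "w1 z * norm (comp_kernel r \<xi> z) \<le> t * (1 / (2 * R^2) * ?m z)"
          using w1 t by (intro mult_mono) auto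
        then show ?thesis using w1[of z] by (simp add: mult.assoc)
      next
        case False
        have "0 \<le> t * (1 / (2 * R^2)) * ?m z" using t by simp
        then show ?thesis using False by (simp add: w1_def)
      qed
    qed
    also have "\<dots> = (t * h_fun N r) / (2 * R^2)" by (simp add: h_fun_def)
    also have "\<dots> \<le> CN / (2 * R^2)" using CN by (intro divide_right_mono) auto
    finally show ?thesis by simp
  qed
  define G where "G = (\<lambda>\<xi>. F \<xi> * exp (- y1 \<xi>))"
  have G: "integrable lborel G" "\<And>x. 0 \<le> Re (inv_ft G x)"
    unfolding G_def using cf_seq_integrable_mult[OF Q F] cf_seq_nonneg[OF Q F f0] by auto
  have Rr: "0 < R * r" using R r by simp
  have "c * (1 - 9 * real DIM('a) * (CN / R^2)) \<le> Re (inv_ft G x)"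
    unfolding G_def
    by (rule cf_seq_shrink_ball[OF F f0 _ c Q Rr up x]) (auto intro!: fc simp: algebra_simps)
  moreover have "c / 2 \<le> c * (1 - 9 * real DIM('a) * (CN / R^2))"
  proof -
    have "18 * real DIM('a) * CN \<le> R * R" using R mult_mono[of 1 R R R] by linarith
    then have "9 * real DIM('a) * (CN / R^2) \<le> 1 / 2" using R by (simp add: field_simps power2_eq_square)
    then have "c * (1 / 2) \<le> c * (1 - 9 * real DIM('a) * (CN / R^2))" using c by (intro mult_left_mono) auto
    then show ?thesis by simp
  qed
  ultimately have Gc: "c / 2 \<le> Re (inv_ft G x)" by linarith
  obtain P where P: "borel_prob P" "\<And>\<xi>. char_fn P \<xi> = exp (- jump_exp N w2 r \<xi>)"
    "exp (- (LINT z|N. w2 z)) \<le> measure P {0}"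
    using compound_poisson_big_jumps[OF N r m2 w2] by (auto simp: w2_def)
  have "(LINT z|N. w2 z) \<le> (LINT z|N. t * ?m z)"
  proof (rule integral_mono_AE')
    show "integrable N (\<lambda>z. t * ?m z)" by (intro integrable_mult_right h_fun_integrable N r)
    show "AE z in N. w2 z \<le> t * ?m z"
    proof (rule AE_I2)
      fix z :: 'a
      show "w2 z \<le> t * ?m z"
      proof (cases "norm z < r")
        case False
        then have "r^2 \<le> norm z ^ 2" using r by (intro power_mono) auto
        then have "?m z = 1" using r by simp
        then show ?thesis using w2[of z] by simp
      qed (use t in \<open>simp add: w2_def\<close>)
    qed
    show "AE z in N. 0 \<le> t * ?m z" using t by simp
  qed
  also have "\<dots> \<le> CN" using CN by (simp add: h_fun_def)
  finally have "exp (- CN) \<le> measure P {0}" using P(3) by (meson exp_le_cancel_iff neg_le_iff_le order_trans)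
  from atom_lower_bound[OF G P(1) this, of x]
  have A: "exp (- CN) * Re (inv_ft G x) \<le> Re (inv_ft (\<lambda>\<xi>. G \<xi> * char_fn P \<xi>) x)" .
  have B: "exp (- CN) * (c / 2) \<le> exp (- CN) * Re (inv_ft G x)" using Gc by simp
  have eq: "G \<xi> * char_fn P \<xi> = F \<xi> * exp (- jump_exp N w r \<xi>)" for \<xi>
  proof -
    have "jump_exp N w r \<xi> = (LINT z|N. w1 z *\<^sub>R comp_kernel r \<xi> z + w2 z *\<^sub>R comp_kernel r \<xi> z)"
      by (rule Bochner_Integration.integral_cong) (auto simp: w1_def w2_def algebra_simps)
    also have "\<dots> = y1 \<xi> + jump_exp N w2 r \<xi>"
      unfolding y1_def by (rule Bochner_Integration.integral_add[OF i1 i2])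
    finally show ?thesis by (simp add: G_def P(2) exp_add[symmetric] algebra_simps)
  qed
  show ?thesis using order_trans[OF B A] unfolding eq .
qed

lemma Psi_s_measurable:
  fixes \<nu> :: "'a::euclidean_space measure"
  assumes "levy_measure \<nu>"
  shows "Psi_s \<nu> \<in> borel_measurable borel"
proof -
  interpret sigma_finite_measure \<nu> by (rule levy_sigma_finite[OF assms])
  note [measurable_cong] = levy_sets[OF assms]
  show ?thesis unfolding Psi_s_def by (rule borel_measurable_lebesgue_integral) simp
qed

lemma one_minus_exp_ge:
  assumes "0 \<le> y" "y \<le> 1"
  shows "y / 2 \<le> 1 - exp (- y :: real)"
proof -
  have "exp (- y) \<le> 1 / (1 + y)"
    using assms exp_ge_add_one_self[of y] by (simp add: exp_minus field_simps)
  also have "\<dots> \<le> 1 - y / 2"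
  proof -
    have "y * y \<le> y" using assms mult_left_mono[of y 1 y] by simp
    then show ?thesis using assms by (simp add: field_simps)
  qed
  finally show ?thesis by linarith
qed

section \<open>The two symmetric factors under the standing hypotheses\<close>

context levy_setup
begin

lemma nu_comp_kernel:
  assumes "0 < r" "v \<in> borel_measurable borel" "\<And>z. 0 \<le> v z" "\<And>z. v z \<le> V" "\<And>z. v (- z) = v z"
  shows "jump_exp \<nu> v r \<xi> = of_real (LINT z|\<nu>. v z * (1 - cos (\<xi> \<bullet> z)))"
  by (rule symmetric_comp_kernel[OF \<nu> sym assms])

text \<open>At the scale \<open>q\<close> the quantity \<open>t * h_fun \<nu> q\<close> is
  comparable to 1, so the exponent is bounded up to frequency \<open>1 / q\<close> and grows like
  the power \<alpha> beyond it, as \<open>small_ball_bound\<close> demands. By symmetry the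
  truncation radius \<open>r\<close> can be arbitrary.\<close>

lemma base_part:
  fixes t q r :: real
  assumes base: "small_ball_bound TYPE('a) (a1 * k0^2) (a1 * cB / 2) \<alpha> c0 e0"
    and cB: "cB = c3^2 * a1 / (9 * real DIM('a) * a2)"
    and t: "0 < t" and q: "0 < q" "1 / T3 < ereal (1 / q)" and r: "0 < r"
    and h: "t * h_fun \<nu> q \<le> k0^2" "1 \<le> t * h_fun \<nu> q"
    and eps: "0 < eps" "eps \<le> q^2"
  defines "F \<equiv> \<lambda>\<xi>. complex_of_real (exp (- (t * a1 / 2 * Psi_s \<nu> \<xi>)) * gauss eps \<xi>)"
  shows "integrable lborel F" "\<And>x. 0 \<le> Re (inv_ft F x)"
    "\<And>x. norm x \<le> e0 * q \<Longrightarrow> c0 * (1 / q) ^ DIM('a) \<le> Re (inv_ft F x)"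
    "\<And>\<xi>. F \<xi> = of_real (gauss eps \<xi>) * exp (- jump_exp \<nu> (\<lambda>_. t * a1 / 2) r \<xi>)"
proof -
  let ?\<psi> = "\<lambda>\<xi>. t * a1 / 2 * Psi_s \<nu> \<xi>"
  have ta: "0 \<le> t * a1 / 2" using t a1 by simp
  have k: "jump_exp \<nu> (\<lambda>_. t * a1 / 2) r \<xi> = of_real (?\<psi> \<xi>)" for \<xi>
    by (subst nu_comp_kernel[OF r, where V = "t * a1 / 2"]) (use ta in \<open>auto simp: Psi_s_def\<close>)
  show F: "F \<xi> = of_real (gauss eps \<xi>) * exp (- jump_exp \<nu> (\<lambda>_. t * a1 / 2) r \<xi>)" for \<xi>
    unfolding k F_def by (simp add: exp_of_real[symmetric] mult.commute)
  obtain Q where Q: "cf_seq Q (\<lambda>\<xi>. exp (- jump_exp \<nu> (\<lambda>_. t * a1 / 2) r \<xi>))"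
    using cf_seq_levy[OF \<nu> r, of "\<lambda>_. t * a1 / 2" "t * a1 / 2"] ta by auto
  have gi: "integrable lborel (\<lambda>\<xi>::'a. complex_of_real (gauss eps \<xi>))"
    by (intro integrable_of_real integrable_gauss eps)
  have g0: "0 \<le> Re (inv_ft (\<lambda>\<xi>. complex_of_real (gauss eps \<xi>)) x)" for x :: 'a
    unfolding inv_ft_gauss[OF eps(1)] using eps by (simp add: gauss_def)
  have FF: "F = (\<lambda>\<xi>. of_real (gauss eps \<xi>) * exp (- jump_exp \<nu> (\<lambda>_. t * a1 / 2) r \<xi>))"
    using F by (rule ext)
  show "integrable lborel F" unfolding FF by (rule cf_seq_integrable_mult[OF Q gi])
  show "0 \<le> Re (inv_ft F x)" for x unfolding FF by (rule cf_seq_nonneg[OF Q gi g0])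
  fix x :: 'a assume x: "norm x \<le> e0 * q"
  have "?\<psi> \<xi> \<le> a1 * k0^2" if "norm \<xi> * q \<le> 1" for \<xi>
  proof -
    have "?\<psi> \<xi> \<le> t * a1 / 2 * (2 * h_fun \<nu> q)"
      using ta by (intro mult_left_mono Psi_s_le_h_fun[OF \<nu> q(1) that])
    also have "\<dots> = a1 * (t * h_fun \<nu> q)" by simp
    also have "\<dots> \<le> a1 * k0^2" using h a1 by (intro mult_left_mono) auto
    finally show ?thesis .
  qed
  moreover have "a1 * cB / 2 * (norm \<xi> * q) powr \<alpha> \<le> ?\<psi> \<xi>" if "1 \<le> norm \<xi> * q" for \<xi>
  proof -
    have *: "cB * (norm \<xi> * q) powr \<alpha> * h_fun \<nu> q \<le> Psi_s \<nu> \<xi>"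
      unfolding cB by (rule Psi_nu_lower[OF q that])
    have cB0: "0 \<le> cB" using a1 a2 unfolding cB by simp
    have "cB * (norm \<xi> * q) powr \<alpha> * 1 \<le> cB * (norm \<xi> * q) powr \<alpha> * (t * h_fun \<nu> q)"
      using h cB0 by (intro mult_left_mono) auto
    also have "\<dots> = t * (cB * (norm \<xi> * q) powr \<alpha> * h_fun \<nu> q)" by (simp only: mult_ac)
    also have "\<dots> \<le> t * Psi_s \<nu> \<xi>" using * t by (intro mult_left_mono) auto
    finally have "a1 / 2 * (cB * (norm \<xi> * q) powr \<alpha> * 1) \<le> a1 / 2 * (t * Psi_s \<nu> \<xi>)"
      using a1 by (intro mult_left_mono) auto
    then show ?thesis by (simp add: mult_ac)
  qed
  moreover have "?\<psi> \<in> borel_measurable borel" using Psi_s_measurable[OF \<nu>] by measurable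
  moreover have "0 \<le> ?\<psi> \<xi>" for \<xi> using ta Psi_s_nonneg by (rule mult_nonneg_nonneg)
  ultimately show "c0 * (1 / q) ^ DIM('a) \<le> Re (inv_ft F x)"
    using base q(1) eps x unfolding F_def small_ball_bound_def by simp
qed

text \<open>The law is the n-fold convolution of a piece of intensity \<tau>/n. The normalisation
  \<tau> h(s) = H/2 makes the exponent of a piece at least H/n \<le> 1 at frequencies of norm K/s,
  hence 1 - Re \<phi> \<ge> H/(2n) there.\<close>

lemma spread_part:
  fixes F :: "'a \<Rightarrow> complex" and n :: nat
  assumes F: "integrable lborel F" "\<And>x. 0 \<le> Re (inv_ft F x)"
    "\<And>x. norm x \<le> e0 * q \<Longrightarrow> c \<le> Re (inv_ft F x)" and c: "0 \<le> c"
    and q: "0 < q" and r: "0 < r" and \<kappa>: "0 < \<kappa>" and s: "s = \<kappa> * q" "1 / T3 < ereal (1 / s)"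
    and K: "1 \<le> K" "36 * real DIM('a) * a2 \<le> c3^2 * a1 * K powr \<alpha>"
    and \<tau>: "0 < \<tau>" "\<tau> * h_fun \<nu> s = H / 2"
    and par: "1 \<le> H" "H \<le> real n" "8 * K^2 * L^2 \<le> real n * H * \<kappa>^2"
      "36 * (real DIM('a))^2 * \<kappa> * K \<le> e0 * sqrt (H / (2 * real n))" "6 * real DIM('a) * \<kappa> \<le> e0" and L: "0 < L"
  defines "G \<equiv> \<lambda>\<xi>. F \<xi> * exp (- jump_exp \<nu> (\<lambda>z. \<tau> * indicator (cball 0 s) z) r \<xi>)"
  shows "integrable lborel G" "\<And>x. 0 \<le> Re (inv_ft G x)"
    "\<And>x. norm x \<le> L * q \<Longrightarrow> c * (H / (32 * real n)) ^ n \<le> Re (inv_ft G x)"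
proof -
  let ?d = "real DIM('a)"
  have d: "1 \<le> ?d" using DIM_positive[where 'a='a] by linarith
  have n: "0 < real n" using par by linarith
  have s0: "0 < s" using s \<kappa> q by simp
  have h: "0 < h_fun \<nu> s" by (rule h_nu_pos[OF s0])
  have [measurable]: "cball (0::'a) s \<in> sets borel" by simp
  define v where "v = (\<lambda>z::'a. \<tau> / real n * indicator (cball 0 s) z)"
  have vm: "v \<in> borel_measurable borel" unfolding v_def by measurable
  have v0: "0 \<le> v z" "v z \<le> \<tau> / real n" "v (- z) = v z" for z
    using \<tau> n by (auto simp: v_def indicator_def)
  define \<Phi> where "\<Phi> = (\<lambda>\<xi>. \<tau> / real n * small_Psi \<nu> s \<xi>)"
  define \<phi> where "\<phi> = (\<lambda>\<xi>. exp (- jump_exp \<nu> v r \<xi>))"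
  have \<phi>: "\<phi> \<xi> = of_real (exp (- \<Phi> \<xi>))" for \<xi>
  proof -
    have "jump_exp \<nu> v r \<xi> = of_real (LINT z|\<nu>. v z * (1 - cos (\<xi> \<bullet> z)))"
      by (rule nu_comp_kernel[OF r vm v0])
    also have "(LINT z|\<nu>. v z * (1 - cos (\<xi> \<bullet> z))) = \<Phi> \<xi>"
      unfolding \<Phi>_def small_Psi_def v_def by (simp only: mult.assoc integral_mult_right_zero)
    finally show ?thesis unfolding \<phi>_def by (simp add: exp_of_real[symmetric])
  qed
  obtain Q where Q: "cf_seq Q \<phi>" unfolding \<phi>_def using cf_seq_levy[OF \<nu> r vm v0(1,2)] by auto
  define \<eta> where "\<eta> = H / (2 * real n)"
  have \<eta>: "0 < \<eta>" using par n by (simp add: \<eta>_def)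
  \<comment> \<open>The factor 6d makes the tail term 9 d C at most H/(16n), half of \<eta>/4 =
    H/(8n); what is left, halved again, is the rate H/(32n). The step \<open>a\<close> is the
    equality case of k^2 a^2 \<le> \<eta> with k = K/s.\<close>
  define \<beta> where "\<beta> = 6 * ?d * s"
  define a where "a = s * sqrt \<eta> / K"
  define C where "C = H / (144 * real n * ?d^2)"
  have low: "\<eta> \<le> 1 - Re (\<phi> ((K / s) *\<^sub>R u))" if "norm u = 1" for u
  proof -
    have "H / real n = \<tau> / real n * (2 * h_fun \<nu> s)" using \<tau>(2) n by (simp add: field_simps)
    also have "\<dots> \<le> \<Phi> ((K / s) *\<^sub>R u)" unfolding \<Phi>_def
      using \<tau> n by (intro mult_left_mono small_Psi_lower[OF s0 s(2) K that]) auto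
    finally have "exp (- \<Phi> ((K / s) *\<^sub>R u)) \<le> exp (- (H / real n))" by simp
    moreover have "H / real n / 2 \<le> 1 - exp (- (H / real n))"
      using par n by (intro one_minus_exp_ge) auto
    moreover have "\<eta> = H / real n / 2" by (simp add: \<eta>_def)
    ultimately have "\<eta> \<le> 1 - exp (- \<Phi> ((K / s) *\<^sub>R u))" by linarith
    then show ?thesis by (simp add: \<phi>)
  qed
  have up: "1 - Re (\<phi> \<xi>) \<le> C" if \<xi>: "norm \<xi> \<le> 1 / \<beta>" for \<xi>
  proof -
    have "1 - Re (\<phi> \<xi>) \<le> \<Phi> \<xi>" using exp_ge_add_one_self[of "- \<Phi> \<xi>"] by (simp add: \<phi>)
    also have "\<dots> \<le> \<tau> / real n * (norm \<xi> ^ 2 * s^2 / 2 * h_fun \<nu> s)" unfolding \<Phi>_def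
      using \<tau> n by (intro mult_left_mono small_Psi_le[OF \<nu> s0]) auto
    also have "\<dots> = H * (norm \<xi> * s)^2 / (4 * real n)" 
    proof -
      have "\<tau> / real n * (norm \<xi> ^ 2 * s^2 / 2 * h_fun \<nu> s) = (\<tau> * h_fun \<nu> s) * (norm \<xi> * s)^2 / (2 * real n)"
        by (simp add: power_mult_distrib mult_ac)
      then show ?thesis unfolding \<tau>(2) by simp
    qed
    also have "\<dots> \<le> H * (1 / (6 * ?d))^2 / (4 * real n)"
    proof -
      have "norm \<xi> * s \<le> 1 / \<beta> * s" using \<xi> s0 by (intro mult_right_mono) auto
      also have "\<dots> = 1 / (6 * ?d)" using s0 by (simp add: \<beta>_def)
      finally show ?thesis
        using par n s0 by (intro divide_right_mono mult_left_mono power_mono) auto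
    qed
    also have "\<dots> = C" by (simp add: C_def power_divide power_mult_distrib)
    finally show ?thesis .
  qed
  have P: "0 < a" "0 < \<beta>" "\<beta> \<le> e0 * q" "\<beta>^2 \<le> e0 * q * a" "(K / s)^2 * a^2 \<le> \<eta>"
  proof -
    show "0 < a" using s0 \<eta> K by (simp add: a_def)
    show "0 < \<beta>" using s0 d by (simp add: \<beta>_def)
    have "6 * ?d * \<kappa> * q \<le> e0 * q" using par(5) q by (intro mult_right_mono) auto
    then show "\<beta> \<le> e0 * q" by (simp add: \<beta>_def s(1) mult_ac)
    have "\<beta>^2 = (36 * ?d^2 * \<kappa> * K) * (q * s / K)"
      using K by (simp add: \<beta>_def s(1) power2_eq_square)
    also have "\<dots> \<le> (e0 * sqrt \<eta>) * (q * s / K)"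
      using par(4) q s0 K unfolding \<eta>_def by (intro mult_right_mono) auto
    also have "\<dots> = e0 * q * a" by (simp add: a_def)
    finally show "\<beta>^2 \<le> e0 * q * a" .
    show "(K / s)^2 * a^2 \<le> \<eta>" using s0 K \<eta> by (simp add: a_def power_divide power_mult_distrib)
  qed
  have \<gamma>: "0 \<le> H / (32 * real n)" "H / (32 * real n) \<le> (\<eta> / 4 - 9 * ?d * C) / 2"
  proof -
    show "0 \<le> H / (32 * real n)" using par n by simp
    have "9 * ?d * C = H / (16 * real n) * (1 / ?d)" using d by (simp add: C_def power2_eq_square)
    also have "\<dots> \<le> H / (16 * real n) * 1"
      using par n d by (intro mult_left_mono) auto
    finally have "9 * ?d * C \<le> H / (16 * real n)" by simp
    moreover define X where "X = H / (16 * real n)"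
    moreover define Y where "Y = 9 * ?d * C"
    moreover have "\<eta> = 8 * X" "H / (32 * real n) = X / 2" by (auto simp: \<eta>_def X_def)
    ultimately show "H / (32 * real n) \<le> (\<eta> / 4 - 9 * ?d * C) / 2" by simp
  qed
  have re: "Im (\<phi> \<xi>) = 0" for \<xi> by (simp add: \<phi>)
  have Gn: "G = (\<lambda>\<xi>. F \<xi> * \<phi> \<xi> ^ n)"
  proof
    fix \<xi>
    have "jump_exp \<nu> (\<lambda>z. \<tau> * indicator (cball 0 s) z) r \<xi>
        = (LINT z|\<nu>. real n *\<^sub>R (v z *\<^sub>R comp_kernel r \<xi> z))"
      using n by (intro Bochner_Integration.integral_cong) (auto simp: v_def)
    also have "\<dots> = of_nat n * jump_exp \<nu> v r \<xi>"
      by (simp add: scaleR_conv_of_real)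
    finally show "G \<xi> = F \<xi> * \<phi> \<xi> ^ n"
      by (simp add: G_def \<phi>_def exp_of_nat_mult[symmetric])
  qed
  have S: "integrable lborel G \<and> (\<forall>x. 0 \<le> Re (inv_ft G x)) \<and>
    (\<forall>x. norm x \<le> e0 * q + real n * a / 2 \<longrightarrow> c * (H / (32 * real n)) ^ n \<le> Re (inv_ft G x))"
    unfolding Gn by (rule cf_seq_spread[OF F c Q re low up P \<gamma>])
  then show "integrable lborel G" "\<And>x. 0 \<le> Re (inv_ft G x)" by auto
  \<comment> \<open>Squared and written out, n a / 2 \<ge> L q is exactly the third inequality of
    \<open>par\<close>.\<close>
  have "L * q \<le> e0 * q + real n * a / 2"
  proof -
    have "(2 * K * L)^2 \<le> (\<kappa> * real n * sqrt \<eta>)^2"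
      using par(3) n \<eta> by (simp add: power_mult_distrib) (simp add: \<eta>_def power2_eq_square mult_ac)
    then have "2 * K * L \<le> \<kappa> * real n * sqrt \<eta>"
      by (rule power2_le_imp_le) (use \<kappa> n \<eta> in simp)
    then have "2 * K * L * (q / (2 * K)) \<le> \<kappa> * real n * sqrt \<eta> * (q / (2 * K))"
      using q K by (intro mult_right_mono) auto
    also have "\<dots> = real n * a / 2" by (simp add: a_def s(1) mult_ac)
    finally have "L * q \<le> real n * a / 2" using K by simp
    moreover have "0 \<le> e0 * q" using P by linarith
    ultimately show ?thesis by linarith
  qed
  then show "c * (H / (32 * real n)) ^ n \<le> Re (inv_ft G x)" if "norm x \<le> L * q" for x
    using S that order_trans by blast
qed

end

section \<open>Choice of the scales and combination of the three laws\<close>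

context levy_setup
begin

text \<open>The intensity budget: by the growth of the exponent the mean activity at scale \<kappa>
  q exceeds any prescribed constant once \<kappa> is small, so a share of it that equals
  \<open>H\<close> up to a constant can be split off.\<close>

lemma small_scale_h_nu:
  assumes cB: "cB = c3^2 * a1 / (9 * real DIM('a) * a2)"
    and t: "0 < t" and q: "0 < q" "1 / T3 < ereal (1 / q)" and h: "1 \<le> t * h_fun \<nu> q"
    and \<kappa>: "0 < \<kappa>" "\<kappa> \<le> 1" and H: "H \<le> a1 * cB / 2 * \<kappa> powr (- \<alpha>)"
  shows "H \<le> t * a1 * h_fun \<nu> (\<kappa> * q)"
proof -
  have cB0: "0 \<le> cB" using a1 a2 unfolding cB by simp
  obtain e :: 'a where e: "norm e = 1" using vector_choose_size[of 1] by auto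
  define \<xi> where "\<xi> = (1 / (\<kappa> * q)) *\<^sub>R e"
  have n: "norm \<xi> = 1 / (\<kappa> * q)" using e \<kappa> q by (simp add: \<xi>_def)
  then have nq: "norm \<xi> * q = 1 / \<kappa>" using q by simp
  have p: "(norm \<xi> * q) powr \<alpha> = \<kappa> powr (- \<alpha>)"
    unfolding nq using \<kappa> by (simp add: powr_divide powr_minus inverse_eq_divide)
  have "1 \<le> norm \<xi> * q" unfolding nq using \<kappa> by simp
  from Psi_nu_lower[OF q this]
  have "cB * \<kappa> powr (- \<alpha>) * h_fun \<nu> q \<le> Psi_s \<nu> \<xi>" unfolding p cB .
  also have "\<dots> \<le> 2 * h_fun \<nu> (\<kappa> * q)"
    using \<kappa> q n by (intro Psi_s_le_h_fun[OF \<nu>]) auto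
  finally have *: "cB * \<kappa> powr (- \<alpha>) * h_fun \<nu> q \<le> 2 * h_fun \<nu> (\<kappa> * q)" .
  have "a1 * cB / 2 * \<kappa> powr (- \<alpha>) * 1 \<le> a1 * cB / 2 * \<kappa> powr (- \<alpha>) * (t * h_fun \<nu> q)"
    using h cB0 a1 by (intro mult_left_mono) auto
  also have "\<dots> = t * a1 / 2 * (cB * \<kappa> powr (- \<alpha>) * h_fun \<nu> q)" by simp
  also have "\<dots> \<le> t * a1 / 2 * (2 * h_fun \<nu> (\<kappa> * q))"
    using * t a1 by (intro mult_left_mono) auto
  finally show ?thesis using H by simp
qed

text \<open>The density \<open>g\<close> of \<open>\<nu>\<close> is at most \<open>1 / a1\<close>,
  so each of the two symmetric parts takes a weight of at most t/2 and the remaining weight is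
  nonnegative.\<close>

lemma levy_split:
  assumes t: "0 < t" and r: "0 < r" and \<tau>: "0 < \<tau>" "\<tau> \<le> t * a1 / 2"
  shows "\<exists>w. w \<in> borel_measurable borel \<and> (\<forall>z. 0 \<le> w z \<and> w z \<le> t) \<and>
    (\<forall>\<xi>. of_real t * (LINT z|N. comp_kernel r \<xi> z) = jump_exp \<nu> (\<lambda>_. t * a1 / 2) r \<xi>
      + jump_exp \<nu> (\<lambda>z. \<tau> * indicator (cball 0 s) z) r \<xi> + jump_exp N w r \<xi>)"
proof -
  obtain g where g [measurable]: "g \<in> borel_measurable borel" and g0: "\<And>z. 0 \<le> g z" "\<And>z. a1 * g z \<le> 1"
    and eq: "\<nu> = density N (\<lambda>z. ennreal (g z))"
    using nu_density by auto
  note [measurable_cong] = levy_sets[OF N]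
  have [measurable]: "cball (0::'a) s \<in> sets borel" by simp
  let ?i = "\<lambda>z::'a. indicator (cball 0 s) z :: real"
  define u1 where "u1 = (\<lambda>z. g z * (t * a1 / 2))"
  define u2 where "u2 = (\<lambda>z. g z * (\<tau> * ?i z))"
  define w where "w = (\<lambda>z. t - u1 z - u2 z)"
  have m [measurable]: "u1 \<in> borel_measurable borel" "u2 \<in> borel_measurable borel"
    unfolding u1_def u2_def by measurable
  have mw: "w \<in> borel_measurable borel" unfolding w_def by measurable
  have u1: "0 \<le> u1 z" "u1 z \<le> t / 2" for z
  proof -
    show "0 \<le> u1 z" using g0 t a1 by (simp add: u1_def)
    have "t / 2 * (a1 * g z) \<le> t / 2 * 1" using g0 t by (intro mult_left_mono) auto
    then show "u1 z \<le> t / 2" by (simp add: u1_def mult_ac)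
  qed
  have u2: "0 \<le> u2 z" "u2 z \<le> t / 2" for z
  proof -
    show "0 \<le> u2 z" using g0 \<tau> by (simp add: u2_def)
    have "u2 z \<le> g z * (t * a1 / 2)" unfolding u2_def
      using g0 \<tau> t a1 by (intro mult_left_mono) (auto simp: indicator_def)
    then show "u2 z \<le> t / 2" using u1(2)[of z] by (simp add: u1_def)
  qed
  have w0: "0 \<le> w z" "w z \<le> t" for z using u1[of z] u2[of z] by (auto simp: w_def)
  have "of_real t * (LINT z|N. comp_kernel r \<xi> z) = jump_exp \<nu> (\<lambda>_. t * a1 / 2) r \<xi>
      + jump_exp \<nu> (\<lambda>z. \<tau> * ?i z) r \<xi> + jump_exp N w r \<xi>" for \<xi>
  proof -
    note i1 = integrable_comp_kernel[OF N r m(1) u1, of \<xi>]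
      and i2 = integrable_comp_kernel[OF N r m(2) u2, of \<xi>]
      and i3 = integrable_comp_kernel[OF N r mw w0, of \<xi>]
    have e1: "jump_exp \<nu> (\<lambda>_. t * a1 / 2) r \<xi> = jump_exp N u1 r \<xi>"
      unfolding eq u1_def by (subst integral_density) (auto simp: g0)
    have e2: "jump_exp \<nu> (\<lambda>z. \<tau> * ?i z) r \<xi> = jump_exp N u2 r \<xi>"
      unfolding eq u2_def by (subst integral_density) (auto simp: g0)
    have "of_real t * (LINT z|N. comp_kernel r \<xi> z) = (LINT z|N. t *\<^sub>R comp_kernel r \<xi> z)"
      by (simp add: scaleR_conv_of_real)
    also have "\<dots> = (LINT z|N. (u1 z *\<^sub>R comp_kernel r \<xi> z + u2 z *\<^sub>R comp_kernel r \<xi> z) + w z *\<^sub>R comp_kernel r \<xi> z)"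
      by (rule Bochner_Integration.integral_cong) (auto simp: w_def scaleR_left_distrib[symmetric])
    also have "\<dots> = jump_exp N u1 r \<xi> + jump_exp N u2 r \<xi>
       + jump_exp N w r \<xi>"
      using Bochner_Integration.integral_add[OF Bochner_Integration.integrable_add[OF i1 i2] i3]
        Bochner_Integration.integral_add[OF i1 i2] by simp
    finally show ?thesis unfolding e1 e2 .
  qed
  then show ?thesis using mw w0 by blast
qed

lemma density_lower_bound:
  fixes t q r :: real and n :: nat
  assumes base: "small_ball_bound TYPE('a) (a1 * k0^2) (a1 * cB / 2) \<alpha> c0 e0"
    and cB: "cB = c3^2 * a1 / (9 * real DIM('a) * a2)" and c0: "0 < c0"
    and k0: "1 \<le> k0" and \<theta>: "0 < \<theta>"
    and CN: "CN = 18 * real DIM('a) * a2 / c3 * k0^2" and R: "1 \<le> R" "18 * real DIM('a) * CN \<le> R"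
    and L: "L = (\<theta> + R) * k0"
    and K: "1 \<le> K" "36 * real DIM('a) * a2 \<le> c3^2 * a1 * K powr \<alpha>"
    and par: "1 \<le> H" "H \<le> real n" "8 * K^2 * L^2 \<le> real n * H * \<kappa>^2"
      "36 * (real DIM('a))^2 * \<kappa> * K \<le> e0 * sqrt (H / (2 * real n))" "6 * real DIM('a) * \<kappa> \<le> e0"
    and \<kappa>: "0 < \<kappa>" "\<kappa> \<le> 1" "H \<le> a1 * cB / 2 * \<kappa> powr (- \<alpha>)"
    and t: "0 < t" and r: "0 < r" and hr: "h_fun \<nu> r = 1 / t" and T3: "1 / T3 < ereal (k0 / r)"
    and x: "norm x \<le> \<theta> * r"
  shows "exp (- CN) * (c0 * (H / (32 * real n)) ^ n / 2) / (2 * pi) ^ DIM('a) * (1 / r) ^ DIM('a)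
     \<le> p t (x + t *\<^sub>R drift_r N b r)"
proof -
  let ?d = "DIM('a)"
  \<comment> \<open>The scale \<open>r\<close> itself may be too large for (C3); \<open>q\<close> is
    below the critical length and differs from \<open>r\<close> only by a constant factor.\<close>
  define q where "q = r / k0"
  have q: "0 < q" "q \<le> r" "k0 * q = r" "k0 / r = 1 / q"
    using r k0 by (auto simp: q_def field_simps)
  have T3q: "1 / T3 < ereal (1 / q)" using T3 q by simp
  have hq: "t * h_fun \<nu> q \<le> k0^2" "1 \<le> t * h_fun \<nu> q"
  proof -
    have "t * h_fun \<nu> q \<le> t * (k0^2 * h_fun \<nu> (k0 * q))"
      using t by (intro mult_left_mono h_fun_scale[OF \<nu> q(1) k0]) auto
    then show "t * h_fun \<nu> q \<le> k0^2" using t by (simp add: q(3) hr)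
    have "t * h_fun \<nu> r \<le> t * h_fun \<nu> q" using t by (intro mult_left_mono h_fun_antimono[OF \<nu> q(1,2)]) auto
    then show "1 \<le> t * h_fun \<nu> q" using t by (simp add: hr)
  qed
  have hN: "t * h_fun N r \<le> CN"
  proof -
    have "t * h_fun N r \<le> t * h_fun N q" using t by (intro mult_left_mono h_fun_antimono[OF N q(1,2)]) auto
    also have "\<dots> = t / c3 * (c3 * h_fun N q)" using C3(2) by simp
    also have "\<dots> \<le> t / c3 * (18 * real ?d * a2 * h_fun \<nu> q)"
      using t C3(2) by (intro mult_left_mono h_N_upper[OF q(1) T3q]) auto
    also have "\<dots> = 18 * real ?d * a2 / c3 * (t * h_fun \<nu> q)" by simp
    also have "\<dots> \<le> CN" unfolding CN using hq a2 C3(2) by (intro mult_left_mono) auto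
    finally show ?thesis .
  qed
  define s where "s = \<kappa> * q"
  have s0: "0 < s" using \<kappa> q by (simp add: s_def)
  have "s \<le> q" using \<kappa> q by (simp add: s_def)
  then have "1 / q \<le> 1 / s" using s0 by (intro divide_left_mono) auto
  then have T3s: "1 / T3 < ereal (1 / s)" using T3q by (meson ereal_less_eq(3) order_less_le_trans)
  have hs: "H \<le> t * a1 * h_fun \<nu> s"
    unfolding s_def by (rule small_scale_h_nu[OF cB t q(1) T3q hq(2) \<kappa>])
  have hs0: "0 < h_fun \<nu> s" by (rule h_nu_pos[OF s0])
  define \<tau> where "\<tau> = H / (2 * h_fun \<nu> s)"
  have \<tau>: "0 < \<tau>" "\<tau> \<le> t * a1 / 2" "\<tau> * h_fun \<nu> s = H / 2"
    using hs hs0 par(1) by (auto simp: \<tau>_def field_simps)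
  obtain w where w: "w \<in> borel_measurable borel" "\<And>z. 0 \<le> w z" "\<And>z. w z \<le> t"
    and split: "\<And>\<xi>. of_real t * (LINT z|N. comp_kernel r \<xi> z) = jump_exp \<nu> (\<lambda>_. t * a1 / 2) r \<xi>
      + jump_exp \<nu> (\<lambda>z. \<tau> * indicator (cball 0 s) z) r \<xi> + jump_exp N w r \<xi>"
    using levy_split[OF t r \<tau>(1,2), of s] by auto
  have L0: "0 < L" using \<theta> R k0 unfolding L by simp
  \<comment> \<open>The second law has to fill the target radius \<theta> r together with the margin
    R r that the remaining jumps will consume.\<close>
  have Lq: "L * q = (\<theta> + R) * r" unfolding L using q(3) by (simp add: mult_ac)
  define c where "c = c0 * (1 / q) ^ ?d"
  have c: "0 \<le> c" using c0 q by (simp add: c_def)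
  define m where "m = exp (- CN) * (c * (H / (32 * real n)) ^ n / 2)"
  let ?Q = "density lborel (\<lambda>y. ennreal (p t y))"
  let ?a = "t *\<^sub>R drift_r N b r"
  \<comment> \<open>The bound \<open>m\<close> is free of \<open>eps\<close>; the range
    \<open>eps \<le> q^2\<close> comes from \<open>small_ball_bound\<close> and suffices for the
    passage to the density.\<close>
  have key: "m \<le> Re (inv_ft (\<lambda>\<xi>. of_real (gauss eps \<xi>) * char_fn ?Q \<xi>) (x + ?a))"
    if eps: "0 < eps" "eps \<le> q^2" for eps
  proof -
    define F where "F = (\<lambda>\<xi>. complex_of_real (exp (- (t * a1 / 2 * Psi_s \<nu> \<xi>)) * gauss eps \<xi>))"
    note F = base_part[OF base cB t q(1) T3q r hq eps, folded F_def]
    have F4: "F \<xi> = of_real (gauss eps \<xi>) * exp (- jump_exp \<nu> (\<lambda>_. t * a1 / 2) r \<xi>)" for \<xi>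
      unfolding F_def by (rule base_part(4)[OF base cB t q(1) T3q r hq eps])
    have exp3: "exp (- (u + v + w)) = exp (- u) * (exp (- v) * exp (- w))" for u v w :: complex
      by (simp add: mult_exp_exp algebra_simps)
    define G where "G = (\<lambda>\<xi>. F \<xi> * exp (- jump_exp \<nu> (\<lambda>z. \<tau> * indicator (cball 0 s) z) r \<xi>))"
    note G = spread_part[OF F(1,2,3)[folded c_def] c q(1) r \<kappa>(1) s_def T3s K \<tau>(1,3) par L0, folded G_def]
    have cn: "0 \<le> c * (H / (32 * real n)) ^ n" using c par by simp
    have "m \<le> Re (inv_ft (\<lambda>\<xi>. G \<xi> * exp (- jump_exp N w r \<xi>)) x)"
      unfolding m_def
      by (rule jumps_lower_bound[OF N r t hN w G(1,2) G(3)[unfolded Lq] cn R x])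
    also have "(\<lambda>\<xi>. G \<xi> * exp (- jump_exp N w r \<xi>))
       = (\<lambda>\<xi>. of_real (gauss eps \<xi>) * char_fn ?Q \<xi> * cis (- (\<xi> \<bullet> ?a)))"
    proof
      fix \<xi>
      have "G \<xi> * exp (- jump_exp N w r \<xi>)
         = of_real (gauss eps \<xi>) * exp (- (of_real t * (LINT z|N. comp_kernel r \<xi> z)))"
        unfolding G_def F4 split exp3 by (simp only: mult.assoc)
      \<comment> \<open>Changing the truncation radius from 1 to \<open>r\<close> leaves a phase
        which is exactly the translation by \<open>?a\<close>; this is how the drift enters.\<close>
      also have "\<dots> = of_real (gauss eps \<xi>) * char_fn ?Q \<xi> * cis (- (\<xi> \<bullet> ?a))"
        unfolding levy_density_prob(2)[OF dens t] comp_kernel_drift[OF N r, of \<xi> b] cis_conv_exp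
        by (simp add: exp_add[symmetric] mult.assoc algebra_simps)
      finally show "G \<xi> * exp (- jump_exp N w r \<xi>)
         = of_real (gauss eps \<xi>) * char_fn ?Q \<xi> * cis (- (\<xi> \<bullet> ?a))" .
    qed
    finally show ?thesis unfolding inv_ft_shift .
  qed
  have "m \<le> (2 * pi) ^ ?d * p t (x + ?a)"
  proof (rule gauss_inversion_lower_bound)
    show "continuous_on UNIV (p t)" "\<And>y. 0 \<le> p t y" using dens t by (auto simp: levy_density_def)
    show "borel_prob ?Q" by (rule levy_density_prob(1)[OF dens t])
    show "0 < q^2" using q by simp
  qed (rule key)
  then have "m / (2 * pi) ^ ?d \<le> p t (x + ?a)" by (simp add: pos_divide_le_eq mult.commute)
  moreover have "exp (- CN) * (c0 * (H / (32 * real n)) ^ n / 2) / (2 * pi) ^ ?d * (1 / r) ^ ?d \<le> m / (2 * pi) ^ ?d"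
  proof -
    have "(1 / r) ^ ?d \<le> (1 / q) ^ ?d" using q r by (intro power_mono divide_left_mono) auto
    then have "exp (- CN) * (c0 * (H / (32 * real n)) ^ n / 2) / (2 * pi) ^ ?d * (1 / r) ^ ?d
       \<le> exp (- CN) * (c0 * (H / (32 * real n)) ^ n / 2) / (2 * pi) ^ ?d * (1 / q) ^ ?d"
      using c0 par by (intro mult_left_mono) auto
    also have "\<dots> = m / (2 * pi) ^ ?d" by (simp add: m_def c_def mult_ac)
    finally show ?thesis .
  qed
  ultimately show ?thesis by linarith
qed

end

text \<open>The constant precedes the process, \<open>T3\<close> and \<open>\<nu>\<close> in the
  quantifiers: the dependence on the last two is channelled through \<open>k0\<close>. Constants are
  fixed in the order \<open>CN\<close>, \<open>R\<close>, \<open>L\<close>, \<open>K\<close>, then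
  \<open>c0\<close> and \<open>e0\<close>, and finally \<open>H\<close>, \<open>\<kappa>\<close>,
  \<open>n\<close>.\<close>

lemma uniform_density_lower_bound:
  fixes c3 \<alpha> a1 a2 k0 \<theta> :: real
  assumes c3: "0 < c3" and \<alpha>: "0 < \<alpha>" and a1: "0 < a1" and a2: "1 \<le> a2" and k0: "1 \<le> k0" and \<theta>: "0 < \<theta>"
  shows "\<exists>c>0. \<forall>N b p T3 \<nu> t r. \<forall>x::'a::euclidean_space. levy_setup N b p T3 c3 \<alpha> a1 a2 \<nu> \<longrightarrow> 0 < t \<longrightarrow> 0 < r \<longrightarrow>
     h_fun \<nu> r = 1 / t \<longrightarrow> 1 / T3 < ereal (k0 / r) \<longrightarrow> norm x \<le> \<theta> * r \<longrightarrow>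
     c * (1 / r) ^ DIM('a) \<le> p t (x + t *\<^sub>R drift_r N b r)"
proof -
  let ?d = "real DIM('a)"
  have d: "1 \<le> ?d" using DIM_positive[where 'a='a] by linarith
  define cB where "cB = c3^2 * a1 / (9 * ?d * a2)"
  have cB: "0 < cB" using c3 a1 a2 d by (simp add: cB_def)
  define CN where "CN = 18 * ?d * a2 / c3 * k0^2"
  have CN: "0 \<le> CN" using c3 a2 by (simp add: CN_def)
  define R where "R = 18 * ?d * CN + 1"
  have R: "1 \<le> R" "18 * ?d * CN \<le> R" using CN by (auto simp: R_def)
  define L where "L = (\<theta> + R) * k0"
  have L: "0 < L" using \<theta> R k0 by (simp add: L_def)
  \<comment> \<open>The smallest value with \<open>K \<ge> 1\<close> that satisfies the requirement
    of \<open>small_Psi_lower\<close>.\<close>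
  define K where "K = max 1 ((36 * ?d * a2 / (c3^2 * a1)) powr (1 / \<alpha>))"
  have K: "1 \<le> K" "36 * ?d * a2 \<le> c3^2 * a1 * K powr \<alpha>"
  proof -
    show "1 \<le> K" by (simp add: K_def)
    have "36 * ?d * a2 / (c3^2 * a1) = ((36 * ?d * a2 / (c3^2 * a1)) powr (1 / \<alpha>)) powr \<alpha>"
      using \<alpha> c3 a1 a2 d by (simp add: powr_powr)
    also have "\<dots> \<le> K powr \<alpha>" using \<alpha> by (intro powr_mono2) (auto simp: K_def)
    finally show "36 * ?d * a2 \<le> c3^2 * a1 * K powr \<alpha>"
      using c3 a1 by (simp add: pos_divide_le_eq mult_ac)
  qed
  have "0 < a1 * cB / 2" using a1 cB by simp
  obtain c0 e0 where c0: "0 < c0" and e0: "0 < e0"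
    and base: "small_ball_bound TYPE('a) (a1 * k0^2) (a1 * cB / 2) \<alpha> c0 e0"
    using small_ball_bound_exists[OF \<open>0 < a1 * cB / 2\<close> \<alpha>, of "a1 * k0^2", where 'a='a] by blast
  obtain H \<kappa> and n :: nat where par: "1 \<le> H" "0 < \<kappa>" "\<kappa> \<le> 1" "H \<le> real n" "8 * K^2 * L^2 \<le> real n * H * \<kappa>^2"
    "36 * ?d^2 * \<kappa> * K \<le> e0 * sqrt (H / (2 * real n))" "6 * ?d * \<kappa> \<le> e0" "H \<le> a1 * cB / 2 * \<kappa> powr (- \<alpha>)"
    using spread_parameters[OF K(1) L e0 \<open>0 < a1 * cB / 2\<close> \<alpha> d] by blast
  define c where "c = exp (- CN) * (c0 * (H / (32 * real n)) ^ n / 2) / (2 * pi) ^ DIM('a)"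
  have "0 < real n" using par by linarith
  then have c: "0 < c" using c0 par(1) by (simp add: c_def)
  have "c * (1 / r) ^ DIM('a) \<le> p t (x + t *\<^sub>R drift_r N b r)"
    if "levy_setup N b p T3 c3 \<alpha> a1 a2 \<nu>" "0 < t" "0 < r" "h_fun \<nu> r = 1 / t" "1 / T3 < ereal (k0 / r)" "norm x \<le> \<theta> * r"
    for N b p T3 \<nu> t r and x :: 'a
    unfolding c_def
    by (rule levy_setup.density_lower_bound[OF that(1) base cB_def c0 k0 \<theta> CN_def R L_def K par(1,4-7,2,3,8) that(2-6)])
  then show ?thesis using c by blast
qed

theorem theorem4p3:
  fixes T3 :: ereal and c3 \<alpha>3 a1 a2 :: real and \<nu>s :: "'a::euclidean_space measure"
  assumes "0 < T3" "0 < c3" "c3 \<le> 1" "0 < \<alpha>3" "\<alpha>3 \<le> 2"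
    and "levy_measure \<nu>s" "symmetric_measure \<nu>s"
    and "0 < a1" "a1 \<le> 1" "1 \<le> a2"
  shows "(\<forall>T>0. \<forall>\<theta>>0. \<exists>c>0. \<forall>(N::'a measure) b p.
            thm43_hyps N b p T3 c3 \<alpha>3 \<nu>s a1 a2 \<longrightarrow>
            (\<forall>t x. 0 < t \<and> t < T \<and> norm x \<le> \<theta> * h_inv \<nu>s (1 / t) \<longrightarrow>
               p t (x + t *\<^sub>R drift_r N b (h_inv \<nu>s (1 / t)))
                 \<ge> c * h_inv \<nu>s (1 / t) powr (- real DIM('a))))
       \<and> (T3 = \<infinity> \<longrightarrow>
          (\<forall>\<theta>>0. \<exists>c>0. \<forall>(N::'a measure) b p.
            thm43_hyps N b p T3 c3 \<alpha>3 \<nu>s a1 a2 \<longrightarrow>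
            (\<forall>t x. 0 < t \<and> norm x \<le> \<theta> * h_inv \<nu>s (1 / t) \<longrightarrow>
               p t (x + t *\<^sub>R drift_r N b (h_inv \<nu>s (1 / t)))
                 \<ge> c * h_inv \<nu>s (1 / t) powr (- real DIM('a)))))"
proof -
  let ?P = "\<lambda>(N::'a measure) b p. thm43_hyps N b p T3 c3 \<alpha>3 \<nu>s a1 a2"
  have inst: "levy_setup N b p T3 c3 \<alpha>3 a1 a2 \<nu>s" if "?P N b p" for N b p
    using that assms by unfold_locales auto
  \<comment> \<open>Both claims are instances of this one: \<open>S\<close> collects the admissible
    times, and \<open>k0\<close> must bring the scale of every such time below the critical
    length.\<close>
  have bound: "\<exists>c>0. \<forall>(N::'a measure) b p. ?P N b p \<longrightarrow>
      (\<forall>t x. 0 < t \<and> t \<in> S \<and> norm x \<le> \<theta> * h_inv \<nu>s (1 / t) \<longrightarrow>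
         p t (x + t *\<^sub>R drift_r N b (h_inv \<nu>s (1 / t))) \<ge> c * h_inv \<nu>s (1 / t) powr (- real DIM('a)))"
    if \<theta>: "0 < \<theta>" and k0: "1 \<le> k0"
      and scale: "\<And>t r. 0 < t \<Longrightarrow> t \<in> S \<Longrightarrow> 0 < r \<Longrightarrow> h_fun \<nu>s r = 1 / t \<Longrightarrow> 1 / T3 < ereal (k0 / r)"
    for \<theta> k0 and S :: "real set"
  proof -
    obtain c where c: "0 < c" and low: "\<And>N b p T3 \<nu> t r x. levy_setup N b p T3 c3 \<alpha>3 a1 a2 \<nu> \<Longrightarrow> 0 < t \<Longrightarrow> 0 < r \<Longrightarrow>
       h_fun \<nu> r = 1 / t \<Longrightarrow> 1 / T3 < ereal (k0 / r) \<Longrightarrow> norm (x::'a) \<le> \<theta> * r \<Longrightarrow>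
       c * (1 / r) ^ DIM('a) \<le> p t (x + t *\<^sub>R drift_r N b r)"
      using uniform_density_lower_bound[OF assms(2,4,8,10) k0 \<theta>, where 'a='a] by blast
    have "c * h_inv \<nu>s (1 / t) powr (- real DIM('a)) \<le> p t (x + t *\<^sub>R drift_r N b (h_inv \<nu>s (1 / t)))"
      if P: "?P N b p" and t: "0 < t" "t \<in> S" and x: "norm x \<le> \<theta> * h_inv \<nu>s (1 / t)" for N b p t and x :: 'a
    proof -
      interpret levy_setup N b p T3 c3 \<alpha>3 a1 a2 \<nu>s by (rule inst[OF P])
      define r where "r = h_inv \<nu>s (1 / t)"
      have r: "0 < r" "h_fun \<nu>s r = 1 / t" using h_inv_nu[of "1 / t"] t by (auto simp: r_def)
      have "r powr (- real DIM('a)) = (1 / r) ^ DIM('a)"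
        using r by (simp add: powr_minus powr_realpow power_divide inverse_eq_divide)
      then show ?thesis
        using low[OF inst[OF P] t(1) r scale[OF t r] x[folded r_def]] by (simp add: r_def)
    qed
    then show ?thesis using c by blast
  qed
  have fin: "\<exists>c>0. \<forall>(N::'a measure) b p. ?P N b p \<longrightarrow>
      (\<forall>t x. 0 < t \<and> t < T \<and> norm x \<le> \<theta> * h_inv \<nu>s (1 / t) \<longrightarrow>
         p t (x + t *\<^sub>R drift_r N b (h_inv \<nu>s (1 / t))) \<ge> c * h_inv \<nu>s (1 / t) powr (- real DIM('a)))"
    if T: "0 < T" and \<theta>: "0 < \<theta>" for T \<theta>
  proof -
    \<comment> \<open>For t < T the value of \<open>h_fun\<close> at r exceeds 1/T, so r stays below
      a number determined by \<open>\<nu>s\<close> and \<open>T\<close>. Dividing that number by a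
      finite \<open>T3\<close> gives \<open>k0\<close>. For infinite \<open>T3\<close> the threshold
      \<open>1 / T3\<close> is 0 and \<open>k0 = 1\<close> works for all times.\<close>
    have "\<exists>k0\<ge>1. \<forall>t r. 0 < t \<longrightarrow> t < T \<longrightarrow> 0 < r \<longrightarrow> h_fun \<nu>s r = 1 / t \<longrightarrow> 1 / T3 < ereal (k0 / r)"
    proof (cases T3)
      case (real y)
      then have y: "0 < y" using assms(1) by simp
      obtain n where n: "h_fun \<nu>s (real (Suc n)) < 1 / T"
        using order_tendstoD(2)[OF h_fun_at_infinity[OF assms(6)], of "1 / T"] T
        by (auto simp: eventually_sequentially)
      define k0 where "k0 = max 1 (real (Suc n) / y)"
      have "1 / T3 < ereal (k0 / r)" if "0 < t" "t < T" "0 < r" "h_fun \<nu>s r = 1 / t" for t r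
      proof -
        have "1 / T < 1 / t" using that by (intro divide_strict_left_mono) auto
        then have "h_fun \<nu>s (real (Suc n)) < h_fun \<nu>s r" using n that by simp
        then have "r < real (Suc n)"
          using h_fun_antimono[OF assms(6), of "real (Suc n)" r] by force
        also have "\<dots> = y * (real (Suc n) / y)" using y by simp
        also have "\<dots> \<le> y * k0" using y by (intro mult_left_mono) (auto simp: k0_def)
        finally have "1 / y < k0 / r" using y that by (simp add: field_simps)
        then show ?thesis using real y by (simp add: one_ereal_def)
      qed
      then show ?thesis by (intro exI[of _ k0]) (auto simp: k0_def)
    next
      case PInf
      then show ?thesis by (intro exI[of _ 1]) auto
    qed (use assms(1) in auto)
    then show ?thesis using bound[OF \<theta>, of _ "{..<T}"] by auto
  qed
  moreover have "\<exists>c>0. \<forall>(N::'a measure) b p. ?P N b p \<longrightarrow>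
      (\<forall>t x. 0 < t \<and> norm x \<le> \<theta> * h_inv \<nu>s (1 / t) \<longrightarrow>
         p t (x + t *\<^sub>R drift_r N b (h_inv \<nu>s (1 / t))) \<ge> c * h_inv \<nu>s (1 / t) powr (- real DIM('a)))"
    if "T3 = \<infinity>" "0 < \<theta>" for \<theta>
    using bound[OF that(2), of 1 UNIV] that(1) by simp
  ultimately show ?thesis by blast
qed

end
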